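(* Let $\mathbf{A}_0,\mathbf{A}_1,\mathbf{A}_2\in\mathbb{R}^{n\times n}[x]$, $E\in\mathbb{R}^{2n\times 4n}$ and $\mathbf{F}\in\mathbb{R}^{2n\times n}[x]$. Let $X$, $Y$, $m$, $\mathcal{T}$, $\mathcal{R}$, $\mathcal{F}$, $\mathcal{K}$ and $\mathscr{D}$ be the spaces and operators associated with $\{E,\mathbf{F}\}$ as defined in the context, let $$\mathcal{A}\mathbf{v}:=\mathbf{A}_0\,(\mathcal{T}\mathbf{v})+\mathbf{A}_1\,(\mathcal{R}\mathbf{v})+\mathbf{A}_2\,\mathbf{v}_1,\qquad \mathbf{v}=\begin{bmatrix}v_0\\ \mathbf{v}_1\end{bmatrix}\in\mathbb{R}^m\times L_2^n[a,b],$$ (pointwise multiplication by the matrix polynomials $\mathbf{A}_i(x)$), and let $$\hat{\mathcal{T}}\begin{bmatrix}v_0\\ \mathbf{v}_1\end{bmatrix}:=\begin{bmatrix}v_0\\ \mathcal{T}\mathbf{v}\end{bmatrix},\qquad \hat{\mathcal{A}}\mathbf{v}:=\begin{bmatrix}\mathcal{F}\mathcal{A}\mathbf{v}\\ \mathcal{A}\mathbf{v}\end{bmatrix}.$$ Then: 1. If $\mathbf{u}$ solves the PDE defined by $\{\mathbf{A}_i,E,\mathbf{F}\}$ with initial state $\mathbf{u}^0\in X$, then $\mathbf{v}:=\mathscr{D}\mathbf{u}$ solves the PIE defined by $\{\hat{\mathcal{T}},\hat{\mathcal{A}},\mathcal{K}\}$ with initial state $\mathbf{v}^0:=\mathscr{D}\mathbf{u}^0$.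 2. If $\mathbf{v}$ solves the PIE defined by $\{\hat{\mathcal{T}},\hat{\mathcal{A}},\mathcal{K}\}$ with initial state $\mathbf{v}^0$, then $\mathbf{u}:=\mathcal{T}\mathbf{v}$ solves the PDE defined by $\{\mathbf{A}_i,E,\mathbf{F}\}$ with initial state $\mathbf{u}^0:=\mathcal{T}\mathbf{v}^0$.
   Context: $[a,b]\subset\mathbb{R}$ is a given interval and $n\ge1$ is an integer. $\mathbb{R}^{k\times l}[x]$ denotes the $k\times l$ matrix-valued real polynomials in $x$. $L_2^n[a,b]$ is the Hilbert space of square-integrable $\mathbb{R}^n$-valued functions on $[a,b]$ (similarly $L_2^{k\times l}[a,b]$ for matrix-valued functions), and $W_2^{2,n}[a,b]:=\{\mathbf{u}\in L_2^n[a,b]\mid \mathbf{u}_x,\mathbf{u}_{xx}\in L_2^n[a,b]\}$. Blocks with zero rows or columns are understood to be empty, and $[\cdot;\cdot]$ denotes vertical stacking. For $E\in\mathbb{R}^{k\times 4n}$ and $\mathbf{F}\in L_2^{k\times n}[a,b]$ (any $k$), define $$G_{E,\mathbf{F}}:=E\begin{bmatrix}I_n&0_n\\ I_n&(b-a)I_n\\ 0_n&I_n\\ 0_n&I_n\end{bmatrix}+\int_a^b\mathbf{F}(x)\begin{bmatrix}I_n&(x-a)I_n\end{bmatrix}dx,\qquad \mathbf{H}_{E,\mathbf{F}}(x):=-E\begin{bmatrix}0_n\\ (b-x)I_n\\ 0_n\\ I_n\end{bmatrix}-\int_x^b(\theta-x)\mathbf{F}(\theta)\,d\theta.$$ Spaces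 and operators associated with $\{E,\mathbf{F}\}$, $E\in\mathbb{R}^{2n\times4n}$, $\mathbf{F}\in\mathbb{R}^{2n\times n}[x]$: - $X:=\{\mathbf{u}\in W_2^{2,n}[a,b]\mid E\,[\mathbf{u}(a);\mathbf{u}(b);\mathbf{u}_x(a);\mathbf{u}_x(b)]+\int_a^b\mathbf{F}(x)\mathbf{u}(x)dx=0\}$. - $0\le m\le 2n$ and an invertible $J\in\mathbb{R}^{2n\times2n}$ are such that, with $E_1,\mathbf{F}_1$ the first $2n-m$ rows and $E_2,\mathbf{F}_2$ the last $m$ rows of $JE,J\mathbf{F}$, $G_{E_1,\mathbf{F}_1}$ has full row rank and $G_{E_2,\mathbf{F}_2}=0_{m\times2n}$ (such $m$ and $J$ always exist). - $\mathcal{K}:\mathbb{R}^m\times L_2^n[a,b]\to\mathbb{R}^m$, $\mathcal{K}[v_0;\mathbf{v}_1]:=\int_a^b\mathbf{H}_{E_2,\mathbf{F}_2}(x)\mathbf{v}_1(x)dx$, and $Y:=\{\mathbf{v}\in\mathbb{R}^m\times L_2^n[a,b]\mid\mathcal{K}\mathbf{v}=0\}$. - $\mathbf{F}_3\in L_2^{m\times n}[a,b]$ is such that $\hat G:=G_{[E_1;0_{m\times4n}],[\mathbf{F}_1;\mathbf{F}_3]}\in\mathbb{R}^{2n\times2n}$ is invertible; $\hat{\mathbf{H}}:=\mathbf{H}_{[E_1;0_{m\times4n}],[\mathbf{F}_1;\mathbf{F}_3]}$. - $\mathbf{T}_0(x):=\begin{bmatrix}I_n&(x-a)I_n\end{bmatrix}\hat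 G^{-1}\begin{bmatrix}0_{(2n-m)\times m}\\ I_m\end{bmatrix}$ and $\mathbf{T}_1(x,\theta):=\begin{bmatrix}I_n&(x-a)I_n\end{bmatrix}\hat G^{-1}\hat{\mathbf{H}}(\theta)$. - $\mathcal{F}:L_2^n[a,b]\to\mathbb{R}^m$, $\mathcal{F}\mathbf{u}:=\int_a^b\mathbf{F}_3(x)\mathbf{u}(x)dx$, and $\mathscr{D}\mathbf{u}:=[\mathcal{F}\mathbf{u};\mathbf{u}_{xx}]$. - For $\mathbf{v}=[v_0;\mathbf{v}_1]\in\mathbb{R}^m\times L_2^n[a,b]$: $(\mathcal{T}\mathbf{v})(x):=\mathbf{T}_0(x)v_0+\int_a^b\mathbf{T}_1(x,\theta)\mathbf{v}_1(\theta)d\theta+\int_a^x(x-\theta)\mathbf{v}_1(\theta)d\theta$ and $(\mathcal{R}\mathbf{v})(x):=\partial_x\mathbf{T}_0(x)v_0+\int_a^b\partial_x\mathbf{T}_1(x,\theta)\mathbf{v}_1(\theta)d\theta+\int_a^x\mathbf{v}_1(\theta)d\theta$. PDE solution: $\mathbf{u}$ is a solution to the PDE defined by $\{\mathbf{A}_i,E,\mathbf{F}\}$ with initial state $\mathbf{u}^0\in X$ if $\mathbf{u}(t)$ is Fréchet differentiable, $\mathbf{u}(0)=\mathbf{u}^0$, and for all $t\ge0$, $\mathbf{u}(t)\in X$ and $\mathbf{u}_t(t,x)=\mathbf{A}_0(x)\mathbf{u}(t,x)+\mathbf{A}_1(x)\mathbf{u}_x(t,x)+\mathbf{A}_2(x)\mathbf{u}_{xx}(t,x)$.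 PIE (Partial Integral Equation) solution: $\mathbf{v}$ solves the PIE defined by $\{\hat{\mathcal{T}},\hat{\mathcal{A}},\mathcal{K}\}$ with initial state $\mathbf{v}^0\in Y$ if $\mathbf{v}(t)$ is Fréchet differentiable, $\mathbf{v}(0)=\mathbf{v}^0$, and for all $t\ge0$, $\mathbf{v}(t)\in Y$ and $\partial_t\hat{\mathcal{T}}\mathbf{v}(t)=\hat{\mathcal{A}}\mathbf{v}(t)$. *)

theory Defs
  imports
    "HOL-Analysis.Equivalence_Lebesgue_Henstock_Integration"
    "HOL-Analysis.Smooth_Paths"
    "Jordan_Normal_Form.Gauss_Jordan_Elimination"
    "Jordan_Normal_Form.DL_Rank"
begin

text \<open>
  Dimensions such as \<open>2n - m\<close> and \<open>m\<close> may be zero, so vectors and matrices are those of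
  \<^theory>\<open>Jordan_Normal_Form.Matrix\<close>, with their dimensions given by \<open>carrier_vec\<close> and \<open>carrier_mat\<close>.
  An element of \<open>L\<^sub>2\<close> is represented by a function, and two functions represent the same element
  iff they agree almost everywhere on \<open>[a,b]\<close>; values outside \<open>[a,b]\<close> are irrelevant.
\<close>


subsection \<open>Integration and square-integrable functions\<close>

definition vec_integral :: "real \<Rightarrow> real \<Rightarrow> nat \<Rightarrow> (real \<Rightarrow> real vec) \<Rightarrow> real vec" where
  "vec_integral a b k f = vec k (\<lambda>i. \<integral>x. f x $ i \<partial>lebesgue_on {a..b})"

definition mat_integral :: "real \<Rightarrow> real \<Rightarrow> nat \<Rightarrow> nat \<Rightarrow> (real \<Rightarrow> real mat) \<Rightarrow> real mat" where
  "mat_integral a b k l M = mat k l (\<lambda>(i, j). \<integral>x. M x $$ (i, j) \<partial>lebesgue_on {a..b})"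

definition square_integrable :: "real \<Rightarrow> real \<Rightarrow> (real \<Rightarrow> real) \<Rightarrow> bool" where
  "square_integrable a b f \<longleftrightarrow>
     f \<in> borel_measurable (lebesgue_on {a..b}) \<and> integrable (lebesgue_on {a..b}) (\<lambda>x. (f x)\<^sup>2)"

definition L2_vec :: "real \<Rightarrow> real \<Rightarrow> nat \<Rightarrow> (real \<Rightarrow> real vec) set" where
  "L2_vec a b k = {f. (\<forall>x\<in>{a..b}. f x \<in> carrier_vec k) \<and>
                      (\<forall>i<k. square_integrable a b (\<lambda>x. f x $ i))}"

definition L2_mat :: "real \<Rightarrow> real \<Rightarrow> nat \<Rightarrow> nat \<Rightarrow> (real \<Rightarrow> real mat) set" where
  "L2_mat a b k l = {M. (\<forall>x\<in>{a..b}. M x \<in> carrier_mat k l) \<and>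
                        (\<forall>i<k. \<forall>j<l. square_integrable a b (\<lambda>x. M x $$ (i, j)))}"

definition L2_norm :: "real \<Rightarrow> real \<Rightarrow> nat \<Rightarrow> (real \<Rightarrow> real vec) \<Rightarrow> real" where
  "L2_norm a b k f = sqrt (\<Sum>i<k. \<integral>x. (f x $ i)\<^sup>2 \<partial>lebesgue_on {a..b})"

definition ae_eq :: "real \<Rightarrow> real \<Rightarrow> (real \<Rightarrow> real vec) \<Rightarrow> (real \<Rightarrow> real vec) \<Rightarrow> bool" where
  "ae_eq a b f g \<longleftrightarrow> (AE x in lebesgue_on {a..b}. f x = g x)"


subsection \<open>The Sobolev space \<open>W\<^sub>2\<^sup>2\<close> on an interval\<close>

text \<open>
  Weak derivatives are tested against compactly supported \<open>C\<^sup>1\<close> functions; on an interval this gives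
  the same notion as \<open>C\<^sup>\<infinity>\<close> test functions.
\<close>

definition test_function :: "real \<Rightarrow> real \<Rightarrow> (real \<Rightarrow> real) \<Rightarrow> bool" where
  "test_function a b \<phi> \<longleftrightarrow> \<phi> C1_differentiable_on UNIV \<and>
     compact (closure {x. \<phi> x \<noteq> 0}) \<and> closure {x. \<phi> x \<noteq> 0} \<subseteq> {a<..<b}"

definition has_weak_deriv ::
    "real \<Rightarrow> real \<Rightarrow> nat \<Rightarrow> (real \<Rightarrow> real vec) \<Rightarrow> (real \<Rightarrow> real vec) \<Rightarrow> bool" where
  "has_weak_deriv a b k f g \<longleftrightarrow> f \<in> L2_vec a b k \<and> g \<in> L2_vec a b k \<and>
     (\<forall>\<phi>. test_function a b \<phi> \<longrightarrow> (\<forall>i<k.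
        (\<integral>x. f x $ i * deriv \<phi> x \<partial>lebesgue_on {a..b}) = - (\<integral>x. g x $ i * \<phi> x \<partial>lebesgue_on {a..b})))"

definition weak_deriv :: "real \<Rightarrow> real \<Rightarrow> nat \<Rightarrow> (real \<Rightarrow> real vec) \<Rightarrow> real \<Rightarrow> real vec" where
  "weak_deriv a b k f = (SOME g. has_weak_deriv a b k f g)"

abbreviation weak_deriv2 :: "real \<Rightarrow> real \<Rightarrow> nat \<Rightarrow> (real \<Rightarrow> real vec) \<Rightarrow> real \<Rightarrow> real vec" where
  "weak_deriv2 a b k f \<equiv> weak_deriv a b k (weak_deriv a b k f)"

definition W22 :: "real \<Rightarrow> real \<Rightarrow> nat \<Rightarrow> (real \<Rightarrow> real vec) set" where
  "W22 a b k = {u \<in> L2_vec a b k. \<exists>g h. has_weak_deriv a b k u g \<and> has_weak_deriv a b k g h}"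

definition W22_norm :: "real \<Rightarrow> real \<Rightarrow> nat \<Rightarrow> (real \<Rightarrow> real vec) \<Rightarrow> real" where
  "W22_norm a b k u = sqrt ((L2_norm a b k u)\<^sup>2 + (L2_norm a b k (weak_deriv a b k u))\<^sup>2
                            + (L2_norm a b k (weak_deriv2 a b k u))\<^sup>2)"

text \<open>The point values of \<open>u\<close> and \<open>u\<^sub>x\<close> for \<open>u \<in> W\<^sub>2\<^sup>2\<close> are those of the continuous representative.\<close>

definition cont_rep :: "real \<Rightarrow> real \<Rightarrow> nat \<Rightarrow> (real \<Rightarrow> real vec) \<Rightarrow> real \<Rightarrow> real vec" where
  "cont_rep a b k f = (SOME g. (\<forall>x\<in>{a..b}. g x \<in> carrier_vec k) \<and>
     (\<forall>i<k. continuous_on {a..b} (\<lambda>x. g x $ i)) \<and> ae_eq a b g f)"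


subsection \<open>Polynomial matrices and block matrices\<close>

definition eval_pmat :: "real poly mat \<Rightarrow> real \<Rightarrow> real mat" where
  "eval_pmat P x = map_mat (\<lambda>p. poly p x) P"

definition mat_deriv :: "(real \<Rightarrow> real mat) \<Rightarrow> real \<Rightarrow> real mat" where
  "mat_deriv M x = mat (dim_row (M x)) (dim_col (M x)) (\<lambda>(i, j). deriv (\<lambda>y. M y $$ (i, j)) x)"

definition first_rows :: "nat \<Rightarrow> 'a mat \<Rightarrow> 'a mat" where
  "first_rows k M = mat k (dim_col M) (\<lambda>(i, j). M $$ (i, j))"

definition last_rows :: "nat \<Rightarrow> 'a mat \<Rightarrow> 'a mat" where
  "last_rows k M = mat k (dim_col M) (\<lambda>(i, j). M $$ (dim_row M - k + i, j))"

definition append_cols :: "'a :: zero mat \<Rightarrow> 'a mat \<Rightarrow> 'a mat" where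
  "append_cols M N = four_block_mat M N (0\<^sub>m 0 (dim_col M)) (0\<^sub>m 0 (dim_col N))"


subsection \<open>The matrices \<open>G\<close> and \<open>H\<close> associated with boundary data\<close>

context
  fixes a b :: real and n :: nat
begin

definition affine_row :: "real \<Rightarrow> real mat" where
  "affine_row x = append_cols (1\<^sub>m n) ((x - a) \<cdot>\<^sub>m 1\<^sub>m n)"

definition G_mat :: "real mat \<Rightarrow> (real \<Rightarrow> real mat) \<Rightarrow> real mat" where
  "G_mat E F =
     E * (append_cols (1\<^sub>m n) (0\<^sub>m n n)
          @\<^sub>r append_cols (1\<^sub>m n) ((b - a) \<cdot>\<^sub>m 1\<^sub>m n)
          @\<^sub>r append_cols (0\<^sub>m n n) (1\<^sub>m n)
          @\<^sub>r append_cols (0\<^sub>m n n) (1\<^sub>m n))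
     + mat_integral a b (dim_row E) (2 * n) (\<lambda>x. F x * affine_row x)"

definition H_mat :: "real mat \<Rightarrow> (real \<Rightarrow> real mat) \<Rightarrow> real \<Rightarrow> real mat" where
  "H_mat E F x =
     - (E * (0\<^sub>m n n @\<^sub>r ((b - x) \<cdot>\<^sub>m 1\<^sub>m n) @\<^sub>r 0\<^sub>m n n @\<^sub>r 1\<^sub>m n))
     - mat_integral x b (dim_row E) n (\<lambda>\<theta>. (\<theta> - x) \<cdot>\<^sub>m F \<theta>)"

definition X_space :: "real mat \<Rightarrow> (real \<Rightarrow> real mat) \<Rightarrow> (real \<Rightarrow> real vec) set" where
  "X_space E F = {u \<in> W22 a b n.
     E *\<^sub>v (cont_rep a b n u a @\<^sub>v cont_rep a b n u b
           @\<^sub>v cont_rep a b n (weak_deriv a b n u) a @\<^sub>v cont_rep a b n (weak_deriv a b n u) b)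
     + vec_integral a b (dim_row E) (\<lambda>x. F x *\<^sub>v u x) = 0\<^sub>v (dim_row E)}"

end


subsection \<open>Spaces and operators associated with \<open>{E, F}\<close>\<close>

type_synonym state = "real vec \<times> (real \<Rightarrow> real vec)"

definition RL2 :: "real \<Rightarrow> real \<Rightarrow> nat \<Rightarrow> nat \<Rightarrow> state set" where
  "RL2 a b m n = carrier_vec m \<times> L2_vec a b n"

definition RL2_norm :: "real \<Rightarrow> real \<Rightarrow> nat \<Rightarrow> state \<Rightarrow> real" where
  "RL2_norm a b n v = sqrt (scalar_prod (fst v) (fst v) + (L2_norm a b n (snd v))\<^sup>2)"

definition Y_space :: "real \<Rightarrow> real \<Rightarrow> nat \<Rightarrow> nat \<Rightarrow> (state \<Rightarrow> real vec) \<Rightarrow> state set" where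
  "Y_space a b m n K = {v \<in> RL2 a b m n. K v = 0\<^sub>v m}"

context
  fixes a b :: real and n m :: nat and J E :: "real mat" and F :: "real poly mat"
    and F3 :: "real \<Rightarrow> real mat"
begin

definition E1 :: "real mat" where
  "E1 = first_rows (2 * n - m) (J * E)"

definition F1 :: "real \<Rightarrow> real mat" where
  "F1 x = first_rows (2 * n - m) (J * eval_pmat F x)"

definition E2 :: "real mat" where
  "E2 = last_rows m (J * E)"

definition F2 :: "real \<Rightarrow> real mat" where
  "F2 x = last_rows m (J * eval_pmat F x)"

definition E_hat :: "real mat" where
  "E_hat = E1 @\<^sub>r 0\<^sub>m m (4 * n)"

definition F_hat :: "real \<Rightarrow> real mat" where
  "F_hat x = F1 x @\<^sub>r F3 x"

definition G_hat :: "real mat" where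
  "G_hat = G_mat a b n E_hat F_hat"

definition H_hat :: "real \<Rightarrow> real mat" where
  "H_hat = H_mat b n E_hat F_hat"

definition T0 :: "real \<Rightarrow> real mat" where
  "T0 x = affine_row a n x * the (mat_inverse G_hat) * (0\<^sub>m (2 * n - m) m @\<^sub>r 1\<^sub>m m)"

definition T1 :: "real \<Rightarrow> real \<Rightarrow> real mat" where
  "T1 x \<theta> = affine_row a n x * the (mat_inverse G_hat) * H_hat \<theta>"

definition T_op :: "state \<Rightarrow> real \<Rightarrow> real vec" where
  "T_op v x = T0 x *\<^sub>v fst v
     + vec_integral a b n (\<lambda>\<theta>. T1 x \<theta> *\<^sub>v snd v \<theta>)
     + vec_integral a x n (\<lambda>\<theta>. (x - \<theta>) \<cdot>\<^sub>v snd v \<theta>)"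

definition R_op :: "state \<Rightarrow> real \<Rightarrow> real vec" where
  "R_op v x = mat_deriv T0 x *\<^sub>v fst v
     + vec_integral a b n (\<lambda>\<theta>. mat_deriv (\<lambda>y. T1 y \<theta>) x *\<^sub>v snd v \<theta>)
     + vec_integral a x n (snd v)"

definition K_op :: "state \<Rightarrow> real vec" where
  "K_op v = vec_integral a b m (\<lambda>x. H_mat b n E2 F2 x *\<^sub>v snd v x)"

definition F_op :: "(real \<Rightarrow> real vec) \<Rightarrow> real vec" where
  "F_op u = vec_integral a b m (\<lambda>x. F3 x *\<^sub>v u x)"

definition D_op :: "(real \<Rightarrow> real vec) \<Rightarrow> state" where
  "D_op u = (F_op u, weak_deriv2 a b n u)"

definition T_hat :: "state \<Rightarrow> state" where
  "T_hat v = (fst v, T_op v)"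

context
  fixes A0 A1 A2 :: "real poly mat"
begin

definition A_op :: "state \<Rightarrow> real \<Rightarrow> real vec" where
  "A_op v x = eval_pmat A0 x *\<^sub>v T_op v x + eval_pmat A1 x *\<^sub>v R_op v x
     + eval_pmat A2 x *\<^sub>v snd v x"

definition A_hat :: "state \<Rightarrow> state" where
  "A_hat v = (F_op (A_op v), A_op v)"

end

end


subsection \<open>Solutions of the PDE and of the PIE\<close>

text \<open>
  The Frechet derivative at \<open>t\<close> of a function of real time is the linear map \<open>h \<mapsto> h w\<close>; it is
  represented by \<open>w\<close>.  Time ranges over \<open>[0,\<infinity>)\<close>, so the derivative at 0 is one-sided.
\<close>

definition has_W22_deriv ::
    "real \<Rightarrow> real \<Rightarrow> nat \<Rightarrow> (real \<Rightarrow> real \<Rightarrow> real vec) \<Rightarrow> (real \<Rightarrow> real vec) \<Rightarrow> real \<Rightarrow> bool" where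
  "has_W22_deriv a b n u w t \<longleftrightarrow> w \<in> W22 a b n \<and>
     ((\<lambda>s. W22_norm a b n (\<lambda>x. u s x - u t x - (s - t) \<cdot>\<^sub>v w x) / \<bar>s - t\<bar>) \<longlongrightarrow> 0)
       (at t within {0..})"

definition has_RL2_deriv ::
    "real \<Rightarrow> real \<Rightarrow> nat \<Rightarrow> nat \<Rightarrow> (real \<Rightarrow> state) \<Rightarrow> state \<Rightarrow> real \<Rightarrow> bool" where
  "has_RL2_deriv a b m n v w t \<longleftrightarrow> w \<in> RL2 a b m n \<and>
     ((\<lambda>s. RL2_norm a b n
             (fst (v s) - fst (v t) - (s - t) \<cdot>\<^sub>v fst w,
              \<lambda>x. snd (v s) x - snd (v t) x - (s - t) \<cdot>\<^sub>v snd w x) / \<bar>s - t\<bar>) \<longlongrightarrow> 0)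
       (at t within {0..})"

text \<open>
  The state space \<open>X\<close> of the PDE carries the norm of \<open>W\<^sub>2\<^sup>2\<close>: differentiability of \<open>u\<close> is with
  respect to that norm.
\<close>

definition pde_solution ::
    "real \<Rightarrow> real \<Rightarrow> nat \<Rightarrow> real poly mat \<Rightarrow> real poly mat \<Rightarrow> real poly mat \<Rightarrow> real mat \<Rightarrow> real poly mat
      \<Rightarrow> (real \<Rightarrow> real \<Rightarrow> real vec) \<Rightarrow> (real \<Rightarrow> real vec) \<Rightarrow> bool" where
  "pde_solution a b n A0 A1 A2 E F u u0 \<longleftrightarrow>
     u0 \<in> X_space a b n E (eval_pmat F) \<and> ae_eq a b (u 0) u0 \<and>
     (\<forall>t\<ge>0. u t \<in> X_space a b n E (eval_pmat F) \<and>
       (\<exists>u_t. has_W22_deriv a b n u u_t t \<and>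
          ae_eq a b u_t (\<lambda>x. eval_pmat A0 x *\<^sub>v u t x
             + eval_pmat A1 x *\<^sub>v weak_deriv a b n (u t) x
             + eval_pmat A2 x *\<^sub>v weak_deriv2 a b n (u t) x)))"

definition pie_solution ::
    "real \<Rightarrow> real \<Rightarrow> nat \<Rightarrow> nat \<Rightarrow> (state \<Rightarrow> state) \<Rightarrow> (state \<Rightarrow> state) \<Rightarrow> (state \<Rightarrow> real vec)
      \<Rightarrow> (real \<Rightarrow> state) \<Rightarrow> state \<Rightarrow> bool" where
  "pie_solution a b m n T A K v v0 \<longleftrightarrow>
     v0 \<in> Y_space a b m n K \<and> fst (v 0) = fst v0 \<and> ae_eq a b (snd (v 0)) (snd v0) \<and>
     (\<forall>t\<ge>0. v t \<in> Y_space a b m n K \<and>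
       (\<exists>v_t. has_RL2_deriv a b m n v v_t t) \<and>
       has_RL2_deriv a b m n (\<lambda>s. T (v s)) (A (v t)) t)"

end

(*
  By the lemma of du Bois-Reymond, the functions u in W_2^2 are exactly those of the form
  u(x) = c_1 + (x - a) c_2 + int_a^x (x - t) w(t) dt with w in L_2; then c = (u(a), u_x(a)) and
  w = u_xx.  Exchanging the order of integration turns any
  functional E [u(a); u(b); u_x(a); u_x(b)] + int F u into G c - int H w.  Multiplying the boundary
  condition by the invertible matrix J therefore splits it into the rows with G = 0, which say
  K w = 0, and the remaining rows, which together with int F_3 u = v_0 determine c because the
  matrix G_hat is invertible.  Hence T and u |-> [int F_3 u; u_xx] are mutually inverse
  between Y and X.  Both are bounded linear maps for the norms of W_2^2 and R^m x L_2, so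
  they carry differentiable solutions to differentiable solutions; from the PIE to the PDE one
  also needs that the derivative of T v(t) in L_2 is unique.
*)
theory Submission
  imports Defs "HOL-Analysis.Equivalence_Measurable_On_Borel"
begin

subsection \<open>Square-integrable functions on an interval\<close>

text \<open>Two features of the encoding shape the argument. Elements of L2 are plain functions, and
  \<open>weak_deriv\<close> and \<open>cont_rep\<close> are arbitrary choices, so u, u_x and u_xx
  become computable only after u is replaced, almost everywhere, by its Taylor form
  \<open>reconstruction\<close>. That form depends only on the Cauchy data c = (u(a), u_x(a)) and on
  w = u_xx, and every operator is evaluated on it. Derivatives in time, in turn, are stated through
  norms of remainders f(s) - f(t) - (s - t) f'. These norms are split into scalar entries: real
  functions of order o(s - t) for the finite-dimensional part and L2 remainders, called
  \<open>L2_small\<close>, for the rest. Cauchy-Schwarz shows that primitives and integral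
  functionals preserve smallness, so no operator norms are introduced. As c is a bounded linear
  functional of the state, smallness passes from the state to T v together with both of its
  derivatives. From the PDE to the PIE the obstacle is that u_t is given in W22 only, not in X; its
  Cauchy data are therefore taken from its own Taylor form.\<close>

lemma finite_measure_interval: "finite_measure (lebesgue_on {a..b::real})"
  by (intro finite_measure_lebesgue_on) simp

lemma measurable_id_interval [measurable]: "(\<lambda>x. x) \<in> borel_measurable (lebesgue_on {a..b::real})"
  using id_borel_measurable_lebesgue_on[of "{a..b}"] by (simp add: id_def)

lemma integrable_interval_mono:
  fixes f :: "real \<Rightarrow> real"
  assumes "integrable (lebesgue_on {a..b}) f" "{c..d} \<subseteq> {a..b}"
  shows "integrable (lebesgue_on {c..d}) f"
proof -
  have "integrable lebesgue (\<lambda>x. indicator {a..b} x *\<^sub>R f x)"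
    using assms(1) by (simp add: integrable_restrict_space)
  then have "integrable lebesgue (\<lambda>x. indicator {c..d} x *\<^sub>R (indicator {a..b} x *\<^sub>R f x))"
    by (rule integrable_mult_indicator[rotated]) simp
  moreover have "(\<lambda>x. indicator {c..d} x *\<^sub>R (indicator {a..b} x *\<^sub>R f x)) = (\<lambda>x. indicator {c..d} x *\<^sub>R f x)"
    using assms(2) by (auto simp: indicator_def)
  ultimately show ?thesis by (simp add: integrable_restrict_space)
qed

text \<open>A variable interval of integration becomes an indicator over the fixed interval
  \<open>{a..b}\<close>, the form in which Fubini and dominated convergence apply.\<close>

lemma integral_interval_indicator:
  fixes f :: "real \<Rightarrow> real"
  assumes "{c..d} \<subseteq> {a..b}"
  shows "(\<integral>x. f x \<partial>lebesgue_on {c..d}) = (\<integral>x. indicator {c..d} x * f x \<partial>lebesgue_on {a..b})"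
  using assms by (simp add: integral_restrict_space) (rule Bochner_Integration.integral_cong; auto simp: indicator_def)

lemma square_integrableI_bounded:
  assumes "f \<in> borel_measurable (lebesgue_on {a..b})" "\<And>x. x \<in> {a..b} \<Longrightarrow> \<bar>f x\<bar> \<le> B"
  shows "square_integrable a b f"
proof -
  interpret finite_measure "lebesgue_on {a..b}" by (rule finite_measure_interval)
  have "integrable (lebesgue_on {a..b}) (\<lambda>x. (f x)\<^sup>2)"
  proof (rule integrable_const_bound[where B = "B\<^sup>2"])
    show "AE x in lebesgue_on {a..b}. norm ((f x)\<^sup>2) \<le> B\<^sup>2"
      using assms(2) abs_le_square_iff[of "f _" B] by (intro AE_I2) force
  qed (use assms in measurable)
  with assms show ?thesis by (simp add: square_integrable_def)
qed

lemma continuous_borel_measurable_interval: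
  fixes f :: "real \<Rightarrow> real"
  shows "continuous_on {a..b} f \<Longrightarrow> f \<in> borel_measurable (lebesgue_on {a..b})"
  by (simp add: continuous_imp_measurable_on_sets_lebesgue)

lemma continuous_bounded_interval:
  fixes f :: "real \<Rightarrow> real"
  assumes "continuous_on {a..b} f"
  obtains B where "\<And>x. x \<in> {a..b} \<Longrightarrow> \<bar>f x\<bar> \<le> B"
proof -
  have "bounded (f ` {a..b})" using assms by (intro compact_imp_bounded compact_continuous_image) auto
  then obtain B where "\<forall>x\<in>{a..b}. \<bar>f x\<bar> \<le> B" by (auto simp: bounded_iff)
  then show ?thesis using that by blast
qed

lemma square_integrable_continuous:
  "continuous_on {a..b} f \<Longrightarrow> square_integrable a b f"
  by (rule continuous_bounded_interval, assumption)
    (rule square_integrableI_bounded[OF continuous_borel_measurable_interval])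

lemma square_integrable_integrable_mult:
  assumes "square_integrable a b f" "square_integrable a b g"
  shows "integrable (lebesgue_on {a..b}) (\<lambda>x. f x * g x)"
proof (rule Bochner_Integration.integrable_bound[where f = "\<lambda>x. (f x)\<^sup>2 + (g x)\<^sup>2"])
  show "integrable (lebesgue_on {a..b}) (\<lambda>x. (f x)\<^sup>2 + (g x)\<^sup>2)"
    using assms by (simp add: square_integrable_def)
  show "(\<lambda>x. f x * g x) \<in> borel_measurable (lebesgue_on {a..b})"
    using assms by (auto simp: square_integrable_def)
  have "\<bar>x * y\<bar> \<le> x\<^sup>2 + y\<^sup>2" for x y :: real
  proof -
    have "2 * (\<bar>x\<bar> * \<bar>y\<bar>) \<le> x\<^sup>2 + y\<^sup>2" using sum_squares_bound[of "\<bar>x\<bar>" "\<bar>y\<bar>"] by simp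
    moreover have "\<bar>x\<bar> * \<bar>y\<bar> \<ge> 0" by simp
    ultimately show ?thesis unfolding abs_mult by linarith
  qed
  then show "AE x in lebesgue_on {a..b}. norm (f x * g x) \<le> norm ((f x)\<^sup>2 + (g x)\<^sup>2)"
    by (intro AE_I2) simp
qed

lemma square_integrable_const [simp, intro]: "square_integrable a b (\<lambda>x. c)"
  by (rule square_integrable_continuous) simp

lemma square_integrable_integrable:
  "square_integrable a b f \<Longrightarrow> integrable (lebesgue_on {a..b}) f"
  using square_integrable_integrable_mult[of a b f "\<lambda>x. 1"] by simp

lemma square_integrable_add:
  assumes "square_integrable a b f" "square_integrable a b g"
  shows "square_integrable a b (\<lambda>x. f x + g x)"
proof -
  have "integrable (lebesgue_on {a..b}) (\<lambda>x. (f x)\<^sup>2 + (g x)\<^sup>2 + 2 * (f x * g x))"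
    using assms square_integrable_integrable_mult[OF assms] by (simp add: square_integrable_def)
  then show ?thesis
    using assms by (auto simp: square_integrable_def power2_sum mult.assoc)
qed

lemma square_integrable_bounded_mult:
  assumes "square_integrable a b f" "g \<in> borel_measurable (lebesgue_on {a..b})"
    and "\<And>x. x \<in> {a..b} \<Longrightarrow> \<bar>g x\<bar> \<le> B"
  shows "square_integrable a b (\<lambda>x. g x * f x)"
proof -
  have "integrable (lebesgue_on {a..b}) (\<lambda>x. (g x * f x)\<^sup>2)"
  proof (rule Bochner_Integration.integrable_bound[where f = "\<lambda>x. B\<^sup>2 * (f x)\<^sup>2"])
    show "integrable (lebesgue_on {a..b}) (\<lambda>x. B\<^sup>2 * (f x)\<^sup>2)"
      using assms by (simp add: square_integrable_def)
    show "AE x in lebesgue_on {a..b}. norm ((g x * f x)\<^sup>2) \<le> norm (B\<^sup>2 * (f x)\<^sup>2)"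
    proof (rule AE_I2)
      fix x assume "x \<in> space (lebesgue_on {a..b})"
      then have "\<bar>g x\<bar> \<le> \<bar>B\<bar>" using assms(3)[of x] by simp
      then have "(g x)\<^sup>2 \<le> B\<^sup>2" by (rule abs_le_square_iff[THEN iffD1])
      then show "norm ((g x * f x)\<^sup>2) \<le> norm (B\<^sup>2 * (f x)\<^sup>2)"
        by (simp add: power_mult_distrib mult_right_mono)
    qed
  qed (use assms in \<open>auto simp: square_integrable_def\<close>)
  then show ?thesis using assms by (auto simp: square_integrable_def)
qed

lemma square_integrable_continuous_mult:
  assumes "square_integrable a b f" "continuous_on {a..b} g"
  shows "square_integrable a b (\<lambda>x. g x * f x)"
proof -
  obtain B where "\<And>x. x \<in> {a..b} \<Longrightarrow> \<bar>g x\<bar> \<le> B"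
    using continuous_bounded_interval[OF assms(2)] by blast
  then show ?thesis
    by (rule square_integrable_bounded_mult[OF assms(1) continuous_borel_measurable_interval[OF assms(2)]])
qed

lemma square_integrable_cmult:
  "square_integrable a b f \<Longrightarrow> square_integrable a b (\<lambda>x. c * f x)"
  by (rule square_integrable_continuous_mult) auto

lemma square_integrable_diff:
  "square_integrable a b f \<Longrightarrow> square_integrable a b g \<Longrightarrow> square_integrable a b (\<lambda>x. f x - g x)"
  using square_integrable_add[OF _ square_integrable_cmult[of a b g "-1"]] by simp

lemma square_integrable_sum:
  "(\<And>i. i \<in> I \<Longrightarrow> square_integrable a b (f i)) \<Longrightarrow> square_integrable a b (\<lambda>x. \<Sum>i\<in>I. f i x)"
  by (induction I rule: infinite_finite_induct) (auto intro: square_integrable_add)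

text \<open>Completeness of Lebesgue measure: altering a function on a null set keeps it measurable.
  Extension by zero carries the claim from \<open>lebesgue_on {a..b}\<close> to the whole
  line.\<close>

lemma borel_measurable_interval_AE:
  fixes f :: "real \<Rightarrow> real"
  assumes "f \<in> borel_measurable (lebesgue_on {a..b})" "AE x in lebesgue_on {a..b}. f x = g x"
  shows "g \<in> borel_measurable (lebesgue_on {a..b})"
proof -
  have "AE x in lebesgue. (if x \<in> {a..b} then f x else 0) = (if x \<in> {a..b} then g x else 0)"
    using assms(2) by (auto simp: AE_restrict_space_iff elim: eventually_mono)
  with borel_measurable_if_I[OF assms(1)]
  have "(\<lambda>x. if x \<in> {a..b} then g x else 0) \<in> borel_measurable lebesgue"
    by (rule borel_measurable_AE) simp
  then show ?thesis by (rule borel_measurable_if_D)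
qed

lemma square_integrable_AE:
  assumes "square_integrable a b f" "AE x in lebesgue_on {a..b}. f x = g x"
  shows "square_integrable a b g"
proof -
  have g: "g \<in> borel_measurable (lebesgue_on {a..b})"
    using assms by (auto simp: square_integrable_def intro: borel_measurable_interval_AE[OF _ assms(2)])
  have f: "f \<in> borel_measurable (lebesgue_on {a..b})" using assms by (simp add: square_integrable_def)
  have "integrable (lebesgue_on {a..b}) (\<lambda>x. (f x)\<^sup>2) \<longleftrightarrow> integrable (lebesgue_on {a..b}) (\<lambda>x. (g x)\<^sup>2)"
    using assms(2) f g by (intro integrable_cong_AE) auto
  then show ?thesis using assms g by (simp add: square_integrable_def)
qed

lemma square_integrable_cong:
  assumes "square_integrable a b f" "\<And>x. x \<in> {a..b} \<Longrightarrow> f x = g x"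
  shows "square_integrable a b g"
  using assms by (intro square_integrable_AE[OF assms(1)] AE_I2) auto

lemma square_integrable_mono:
  assumes "square_integrable a b f" "{c..d} \<subseteq> {a..b}"
  shows "square_integrable c d f"
proof -
  have "f \<in> borel_measurable (lebesgue_on {c..d})"
    using assms(1) by (intro measurable_restrict_mono[OF _ assms(2)]) (simp add: square_integrable_def)
  moreover have "integrable (lebesgue_on {c..d}) (\<lambda>x. (f x)\<^sup>2)"
    using assms(1) by (intro integrable_interval_mono[OF _ assms(2)]) (simp add: square_integrable_def)
  ultimately show ?thesis by (simp add: square_integrable_def)
qed

text \<open>The quadratic polynomial t -> \<integral> (f + t g)^2 is nonnegative for every real t,
  so its discriminant cannot be positive. Its leading coefficient \<integral> g^2 may vanish, which
  is treated separately.\<close>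

lemma square_integrable_Cauchy_Schwarz:
  assumes f: "square_integrable a b f" and g: "square_integrable a b g"
  shows "(\<integral>x. f x * g x \<partial>lebesgue_on {a..b})\<^sup>2
     \<le> (\<integral>x. (f x)\<^sup>2 \<partial>lebesgue_on {a..b}) * (\<integral>x. (g x)\<^sup>2 \<partial>lebesgue_on {a..b})"
proof -
  let ?M = "lebesgue_on {a..b}"
  let ?A = "\<integral>x. (f x)\<^sup>2 \<partial>?M" and ?B = "\<integral>x. (g x)\<^sup>2 \<partial>?M" and ?C = "\<integral>x. f x * g x \<partial>?M"
  have q: "0 \<le> ?B * t\<^sup>2 + 2 * ?C * t + ?A" for t
  proof -
    have "0 \<le> (\<integral>x. (f x + t * g x)\<^sup>2 \<partial>?M)" by (simp add: integral_nonneg)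
    also have "\<dots> = (\<integral>x. (f x)\<^sup>2 + (t\<^sup>2 * (g x)\<^sup>2 + 2 * t * (f x * g x)) \<partial>?M)"
      by (simp add: power2_sum power_mult_distrib algebra_simps)
    also have "\<dots> = ?A + (t\<^sup>2 * ?B + 2 * t * ?C)"
      using f g square_integrable_integrable_mult[OF f g] by (simp add: square_integrable_def)
    finally show ?thesis by (simp add: algebra_simps)
  qed
  have A: "0 \<le> ?A" and B: "0 \<le> ?B" by (simp_all add: integral_nonneg)
  show ?thesis
  proof (cases "?B = 0")
    case True
    have "?C = 0"
    proof (rule ccontr)
      assume "?C \<noteq> 0"
      \<comment> \<open>At this t the affine function \<open>2 * ?C * t + ?A\<close> takes the value
        -1.\<close>
      then show False using q[of "- (?A + 1) / (2 * ?C)"] True by (simp add: field_simps)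
    qed
    then show ?thesis using A B by simp
  next
    case False
    then have "0 < ?B" using B by linarith
    \<comment> \<open>The minimum of the quadratic, attained at t = -C/B.\<close>
    moreover have "?B * (- ?C / ?B)\<^sup>2 + 2 * ?C * (- ?C / ?B) + ?A = (?A * ?B - ?C\<^sup>2) / ?B"
      using False by (simp add: power2_eq_square divide_simps)
    ultimately have "0 \<le> ?A * ?B - ?C\<^sup>2" using q[of "- ?C / ?B"] by (simp add: zero_le_divide_iff)
    then show ?thesis by simp
  qed
qed

subsection \<open>Primitives and weak derivatives\<close>

lemma measure_interval [simp]: "a \<le> b \<Longrightarrow> measure (lebesgue_on {a..b}) {a..b} = b - (a :: real)"
  by (simp add: measure_restrict_space)

text \<open>Both sides integrate f(x) w(t) over the triangle t \<le> x of the square, in the two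
  possible orders. Every integration by parts below is obtained from this swap, because the
  primitive of an L2 function need not be differentiable at every point.\<close>

lemma integral_triangle_swap:
  fixes f w :: "real \<Rightarrow> real"
  assumes f: "integrable (lebesgue_on {a..b}) f" and w: "integrable (lebesgue_on {a..b}) w"
  shows "(\<integral>x. f x * (\<integral>t. w t \<partial>lebesgue_on {a..x}) \<partial>lebesgue_on {a..b})
       = (\<integral>t. w t * (\<integral>x. f x \<partial>lebesgue_on {t..b}) \<partial>lebesgue_on {a..b})"
proof -
  let ?M = "lebesgue_on {a..b}"
  interpret M: finite_measure ?M by (rule finite_measure_interval)
  interpret MM: pair_sigma_finite ?M ?M ..
  let ?g = "\<lambda>(x, t). if t \<le> x then f x * w t else 0"
  have [measurable]: "f \<in> borel_measurable ?M" "w \<in> borel_measurable ?M"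
    using f w by auto
  \<comment> \<open>The full product is integrable on the square and dominates its restriction to
    the triangle.\<close>
  have "integrable (?M \<Otimes>\<^sub>M ?M) (\<lambda>(x, t). f x * w t)"
  proof (rule MM.Fubini_integrable)
    show "integrable ?M (\<lambda>x. \<integral>t. norm (case (x, t) of (x, t) \<Rightarrow> f x * w t) \<partial>?M)"
      using f by (simp add: abs_mult)
    show "AE x in ?M. integrable ?M (\<lambda>t. case (x, t) of (x, t) \<Rightarrow> f x * w t)"
      using w by simp
  qed measurable
  then have int: "integrable (?M \<Otimes>\<^sub>M ?M) ?g"
  proof (rule Bochner_Integration.integrable_bound)
    have [measurable]: "(\<lambda>z. fst z) \<in> borel_measurable (?M \<Otimes>\<^sub>M ?M)" "(\<lambda>z. snd z) \<in> borel_measurable (?M \<Otimes>\<^sub>M ?M)"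
      by (auto intro!: measurable_compose[OF measurable_fst measurable_id_interval]
          measurable_compose[OF measurable_snd measurable_id_interval])
    show "?g \<in> borel_measurable (?M \<Otimes>\<^sub>M ?M)"
      unfolding split_beta by measurable
  qed auto
  have "(\<integral>x. f x * (\<integral>t. w t \<partial>lebesgue_on {a..x}) \<partial>?M) = (\<integral>x. (\<integral>t. ?g (x, t) \<partial>?M) \<partial>?M)"
  proof (rule Bochner_Integration.integral_cong[OF refl])
    fix x assume "x \<in> space ?M"
    then have "{a..x} \<subseteq> {a..b}" by auto
    then have "f x * (\<integral>t. w t \<partial>lebesgue_on {a..x}) = (\<integral>t. f x * (indicator {a..x} t * w t) \<partial>?M)"
      by (simp add: integral_interval_indicator)
    also have "\<dots> = (\<integral>t. ?g (x, t) \<partial>?M)"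
      by (rule Bochner_Integration.integral_cong) (auto simp: indicator_def)
    finally show "f x * (\<integral>t. w t \<partial>lebesgue_on {a..x}) = (\<integral>t. ?g (x, t) \<partial>?M)" .
  qed
  also have "\<dots> = (\<integral>t. (\<integral>x. ?g (x, t) \<partial>?M) \<partial>?M)"
    using MM.Fubini_integral[of "\<lambda>x t. ?g (x, t)"] int by simp
  also have "\<dots> = (\<integral>t. w t * (\<integral>x. f x \<partial>lebesgue_on {t..b}) \<partial>?M)"
  proof (rule Bochner_Integration.integral_cong[OF refl])
    fix t assume "t \<in> space ?M"
    then have "{t..b} \<subseteq> {a..b}" by auto
    then have "w t * (\<integral>x. f x \<partial>lebesgue_on {t..b}) = (\<integral>x. w t * (indicator {t..b} x * f x) \<partial>?M)"
      by (simp add: integral_interval_indicator)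
    also have "\<dots> = (\<integral>x. ?g (x, t) \<partial>?M)"
      by (rule Bochner_Integration.integral_cong) (auto simp: indicator_def)
    finally show "(\<integral>x. ?g (x, t) \<partial>?M) = w t * (\<integral>x. f x \<partial>lebesgue_on {t..b})" ..
  qed
  finally show ?thesis .
qed

lemma integral_interval_cong:
  "(\<And>x. x \<in> {a..b} \<Longrightarrow> f x = g x) \<Longrightarrow>
    (\<integral>x. f x \<partial>lebesgue_on {a..b}) = (\<integral>x. (g x :: real) \<partial>lebesgue_on {a..b})"
  by (rule Bochner_Integration.integral_cong) auto

text \<open>The case f = 1 of the swap, with inner integral x - t: Cauchy's formula for repeated
  integration. The kernel x - \<theta> of \<open>T_op\<close> has this origin.\<close>

lemma integral_primitive_left:
  assumes "integrable (lebesgue_on {a..x}) w"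
  shows "(\<integral>t. (\<integral>s. w s \<partial>lebesgue_on {a..t}) \<partial>lebesgue_on {a..x})
       = (\<integral>t. (x - t) * (w t :: real) \<partial>lebesgue_on {a..x})"
proof -
  have "(\<integral>t. 1 * (\<integral>s. w s \<partial>lebesgue_on {a..t}) \<partial>lebesgue_on {a..x})
      = (\<integral>t. w t * (\<integral>s. 1 \<partial>lebesgue_on {t..x}) \<partial>lebesgue_on {a..x})"
    using assms finite_measure.integrable_const[OF finite_measure_interval]
    by (intro integral_triangle_swap)
  also have "\<dots> = (\<integral>t. (x - t) * w t \<partial>lebesgue_on {a..x})"
    by (rule integral_interval_cong) (simp add: mult.commute)
  finally show ?thesis by simp
qed

text \<open>The mirror image, from the case w = 1 of the swap. The kernel \<theta> - x in
  \<open>H_mat\<close> arises in this way.\<close>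

lemma integral_primitive_right:
  assumes "integrable (lebesgue_on {t..b}) f"
  shows "(\<integral>x. (\<integral>s. f s \<partial>lebesgue_on {x..b}) \<partial>lebesgue_on {t..b})
       = (\<integral>x. (x - t) * (f x :: real) \<partial>lebesgue_on {t..b})"
proof -
  have "(\<integral>x. f x * (\<integral>s. 1 \<partial>lebesgue_on {t..x}) \<partial>lebesgue_on {t..b})
      = (\<integral>x. 1 * (\<integral>s. f s \<partial>lebesgue_on {x..b}) \<partial>lebesgue_on {t..b})"
    using assms finite_measure.integrable_const[OF finite_measure_interval]
    by (intro integral_triangle_swap)
  moreover have "(\<integral>x. f x * (\<integral>s. 1 \<partial>lebesgue_on {t..x}) \<partial>lebesgue_on {t..b})
      = (\<integral>x. (x - t) * f x \<partial>lebesgue_on {t..b})"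
    by (rule integral_interval_cong) (simp add: mult.commute)
  ultimately show ?thesis by simp
qed

lemma continuous_primitive:
  fixes w :: "real \<Rightarrow> real"
  assumes "integrable (lebesgue_on {a..b}) w"
  shows "continuous_on {a..b} (\<lambda>x. \<integral>t. w t \<partial>lebesgue_on {a..x})"
  using assms by (rule indefinite_integral_continuous_real)

lemma integral_interval_split:
  fixes f :: "real \<Rightarrow> real"
  assumes f: "integrable (lebesgue_on {a..b}) f" and x: "x \<in> {a..b}"
  shows "(\<integral>t. f t \<partial>lebesgue_on {a..x}) + (\<integral>t. f t \<partial>lebesgue_on {x..b}) = (\<integral>t. f t \<partial>lebesgue_on {a..b})"
proof -
  have sub: "{a..x} \<subseteq> {a..b}" "{x..b} \<subseteq> {a..b}" using x by auto
  have "integral {a..x} f + integral {x..b} f = integral {a..b} f"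
    using x integrable_on_lebesgue_on[OF f] by (intro Henstock_Kurzweil_Integration.integral_combine) auto
  then show ?thesis
    using integrable_interval_mono[OF f sub(1)] integrable_interval_mono[OF f sub(2)] f
    by (simp add: lebesgue_integral_eq_integral)
qed

lemma continuous_primitive_right:
  fixes f :: "real \<Rightarrow> real"
  assumes f: "integrable (lebesgue_on {a..b}) f"
  shows "continuous_on {a..b} (\<lambda>x. \<integral>t. f t \<partial>lebesgue_on {x..b})"
proof (rule continuous_on_eq)
  show "continuous_on {a..b} (\<lambda>x. (\<integral>t. f t \<partial>lebesgue_on {a..b}) - (\<integral>t. f t \<partial>lebesgue_on {a..x}))"
    by (intro continuous_intros continuous_primitive f)
qed (use integral_interval_split[OF f] in \<open>auto simp: algebra_simps\<close>)

text \<open>Here t occurs in the kernel as well as in the limit of integration; written as an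
  iterated primitive the function is visibly continuous. This later gives continuous entries to the
  integral part of \<open>H_mat\<close> although F is only square-integrable.\<close>

lemma continuous_second_primitive_right:
  fixes f :: "real \<Rightarrow> real"
  assumes f: "integrable (lebesgue_on {a..b}) f"
  shows "continuous_on {a..b} (\<lambda>t. \<integral>x. (x - t) * f x \<partial>lebesgue_on {t..b})"
proof -
  have "continuous_on {a..b} (\<lambda>x. \<integral>t. (\<integral>s. f s \<partial>lebesgue_on {t..b}) \<partial>lebesgue_on {x..b})"
    by (intro continuous_primitive_right square_integrable_integrable square_integrable_continuous f)
  then show ?thesis
    by (rule continuous_on_eq) (auto intro!: integral_primitive_right integrable_interval_mono[OF f])
qed

text \<open>The second primitive of w is unfolded into two primitives, and each is moved onto f by
  one exchange of the order of integration.\<close>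

lemma integral_second_primitive_swap:
  fixes f w :: "real \<Rightarrow> real"
  assumes f: "integrable (lebesgue_on {a..b}) f" and w: "integrable (lebesgue_on {a..b}) w"
  shows "(\<integral>x. f x * (\<integral>t. (x - t) * w t \<partial>lebesgue_on {a..x}) \<partial>lebesgue_on {a..b})
       = (\<integral>t. (\<integral>x. (x - t) * f x \<partial>lebesgue_on {t..b}) * w t \<partial>lebesgue_on {a..b})"
proof -
  have pw: "integrable (lebesgue_on {a..b}) (\<lambda>x. \<integral>t. w t \<partial>lebesgue_on {a..x})"
    by (intro square_integrable_integrable square_integrable_continuous continuous_primitive w)
  have pf: "integrable (lebesgue_on {a..b}) (\<lambda>x. \<integral>t. f t \<partial>lebesgue_on {x..b})"
    by (intro square_integrable_integrable square_integrable_continuous continuous_primitive_right f)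
  have "(\<integral>x. f x * (\<integral>t. (x - t) * w t \<partial>lebesgue_on {a..x}) \<partial>lebesgue_on {a..b})
      = (\<integral>x. f x * (\<integral>t. (\<integral>s. w s \<partial>lebesgue_on {a..t}) \<partial>lebesgue_on {a..x}) \<partial>lebesgue_on {a..b})"
    using integrable_interval_mono[OF w]
    by (intro integral_interval_cong) (simp add: integral_primitive_left)
  also have "\<dots> = (\<integral>t. (\<integral>s. w s \<partial>lebesgue_on {a..t}) * (\<integral>x. f x \<partial>lebesgue_on {t..b}) \<partial>lebesgue_on {a..b})"
    by (rule integral_triangle_swap[OF f pw])
  also have "\<dots> = (\<integral>x. (\<integral>s. f s \<partial>lebesgue_on {x..b}) * (\<integral>s. w s \<partial>lebesgue_on {a..x}) \<partial>lebesgue_on {a..b})"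
    by (simp add: mult.commute)
  also have "\<dots> = (\<integral>t. w t * (\<integral>x. (\<integral>s. f s \<partial>lebesgue_on {x..b}) \<partial>lebesgue_on {t..b}) \<partial>lebesgue_on {a..b})"
    by (rule integral_triangle_swap[OF pf w])
  also have "\<dots> = (\<integral>t. (\<integral>x. (x - t) * f x \<partial>lebesgue_on {t..b}) * w t \<partial>lebesgue_on {a..b})"
    using integrable_interval_mono[OF f]
    by (intro integral_interval_cong) (simp add: integral_primitive_right)
  finally show ?thesis .
qed

section \<open>Test functions and the lemma of du Bois-Reymond\<close>

lemma test_functionD:
  assumes "test_function a b \<phi>"
  shows test_function_DERIV: "(\<phi> has_real_derivative deriv \<phi> x) (at x)"
    and test_function_continuous_deriv: "continuous_on S (deriv \<phi>)"
    and test_function_continuous: "continuous_on S \<phi>"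
    and test_function_left: "\<phi> a = 0" and test_function_right: "\<phi> b = 0"
proof -
  obtain D where D: "\<And>x. (\<phi> has_real_derivative D x) (at x)" "continuous_on UNIV D"
    using assms by (auto simp: test_function_def C1_differentiable_on_def has_real_derivative_iff_has_vector_derivative)
  then have [simp]: "deriv \<phi> = D" by (auto intro: DERIV_imp_deriv)
  show "(\<phi> has_real_derivative deriv \<phi> x) (at x)" using D by simp
  show "continuous_on S (deriv \<phi>)" using D by (auto intro: continuous_on_subset)
  show "continuous_on S \<phi>" using D by (auto intro!: DERIV_isCont continuous_at_imp_continuous_on)
  show "\<phi> a = 0" "\<phi> b = 0"
    using assms closure_subset[of "{x. \<phi> x \<noteq> 0}"] by (fastforce simp: test_function_def)+
qed

lemma integral_deriv_interval:
  fixes f :: "real \<Rightarrow> real"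
  assumes "a \<le> b" "\<And>x. x \<in> {a..b} \<Longrightarrow> (f has_real_derivative f' x) (at x)" "continuous_on {a..b} f'"
  shows "(\<integral>x. f' x \<partial>lebesgue_on {a..b}) = f b - f a"
proof -
  have "(f' has_integral (f b - f a)) {a..b}"
    using assms by (intro fundamental_theorem_of_calculus)
      (auto simp: has_real_derivative_iff_has_vector_derivative intro: has_vector_derivative_at_within)
  moreover have "integrable (lebesgue_on {a..b}) f'"
    by (intro square_integrable_integrable square_integrable_continuous assms)
  ultimately show ?thesis
    by (simp add: lebesgue_integral_eq_integral integral_unique)
qed

text \<open>The constant contributes c (\<phi>(b) - \<phi>(a)) = 0. For the primitive, the order of
  integration is exchanged, and the inner integral of the derivative of \<phi> over [t, b] is
  -\<phi>(t).\<close>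

lemma integral_primitive_deriv_test:
  fixes w :: "real \<Rightarrow> real"
  assumes w: "square_integrable a b w" and \<phi>: "test_function a b \<phi>" and "a \<le> b"
  shows "(\<integral>x. (c + (\<integral>t. w t \<partial>lebesgue_on {a..x})) * deriv \<phi> x \<partial>lebesgue_on {a..b})
       = - (\<integral>x. w x * \<phi> x \<partial>lebesgue_on {a..b})"
proof -
  note D = test_functionD[OF \<phi>]
  have d: "square_integrable a b (deriv \<phi>)" by (intro square_integrable_continuous D)
  note [intro] = square_integrable_integrable
  have P: "square_integrable a b (\<lambda>x. \<integral>t. w t \<partial>lebesgue_on {a..x})"
    by (intro square_integrable_continuous continuous_primitive) (use w in auto)
  have "(\<integral>x. (c + (\<integral>t. w t \<partial>lebesgue_on {a..x})) * deriv \<phi> x \<partial>lebesgue_on {a..b})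
      = (\<integral>x. c * deriv \<phi> x + deriv \<phi> x * (\<integral>t. w t \<partial>lebesgue_on {a..x}) \<partial>lebesgue_on {a..b})"
    by (simp add: algebra_simps)
  also have "\<dots> = c * (\<integral>x. deriv \<phi> x \<partial>lebesgue_on {a..b})
      + (\<integral>x. deriv \<phi> x * (\<integral>t. w t \<partial>lebesgue_on {a..x}) \<partial>lebesgue_on {a..b})"
    using d square_integrable_integrable_mult[OF d P] by (subst Bochner_Integration.integral_add) auto
  also have "(\<integral>x. deriv \<phi> x \<partial>lebesgue_on {a..b}) = 0"
    using integral_deriv_interval[OF \<open>a \<le> b\<close> D(1) D(2)] D(4,5) by simp
  also have "(\<integral>x. deriv \<phi> x * (\<integral>t. w t \<partial>lebesgue_on {a..x}) \<partial>lebesgue_on {a..b})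
      = (\<integral>t. w t * (\<integral>x. deriv \<phi> x \<partial>lebesgue_on {t..b}) \<partial>lebesgue_on {a..b})"
    using d w by (intro integral_triangle_swap) auto
  also have "\<dots> = (\<integral>t. - (w t * \<phi> t) \<partial>lebesgue_on {a..b})"
    using integral_deriv_interval[OF _ D(1) D(2)] D(5) by (intro integral_interval_cong) simp
  finally show ?thesis by simp
qed

text \<open>The primitive of q vanishes to the left of c because q does, and to the right of d
  because q has mean zero; so its support stays inside the open interval. Test functions are only
  required to be C1, hence continuity of q is enough.\<close>

lemma test_function_primitive:
  fixes q :: "real \<Rightarrow> real"
  assumes "a < c" "c \<le> d" "d < b" and q: "continuous_on UNIV q"
    and supp: "\<And>x. x \<notin> {c<..<d} \<Longrightarrow> q x = 0"
    and zero: "(\<integral>x. q x \<partial>lebesgue_on {a..b}) = 0"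
  obtains \<phi> where "test_function a b \<phi>" "deriv \<phi> = q"
proof -
  define \<phi> where "\<phi> x = integral {a..x} q" for x
  have qi: "q integrable_on {x..y}" for x y
    by (intro integrable_continuous_real continuous_on_subset[OF q]) auto
  have left: "\<phi> x = 0" if "x \<le> c" for x
    unfolding \<phi>_def using that supp
    by (intro integral_unique has_integral_is_0) auto
  have q_right: "integral {d..x} q = 0" for x
    using supp by (intro integral_unique has_integral_is_0) auto
  have split: "integral {a..x} q = integral {a..d} q" if "d \<le> x" for x
    using Henstock_Kurzweil_Integration.integral_combine[OF _ that qi, of a] q_right assms by simp
  have "integral {a..b} q = 0"
    using zero lebesgue_integral_eq_integral[of "{a..b}" q]
      square_integrable_integrable[OF square_integrable_continuous[OF continuous_on_subset[OF q]]] by simp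
  then have right: "\<phi> x = 0" if "d \<le> x" for x
    unfolding \<phi>_def using split[OF that] split[of b] assms by simp
  have D: "(\<phi> has_real_derivative q x) (at x)" for x
  \<comment> \<open>Outside [c, d] the function \<open>\<phi>\<close> is locally zero. This also
    covers the points outside [a, b], where the fundamental theorem on \<open>{a..b}\<close> says
    nothing.\<close>
  proof (cases "x < c \<or> d < x")
    case True
    then have "\<forall>\<^sub>F y in nhds x. \<phi> y = 0"
    proof
      assume "x < c"
      then have "\<forall>\<^sub>F y in nhds x. y \<in> {..<c}" by (intro eventually_nhds_in_open) auto
      then show ?thesis by eventually_elim (simp add: left)
    next
      assume "d < x"
      then have "\<forall>\<^sub>F y in nhds x. y \<in> {d<..}" by (intro eventually_nhds_in_open) auto
      then show ?thesis by eventually_elim (simp add: right)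
    qed
    moreover have "q x = 0" using True supp by auto
    moreover have "((\<lambda>y. 0 :: real) has_real_derivative 0) (at x)" by simp
    ultimately show ?thesis using DERIV_cong_ev[of x x \<phi> "\<lambda>_. 0" "q x" 0] by auto
  next
    case False
    then have x: "x \<in> {a<..<b}" using assms by auto
    have "((\<lambda>x. integral {a..x} q) has_real_derivative q x) (at x within {a..b})"
      using x by (intro integral_has_real_derivative continuous_on_subset[OF q]) auto
    moreover have "at x within {a..b} = at x"
      using x by (intro at_within_interior) auto
    ultimately show ?thesis by (simp add: \<phi>_def[abs_def])
  qed
  have cl: "closure {x. \<phi> x \<noteq> 0} \<subseteq> {c..d}"
  proof (rule closure_minimal)
    show "{x. \<phi> x \<noteq> 0} \<subseteq> {c..d}"
      using left right by (metis (mono_tags, lifting) atLeastAtMost_iff linear mem_Collect_eq subsetI)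
  qed simp
  have "test_function a b \<phi>"
    unfolding test_function_def
  proof (intro conjI)
    show "\<phi> C1_differentiable_on UNIV"
      unfolding C1_differentiable_on_def using D q
      by (intro exI[of _ q]) (auto simp: has_real_derivative_iff_has_vector_derivative)
    show "compact (closure {x. \<phi> x \<noteq> 0})"
      using cl by (auto intro: bounded_subset[of "{c..d}"] simp: compact_eq_bounded_closed)
    show "closure {x. \<phi> x \<noteq> 0} \<subseteq> {a<..<b}" using cl assms by force
  qed
  moreover have "deriv \<phi> = q" using D by (auto intro: DERIV_imp_deriv)
  ultimately show ?thesis using that by blast
qed

text \<open>Lebesgue differentiation: off a null set g(x) is the limit of the means of g over
  [x, x + h], and these means vanish because they are differences of values of the
  primitive.\<close>

lemma AE_zero_if_primitive_zero:
  fixes g :: "real \<Rightarrow> real"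
  assumes g: "integrable (lebesgue_on {a..b}) g"
    and zero: "\<And>x. x \<in> {a..b} \<Longrightarrow> (\<integral>t. g t \<partial>lebesgue_on {a..x}) = 0"
  shows "AE x in lebesgue_on {a..b}. g x = 0"
proof -
  define f where "f x = (if x \<in> {a..b} then g x else 0)" for x
  have "integrable lebesgue f"
    using g Lebesgue_Measure.integrable_restrict_UNIV[of "{a..b}" g] by (simp add: f_def[abs_def])
  then have "f integrable_on UNIV"
    using integrable_on_lebesgue by blast
  then have "f integrable_on cbox u v" for u v
    using integrable_on_subcbox by blast
  then obtain N where N: "negligible N" "\<And>x e. \<lbrakk>x \<notin> N; 0 < e\<rbrakk> \<Longrightarrow>
      \<exists>d>0. \<forall>h. 0 < h \<and> h < d \<longrightarrow> norm (integral (cbox x (x + h *\<^sub>R One)) f /\<^sub>R h ^ DIM(real) - f x) < e"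
    using integrable_ccontinuous_explicit[of f] by metis
  have g0: "g x = 0" if x: "x \<notin> N" "x \<in> {a..<b}" for x
  proof (rule ccontr)
    assume "g x \<noteq> 0"
    then obtain d where d: "d > 0" "\<And>h. 0 < h \<Longrightarrow> h < d \<Longrightarrow>
        norm (integral {x..x + h} f /\<^sub>R h - f x) < norm (g x)"
      using N(2)[OF x(1), of "norm (g x)"] by auto
    \<comment> \<open>Half of \<open>d\<close> meets the strict bound on the step, and b - x keeps
      [x, x + h] inside [a, b]. The latter is positive only for x < b, so the point b joins the null
      set below.\<close>
    define h where "h = min (d/2) (b - x)"
    have h: "0 < h" "h < d" "x + h \<le> b" using d(1) x(2) by (auto simp: h_def min_def)
    have sub: "{x..x + h} \<subseteq> {a..b}" using h x by auto
    have "integral {x..x + h} f = integral {x..x + h} g"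
      using sub by (intro Henstock_Kurzweil_Integration.integral_cong) (auto simp: f_def)
    also have "\<dots> = (\<integral>t. g t \<partial>lebesgue_on {x..x + h})"
      using integrable_interval_mono[OF g sub] by (simp add: lebesgue_integral_eq_integral)
    also have "\<dots> = 0"
    proof -
      have "{a..x + h} \<subseteq> {a..b}" using h by auto
      from integral_interval_split[OF integrable_interval_mono[OF g this], of x]
      show ?thesis using zero[of x] zero[of "x + h"] h x by simp
    qed
    finally show False using d(2)[OF h(1,2)] x by (simp add: f_def)
  qed
  have "negligible (N \<union> {b})" using N(1) by auto
  then have "AE x in lebesgue. x \<notin> N \<union> {b}"
    by (intro AE_not_in) (simp only: negligible_iff_null_sets)
  then have "AE x in lebesgue. x \<in> {a..b} \<longrightarrow> g x = 0"
    by eventually_elim (auto intro!: g0)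
  then show ?thesis
    by (subst AE_restrict_space_iff) auto
qed

text \<open>One bump with nonzero integral is fixed. Any other bump differs from a multiple of it by
  a function of mean zero, that is, by the derivative of a test function; so h acts on all bumps
  like one and the same constant C. Letting the bumps tend to indicators shows that h - C has
  integral zero over every interior interval, and hence a vanishing primitive.\<close>

lemma du_Bois_Reymond:
  fixes h :: "real \<Rightarrow> real"
  assumes "a < b" and h: "integrable (lebesgue_on {a..b}) h"
    and test: "\<And>\<phi>. test_function a b \<phi> \<Longrightarrow> (\<integral>x. h x * deriv \<phi> x \<partial>lebesgue_on {a..b}) = 0"
  obtains C where "AE x in lebesgue_on {a..b}. h x = C"
proof -
  let ?M = "lebesgue_on {a..b}"
  \<comment> \<open>A trapezoid, or a tent if k is small, with edges of slope k; it vanishes outside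
    (c, d) and is at most 1. It is continuous, so it can occur in the derivative of a C1 test
    function, and it tends to the indicator of (c, d) as k grows.\<close>
  define ramp where "ramp k c d x = max 0 (min 1 (k * min (x - c) (d - x)))" for k c d x :: real
  have ramp_cont: "continuous_on S (ramp k c d)" for S k c d
    unfolding ramp_def by (intro continuous_intros)
  have ramp_0: "ramp k c d x = 0" if "x \<notin> {c<..<d}" "k \<ge> 0" for k c d x
  proof -
    have "min (x - c) (d - x) \<le> 0" using that by auto
    then have "k * min (x - c) (d - x) \<le> 0" using that(2) by (simp add: mult_nonneg_nonpos)
    then show ?thesis by (simp add: ramp_def)
  qed
  have ramp_bounds: "0 \<le> ramp k c d x" "ramp k c d x \<le> 1" for k c d x by (auto simp: ramp_def)
  have ramp_int: "integrable ?M (\<lambda>x. ramp k c d x)" for k c d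
    by (intro square_integrable_integrable square_integrable_continuous ramp_cont)
  have h_ramp_int: "integrable ?M (\<lambda>x. h x * ramp k c d x)" for k c d
  proof (rule Bochner_Integration.integrable_bound[OF h])
    show "(\<lambda>x. h x * ramp k c d x) \<in> borel_measurable ?M"
      by (intro borel_measurable_times borel_measurable_integrable[OF h]
          continuous_borel_measurable_interval ramp_cont)
    show "AE x in ?M. norm (h x * ramp k c d x) \<le> norm (h x)"
      using ramp_bounds[of k c d] by (intro AE_I2) (auto simp: abs_mult intro: mult_left_le)
  qed
  \<comment> \<open>The two points that divide [a, b] into thirds; any interval strictly inside
    would serve.\<close>
  define p where "p = (2 * a + b) / 3"
  define q where "q = (a + 2 * b) / 3"
  have pq: "a < p" "p < q" "q < b" using \<open>a < b\<close> by (auto simp: p_def q_def field_simps)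
  define I where "I k c d = (\<integral>x. ramp k c d x \<partial>?M)" for k c d
  have Ipq: "I 1 p q \<noteq> 0"
  proof
    assume "I 1 p q = 0"
    then have "\<forall>x\<in>{a..b}. ramp 1 p q x = 0"
      unfolding I_def using \<open>a < b\<close> ramp_bounds ramp_cont by (subst (asm) integralL_eq_0_iff) auto
    \<comment> \<open>The midpoint lies strictly between \<open>p\<close> and \<open>q\<close>,
      where the bump is positive.\<close>
    then have "ramp 1 p q ((p + q) / 2) = 0" using pq by auto
    then show False using pq by (auto simp: ramp_def max_def min_def split: if_splits)
  qed
  define C where "C = (\<integral>x. h x * ramp 1 p q x \<partial>?M) / I 1 p q"
  have ramp_test: "(\<integral>x. h x * ramp k c d x \<partial>?M) = C * I k c d"
    if cd: "a < c" "c \<le> d" "d < b" "k \<ge> 0" for k c d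
  proof -
    \<comment> \<open>With this factor \<open>e\<close> has mean zero.\<close>
    define r where "r = I k c d / I 1 p q"
    define e where "e x = ramp k c d x - r * ramp 1 p q x" for x
    obtain \<phi> where \<phi>: "test_function a b \<phi>" "deriv \<phi> = e"
    proof (rule test_function_primitive[of a "min c p" "max d q" b e])
      show "continuous_on UNIV e" unfolding e_def by (intro continuous_intros ramp_cont)
      show "e x = 0" if "x \<notin> {min c p<..<max d q}" for x
      proof -
        have "x \<notin> {c<..<d}" "x \<notin> {p<..<q}" using that by auto
        then show ?thesis using \<open>k \<ge> 0\<close> by (simp add: e_def ramp_0 del: greaterThanLessThan_iff)
      qed
      show "(\<integral>x. e x \<partial>?M) = 0"
        using Ipq ramp_int by (simp add: e_def r_def I_def)
    qed (use cd pq in auto)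
    have "0 = (\<integral>x. h x * e x \<partial>?M)" using test[OF \<phi>(1)] \<phi>(2) by simp
    also have "\<dots> = (\<integral>x. h x * ramp k c d x - r * (h x * ramp 1 p q x) \<partial>?M)"
      by (simp add: e_def algebra_simps)
    also have "\<dots> = (\<integral>x. h x * ramp k c d x \<partial>?M) - r * (\<integral>x. h x * ramp 1 p q x \<partial>?M)"
      using h_ramp_int by simp
    finally show ?thesis using Ipq by (simp add: C_def r_def)
  qed
  define g where "g x = h x - C" for x
  have Cint: "integrable ?M (\<lambda>x. C)"
    using square_integrable_integrable by blast
  have g: "integrable ?M g" unfolding g_def using h Cint by simp
  have g_ramp: "(\<integral>x. g x * ramp k c d x \<partial>?M) = 0" if "a < c" "c \<le> d" "d < b" "k \<ge> 0" for k c d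
  proof -
    have "(\<integral>x. g x * ramp k c d x \<partial>?M) = (\<integral>x. h x * ramp k c d x - C * ramp k c d x \<partial>?M)"
      by (simp add: g_def algebra_simps)
    also have "\<dots> = 0" using h_ramp_int ramp_int ramp_test[OF that] by (simp add: I_def)
    finally show ?thesis .
  qed
  have ind: "(\<lambda>x. indicator S x :: real) \<in> borel_measurable ?M" if "S \<in> sets borel" for S :: "real set"
    using measurable_compose[OF measurable_id_interval borel_measurable_indicator[OF that]] .
  have g_int: "(\<integral>x. g x \<partial>lebesgue_on {c..d}) = 0" if "a < c" "c \<le> d" "d < b" for c d
  proof -
    \<comment> \<open>Steepening edges turn the bump into the indicator of the open interval; all
      functions of the sequence are dominated by the absolute value of \<open>g\<close>.\<close>
    have "(\<lambda>k. \<integral>x. g x * ramp (real k) c d x \<partial>?M) \<longlonglongrightarrow> (\<integral>x. indicator {c<..<d} x * g x \<partial>?M)"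
    proof (rule integral_dominated_convergence[where w = "\<lambda>x. norm (g x)"])
      show "AE x in ?M. (\<lambda>k. g x * ramp (real k) c d x) \<longlonglongrightarrow> indicator {c<..<d} x * g x"
      proof (intro AE_I2)
        fix x
        have "(\<lambda>k. ramp (real k) c d x) \<longlonglongrightarrow> indicator {c<..<d} x"
        proof (cases "x \<in> {c<..<d}")
          case True
          then have m: "0 < min (x - c) (d - x)" by auto
          have "\<forall>\<^sub>F k in sequentially. 1 / min (x - c) (d - x) \<le> real k"
            using filterlim_real_sequentially by (simp add: filterlim_at_top)
          then have "\<forall>\<^sub>F k in sequentially. indicator {c<..<d} x = ramp (real k) c d x"
          proof eventually_elim
            case (elim k)
            then have "1 \<le> real k * min (x - c) (d - x)" using m by (simp only: pos_divide_le_eq)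
            then show ?case using True by (simp add: ramp_def)
          qed
          then show ?thesis by (rule tendsto_eventually[OF eventually_mono]) simp
        next
          case False
          then show ?thesis by (simp add: ramp_0)
        qed
        then show "(\<lambda>k. g x * ramp (real k) c d x) \<longlonglongrightarrow> indicator {c<..<d} x * g x"
          by (subst mult.commute) (intro tendsto_intros)
      qed
      show "AE x in ?M. norm (g x * ramp (real k) c d x) \<le> norm (g x)" for k
        using ramp_bounds[of "real k" c d] by (intro AE_I2) (auto simp: abs_mult intro: mult_left_le)
      show "(\<lambda>x. indicator {c<..<d} x * g x) \<in> borel_measurable ?M"
        using g by (intro borel_measurable_times ind) auto
      show "(\<lambda>x. g x * ramp (real k) c d x) \<in> borel_measurable ?M" for k
        by (intro borel_measurable_times borel_measurable_integrable[OF g]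
            continuous_borel_measurable_interval ramp_cont)
    qed (use g in simp)
    then have "(\<integral>x. indicator {c<..<d} x * g x \<partial>?M) = 0"
      using g_ramp[OF that] by (simp add: LIMSEQ_const_iff)
    moreover have "(\<integral>x. indicator {c..d} x * g x \<partial>?M) = (\<integral>x. indicator {c<..<d} x * g x \<partial>?M)"
    proof (rule integral_cong_AE)
      have "AE x in lebesgue. x \<notin> {c, d}" by (intro AE_not_in) (simp add: negligible_iff_null_sets[symmetric])
      then have "AE x in lebesgue. indicator {c..d} x * g x = indicator {c<..<d} x * g x"
        by eventually_elim (auto simp: indicator_def)
      then show "AE x in ?M. indicator {c..d} x * g x = indicator {c<..<d} x * g x"
        by (subst AE_restrict_space_iff) (auto elim: eventually_mono)
    qed (use g in \<open>auto intro!: borel_measurable_times ind\<close>)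
    moreover have "{c..d} \<subseteq> {a..b}" using that by auto
    ultimately show ?thesis by (simp add: integral_interval_indicator)
  qed
  define P where "P x = (\<integral>t. g t \<partial>lebesgue_on {a..x})" for x
  have Pc: "continuous_on {a..b} P" unfolding P_def by (rule continuous_primitive[OF g])
  have P_le: "P y = P x" if "a < x" "x \<le> y" "y < b" for x y
  proof -
    have "{a..y} \<subseteq> {a..b}" using that by auto
    from integral_interval_split[OF integrable_interval_mono[OF g this], of x]
    show ?thesis using g_int[OF that] that by (simp add: P_def)
  qed
  \<comment> \<open>The primitive is constant on the open interval because \<open>g\<close> has
    integral zero over interior intervals; continuity carries the constant to the endpoint a, where
    the primitive is 0.\<close>
  have "P x = P p" if "x \<in> {a<..<b}" for x
    using P_le[of x p] P_le[of p x] that pq by (cases "x \<le> p") auto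
  moreover have "closure {a<..<b} = {a..b}" using \<open>a < b\<close> by simp
  ultimately have "P x = P p" if "x \<in> {a..b}" for x
    using continuous_constant_on_closure[of "{a<..<b}" P "P p" x] Pc that by simp
  moreover have "P a = 0"
  proof -
    have "{a::real} \<in> null_sets lebesgue" by (simp add: negligible_iff_null_sets[symmetric])
    then show ?thesis unfolding P_def by (simp add: integral_eq_zero_null_sets)
  qed
  ultimately have "P x = 0" if "x \<in> {a..b}" for x using that \<open>a < b\<close> by (metis atLeastAtMost_iff less_imp_le order_refl)
  then have "AE x in ?M. g x = 0" using g by (intro AE_zero_if_primitive_zero) (auto simp: P_def)
  then have "AE x in ?M. h x = C" by (simp add: g_def)
  then show ?thesis using that by blast
qed

section \<open>Vector-valued L2 functions up to almost everywhere equality\<close>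

unbundle no Finite_Cartesian_Product.vec_syntax

lemma AE_interval_zero_iff_integral:
  assumes "square_integrable a b f"
  shows "(\<integral>x. (f x)\<^sup>2 \<partial>lebesgue_on {a..b}) = 0 \<longleftrightarrow> (AE x in lebesgue_on {a..b}. f x = 0)"
  using assms integral_nonneg_eq_0_iff_AE[of "lebesgue_on {a..b}" "\<lambda>x. (f x)\<^sup>2"]
  by (simp add: square_integrable_def)

text \<open>A continuous nonnegative function with integral zero vanishes everywhere, endpoints
  included; here it is the square of f - g. This is what gives a class modulo null sets well-defined
  boundary values.\<close>

lemma continuous_AE_eq_interval:
  fixes f g :: "real \<Rightarrow> real"
  assumes "a < b" and f: "continuous_on {a..b} f" and g: "continuous_on {a..b} g"
    and ae: "AE x in lebesgue_on {a..b}. f x = g x" and x: "x \<in> {a..b}"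
  shows "f x = g x"
proof -
  have c: "continuous_on {a..b} (\<lambda>x. (f x - g x)\<^sup>2)" by (intro continuous_intros f g)
  have "(\<integral>x. (f x - g x)\<^sup>2 \<partial>lebesgue_on {a..b}) = 0"
    using AE_interval_zero_iff_integral[of a b "\<lambda>x. f x - g x"] ae
    by (simp add: square_integrable_continuous continuous_on_diff f g)
  then have "\<forall>x\<in>{a..b}. (f x - g x)\<^sup>2 = 0"
    using integralL_eq_0_iff[OF c \<open>a < b\<close>] by simp
  then show ?thesis using x by simp
qed

lemma L2_vecI:
  "(\<And>x. x \<in> {a..b} \<Longrightarrow> f x \<in> carrier_vec k) \<Longrightarrow>
   (\<And>i. i < k \<Longrightarrow> square_integrable a b (\<lambda>x. f x $ i)) \<Longrightarrow> f \<in> L2_vec a b k"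
  by (simp add: L2_vec_def)

lemma L2_vecD:
  assumes "f \<in> L2_vec a b k"
  shows L2_vec_carrier: "x \<in> {a..b} \<Longrightarrow> f x \<in> carrier_vec k"
    and L2_vec_square_integrable: "i < k \<Longrightarrow> square_integrable a b (\<lambda>x. f x $ i)"
    and L2_vec_integrable: "i < k \<Longrightarrow> integrable (lebesgue_on {a..b}) (\<lambda>x. f x $ i)"
  using assms by (auto simp: L2_vec_def intro: square_integrable_integrable)

lemma ae_eqD: "ae_eq a b f g \<Longrightarrow> AE x in lebesgue_on {a..b}. f x $ i = g x $ i"
  unfolding ae_eq_def by (erule eventually_mono) simp

text \<open>\<open>ae_eq\<close> compares whole vectors, dimension included, so carrier conditions
  accompany the entrywise statement. The exceptional sets of the entries have a null union.\<close>

lemma ae_eqI: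
  assumes "\<And>x. x \<in> {a..b} \<Longrightarrow> f x \<in> carrier_vec k" "\<And>x. x \<in> {a..b} \<Longrightarrow> g x \<in> carrier_vec k"
    and "\<And>i. i < k \<Longrightarrow> AE x in lebesgue_on {a..b}. f x $ i = g x $ i"
  shows "ae_eq a b f g"
proof -
  have "AE x in lebesgue_on {a..b}. \<forall>i. i < k \<longrightarrow> f x $ i = g x $ i"
    using assms(3) by (subst AE_all_countable) auto
  then show ?thesis
    unfolding ae_eq_def
  proof (rule lebesgue_on_mono)
    fix x assume eq: "\<forall>i<k. f x $ i = g x $ i" and x: "x \<in> {a..b}"
    show "f x = g x" using assms(1,2)[OF x] eq by (intro eq_vecI) auto
  qed
qed

lemma ae_eq_refl [simp]: "ae_eq a b f f"
  by (simp add: ae_eq_def)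

lemma ae_eq_sym: "ae_eq a b f g \<Longrightarrow> ae_eq a b g f"
  unfolding ae_eq_def by (erule eventually_mono) simp

lemma ae_eq_trans: "ae_eq a b f g \<Longrightarrow> ae_eq a b g h \<Longrightarrow> ae_eq a b f h"
  unfolding ae_eq_def by (drule (1) eventually_conj) (erule eventually_mono, simp)

lemma ae_eq_on_interval: "(\<And>x. x \<in> {a..b} \<Longrightarrow> f x = g x) \<Longrightarrow> ae_eq a b f g"
  unfolding ae_eq_def by (intro AE_I2) simp

lemma L2_vec_ae_eq:
  assumes "f \<in> L2_vec a b k" "ae_eq a b f g" "\<And>x. x \<in> {a..b} \<Longrightarrow> g x \<in> carrier_vec k"
  shows "g \<in> L2_vec a b k"
  using assms(3) by (intro L2_vecI square_integrable_AE[OF L2_vec_square_integrable[OF assms(1)] ae_eqD[OF assms(2)]])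

section \<open>Weak derivatives and primitives of vector functions\<close>

definition vec_primitive :: "real \<Rightarrow> nat \<Rightarrow> (nat \<Rightarrow> real) \<Rightarrow> (real \<Rightarrow> real vec) \<Rightarrow> real \<Rightarrow> real vec" where
  "vec_primitive a k c w x = vec k (\<lambda>i. c i + (\<integral>t. w t $ i \<partial>lebesgue_on {a..x}))"

lemma vec_primitive_carrier [simp]: "vec_primitive a k c w x \<in> carrier_vec k"
  by (simp add: vec_primitive_def)

lemma vec_primitive_index [simp]:
  "i < k \<Longrightarrow> vec_primitive a k c w x $ i = c i + (\<integral>t. w t $ i \<partial>lebesgue_on {a..x})"
  by (simp add: vec_primitive_def)

lemma continuous_vec_primitive:
  assumes "w \<in> L2_vec a b k" "i < k"
  shows "continuous_on {a..b} (\<lambda>x. vec_primitive a k c w x $ i)"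
  using assms by (simp, intro continuous_intros continuous_primitive L2_vec_integrable)

lemma vec_primitive_L2:
  assumes "w \<in> L2_vec a b k"
  shows "vec_primitive a k c w \<in> L2_vec a b k"
  by (rule L2_vecI[OF vec_primitive_carrier square_integrable_continuous[OF continuous_vec_primitive[OF assms]]])

lemma has_weak_deriv_vec_primitive:
  assumes "a < b" "w \<in> L2_vec a b k"
  shows "has_weak_deriv a b k (vec_primitive a k c w) w"
  using assms unfolding has_weak_deriv_def
  by (auto intro!: vec_primitive_L2 integral_primitive_deriv_test L2_vec_square_integrable)

text \<open>Since \<open>weak_deriv\<close> picks some representative, the relation has to be
  invariant under changes on null sets in both arguments.\<close>

lemma has_weak_deriv_ae_eq:
  assumes d: "has_weak_deriv a b k f g" and f: "ae_eq a b f f'" "f' \<in> L2_vec a b k"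
    and g: "ae_eq a b g g'" "g' \<in> L2_vec a b k"
  shows "has_weak_deriv a b k f' g'"
  unfolding has_weak_deriv_def
proof (intro conjI allI impI f g)
  fix \<phi> i assume \<phi>: "test_function a b \<phi>" and i: "i < k"
  note D = test_functionD[OF \<phi>]
  note [measurable] = continuous_borel_measurable_interval[OF D(2)] continuous_borel_measurable_interval[OF D(3)]
  have fg: "f \<in> L2_vec a b k" "g \<in> L2_vec a b k" using d by (auto simp: has_weak_deriv_def)
  have [measurable]: "(\<lambda>x. f x $ i) \<in> borel_measurable (lebesgue_on {a..b})"
    "(\<lambda>x. g x $ i) \<in> borel_measurable (lebesgue_on {a..b})"
    "(\<lambda>x. f' x $ i) \<in> borel_measurable (lebesgue_on {a..b})"
    "(\<lambda>x. g' x $ i) \<in> borel_measurable (lebesgue_on {a..b})"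
    using fg f g i by (auto intro!: borel_measurable_integrable L2_vec_integrable)
  have "(\<integral>x. f' x $ i * deriv \<phi> x \<partial>lebesgue_on {a..b}) = (\<integral>x. f x $ i * deriv \<phi> x \<partial>lebesgue_on {a..b})"
    using ae_eqD[OF f(1), of i] by (intro integral_cong_AE) auto
  also have "\<dots> = - (\<integral>x. g x $ i * \<phi> x \<partial>lebesgue_on {a..b})"
    using d \<phi> i by (simp add: has_weak_deriv_def)
  also have "(\<integral>x. g x $ i * \<phi> x \<partial>lebesgue_on {a..b}) = (\<integral>x. g' x $ i * \<phi> x \<partial>lebesgue_on {a..b})"
    using ae_eqD[OF g(1), of i] by (intro integral_cong_AE) auto
  finally show "(\<integral>x. f' x $ i * deriv \<phi> x \<partial>lebesgue_on {a..b}) = - (\<integral>x. g' x $ i * \<phi> x \<partial>lebesgue_on {a..b})" .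
qed

text \<open>Entry by entry, f minus the primitive of g has weak derivative zero, so by
  \<open>du_Bois_Reymond\<close> it is constant almost everywhere; these constants form c.\<close>

lemma has_weak_deriv_imp_vec_primitive:
  assumes "a < b" and d: "has_weak_deriv a b k f g"
  obtains c where "ae_eq a b f (vec_primitive a k c g)"
proof -
  have fg: "f \<in> L2_vec a b k" "g \<in> L2_vec a b k" using d by (auto simp: has_weak_deriv_def)
  have "\<exists>C. AE x in lebesgue_on {a..b}. f x $ i = C + (\<integral>t. g t $ i \<partial>lebesgue_on {a..x})" if i: "i < k" for i
  proof -
    let ?P = "\<lambda>x. \<integral>t. g t $ i \<partial>lebesgue_on {a..x}"
    have P: "square_integrable a b ?P"
      by (intro square_integrable_continuous continuous_primitive L2_vec_integrable[OF fg(2) i])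
    have fi: "square_integrable a b (\<lambda>x. f x $ i)" using fg(1) i by (rule L2_vec_square_integrable)
    obtain C where "AE x in lebesgue_on {a..b}. f x $ i - ?P x = C"
    proof (rule du_Bois_Reymond[OF \<open>a < b\<close>])
      show "integrable (lebesgue_on {a..b}) (\<lambda>x. f x $ i - ?P x)"
        by (intro square_integrable_integrable square_integrable_diff fi P)
      fix \<phi> assume \<phi>: "test_function a b \<phi>"
      then have \<phi>': "square_integrable a b (deriv \<phi>)"
        by (intro square_integrable_continuous test_functionD)
      have "(\<integral>x. (f x $ i - ?P x) * deriv \<phi> x \<partial>lebesgue_on {a..b})
          = (\<integral>x. f x $ i * deriv \<phi> x \<partial>lebesgue_on {a..b}) - (\<integral>x. ?P x * deriv \<phi> x \<partial>lebesgue_on {a..b})"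
        using square_integrable_integrable_mult[OF fi \<phi>'] square_integrable_integrable_mult[OF P \<phi>']
        by (simp add: left_diff_distrib)
      also have "\<dots> = 0"
        using d \<phi> i \<open>a < b\<close> integral_primitive_deriv_test[OF L2_vec_square_integrable[OF fg(2) i] \<phi>, of 0]
        by (simp add: has_weak_deriv_def)
      finally show "(\<integral>x. (f x $ i - ?P x) * deriv \<phi> x \<partial>lebesgue_on {a..b}) = 0" .
    qed
    then have "AE x in lebesgue_on {a..b}. f x $ i = C + ?P x"
      by (rule eventually_mono) simp
    then show ?thesis ..
  qed
  then obtain c where c: "\<And>i. i < k \<Longrightarrow> AE x in lebesgue_on {a..b}. f x $ i = c i + (\<integral>t. g t $ i \<partial>lebesgue_on {a..x})"
    by metis
  have "ae_eq a b f (vec_primitive a k c g)"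
    by (rule ae_eqI[where k = k]) (use fg c in \<open>auto intro: L2_vec_carrier\<close>)
  then show ?thesis using that by blast
qed

lemma primitive_at_left [simp]:
  fixes f :: "real \<Rightarrow> real"
  shows "(\<integral>t. f t \<partial>lebesgue_on {a}) = 0"
proof -
  have "{a::real} \<in> null_sets lebesgue" by (simp add: negligible_iff_null_sets[symmetric])
  then show ?thesis by (simp add: integral_eq_zero_null_sets)
qed

text \<open>Primitives are continuous, so they agree at every point of the interval. At x = a this
  compares the constants; what remains says that g - h has a vanishing primitive.\<close>

lemma vec_primitive_ae_eq_unique:
  assumes "a < b" and g: "g \<in> L2_vec a b k" and h: "h \<in> L2_vec a b k"
    and ae: "ae_eq a b (vec_primitive a k c g) (vec_primitive a k d h)"
  shows "\<And>i. i < k \<Longrightarrow> c i = d i" and "ae_eq a b g h"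
proof -
  have eq: "c i + (\<integral>t. g t $ i \<partial>lebesgue_on {a..x}) = d i + (\<integral>t. h t $ i \<partial>lebesgue_on {a..x})"
    if "i < k" "x \<in> {a..b}" for i x
    using continuous_AE_eq_interval[OF \<open>a < b\<close> continuous_vec_primitive[OF g that(1)]
        continuous_vec_primitive[OF h that(1)] ae_eqD[OF ae] that(2)] that(1) by simp
  show c: "c i = d i" if "i < k" for i using eq[OF that, of a] \<open>a < b\<close> by simp
  show "ae_eq a b g h"
  proof (rule ae_eqI[where k = k])
    fix i assume i: "i < k"
    have "AE x in lebesgue_on {a..b}. g x $ i - h x $ i = 0"
    proof (rule AE_zero_if_primitive_zero)
      show "integrable (lebesgue_on {a..b}) (\<lambda>x. g x $ i - h x $ i)"
        using L2_vec_integrable[OF g i] L2_vec_integrable[OF h i] by simp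
      fix x assume x: "x \<in> {a..b}"
      then have "{a..x} \<subseteq> {a..b}" by auto
      then show "(\<integral>t. g t $ i - h t $ i \<partial>lebesgue_on {a..x}) = 0"
        using integrable_interval_mono[OF L2_vec_integrable[OF g i]]
          integrable_interval_mono[OF L2_vec_integrable[OF h i]] eq[OF i x] c[OF i] by simp
    qed
    then show "AE x in lebesgue_on {a..b}. g x $ i = h x $ i" by simp
  qed (use g h in \<open>auto intro: L2_vec_carrier\<close>)
qed

lemma has_weak_deriv_unique:
  assumes "a < b" "has_weak_deriv a b k f g" "has_weak_deriv a b k f h"
  shows "ae_eq a b g h"
proof -
  obtain c where c: "ae_eq a b f (vec_primitive a k c g)"
    using has_weak_deriv_imp_vec_primitive[OF assms(1,2)] .
  obtain d where d: "ae_eq a b f (vec_primitive a k d h)"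
    using has_weak_deriv_imp_vec_primitive[OF assms(1,3)] .
  have "g \<in> L2_vec a b k" "h \<in> L2_vec a b k" using assms by (auto simp: has_weak_deriv_def)
  from vec_primitive_ae_eq_unique(2)[OF assms(1) this ae_eq_trans[OF ae_eq_sym[OF c] d]]
  show ?thesis .
qed

section \<open>Taylor form of functions with two weak derivatives\<close>

lemma has_weak_deriv_weak_deriv:
  "has_weak_deriv a b k f g \<Longrightarrow> has_weak_deriv a b k f (weak_deriv a b k f)"
  unfolding weak_deriv_def by (rule someI[where P = "has_weak_deriv a b k f"])

text \<open>Taylor's formula at a with integral remainder. The vector c holds u(a) in its first n
  entries and u_x(a) in its last n, in the order of the columns of \<open>affine_row\<close>; w is
  the second derivative.\<close>

definition reconstruction :: "real \<Rightarrow> nat \<Rightarrow> real vec \<Rightarrow> (real \<Rightarrow> real vec) \<Rightarrow> real \<Rightarrow> real vec" where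
  "reconstruction a n c w x =
     vec n (\<lambda>i. c $ i + (x - a) * c $ (n + i) + (\<integral>t. (x - t) * w t $ i \<partial>lebesgue_on {a..x}))"

definition reconstruction_deriv :: "real \<Rightarrow> nat \<Rightarrow> real vec \<Rightarrow> (real \<Rightarrow> real vec) \<Rightarrow> real \<Rightarrow> real vec" where
  "reconstruction_deriv a n c w = vec_primitive a n (\<lambda>i. c $ (n + i)) w"

lemma reconstruction_carrier [simp]:
  "reconstruction a n c w x \<in> carrier_vec n" "reconstruction_deriv a n c w x \<in> carrier_vec n"
  by (simp_all add: reconstruction_def reconstruction_deriv_def)

lemma reconstruction_index [simp]:
  "i < n \<Longrightarrow> reconstruction a n c w x $ i =
     c $ i + (x - a) * c $ (n + i) + (\<integral>t. (x - t) * w t $ i \<partial>lebesgue_on {a..x})"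
  "i < n \<Longrightarrow> reconstruction_deriv a n c w x $ i = c $ (n + i) + (\<integral>t. w t $ i \<partial>lebesgue_on {a..x})"
  by (simp_all add: reconstruction_def reconstruction_deriv_def)

text \<open>By Cauchy's formula for repeated integration the Taylor form is the primitive of its
  formal derivative, so its regularity reduces to that of \<open>vec_primitive\<close>.\<close>

lemma vec_primitive_reconstruction_deriv:
  assumes w: "w \<in> L2_vec a b n" and x: "x \<in> {a..b}"
  shows "vec_primitive a n (\<lambda>i. c $ i) (reconstruction_deriv a n c w) x = reconstruction a n c w x"
proof (rule eq_vecI)
  fix i assume "i < dim_vec (reconstruction a n c w x)"
  then have i: "i < n" by (simp add: reconstruction_def)
  have sub: "{a..x} \<subseteq> {a..b}" using x by auto
  note wi = integrable_interval_mono[OF L2_vec_integrable[OF w i] sub]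
  have "(\<integral>t. reconstruction_deriv a n c w t $ i \<partial>lebesgue_on {a..x})
      = (\<integral>t. c $ (n + i) \<partial>lebesgue_on {a..x}) + (\<integral>t. (\<integral>s. w s $ i \<partial>lebesgue_on {a..t}) \<partial>lebesgue_on {a..x})"
    using i by (simp, subst Bochner_Integration.integral_add)
      (auto intro!: square_integrable_integrable square_integrable_continuous continuous_primitive wi)
  also have "\<dots> = (x - a) * c $ (n + i) + (\<integral>t. (x - t) * w t $ i \<partial>lebesgue_on {a..x})"
    using x integral_primitive_left[OF wi] by simp
  finally show "vec_primitive a n (\<lambda>i. c $ i) (reconstruction_deriv a n c w) x $ i = reconstruction a n c w x $ i"
    using i by simp
qed (simp add: reconstruction_def vec_primitive_def)

lemma reconstruction_L2:
  assumes w: "w \<in> L2_vec a b n"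
  shows "reconstruction a n c w \<in> L2_vec a b n" "reconstruction_deriv a n c w \<in> L2_vec a b n"
proof -
  show d: "reconstruction_deriv a n c w \<in> L2_vec a b n"
    unfolding reconstruction_deriv_def by (rule vec_primitive_L2[OF w])
  show "reconstruction a n c w \<in> L2_vec a b n"
    by (rule L2_vec_ae_eq[OF vec_primitive_L2[OF d] ae_eq_on_interval])
      (auto intro!: vec_primitive_reconstruction_deriv[OF w])
qed

lemma continuous_reconstruction:
  assumes w: "w \<in> L2_vec a b n" and i: "i < n"
  shows "continuous_on {a..b} (\<lambda>x. reconstruction a n c w x $ i)"
    and "continuous_on {a..b} (\<lambda>x. reconstruction_deriv a n c w x $ i)"
proof -
  show "continuous_on {a..b} (\<lambda>x. reconstruction_deriv a n c w x $ i)"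
    unfolding reconstruction_deriv_def by (rule continuous_vec_primitive[OF w i])
  show "continuous_on {a..b} (\<lambda>x. reconstruction a n c w x $ i)"
    using continuous_vec_primitive[OF reconstruction_L2(2)[OF w] i, of "\<lambda>i. c $ i" c]
    by (rule continuous_on_eq) (simp only: vec_primitive_reconstruction_deriv[OF w])
qed

lemma has_weak_deriv_reconstruction:
  assumes "a < b" "w \<in> L2_vec a b n"
  shows "has_weak_deriv a b n (reconstruction a n c w) (reconstruction_deriv a n c w)"
    and "has_weak_deriv a b n (reconstruction_deriv a n c w) w"
proof -
  show "has_weak_deriv a b n (reconstruction_deriv a n c w) w"
    using assms unfolding reconstruction_deriv_def by (rule has_weak_deriv_vec_primitive)
  show "has_weak_deriv a b n (reconstruction a n c w) (reconstruction_deriv a n c w)"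
    by (rule has_weak_deriv_ae_eq[OF has_weak_deriv_vec_primitive[OF assms(1)] ae_eq_on_interval _ ae_eq_refl])
      (use assms in \<open>auto intro: vec_primitive_reconstruction_deriv reconstruction_L2\<close>)
qed

text \<open>Once u has a Taylor form, uniqueness of weak derivatives identifies the arbitrary
  choices \<open>weak_deriv\<close> and \<open>weak_deriv2\<close> with explicit functions up to
  null sets.\<close>

lemma W22_weak_derivs:
  assumes "a < b" and u: "u \<in> L2_vec a b n" and w: "w \<in> L2_vec a b n"
    and ae: "ae_eq a b u (reconstruction a n c w)"
  shows W22_if_reconstruction: "u \<in> W22 a b n"
    and ae_eq_weak_deriv: "ae_eq a b (weak_deriv a b n u) (reconstruction_deriv a n c w)"
    and ae_eq_weak_deriv2: "ae_eq a b (weak_deriv2 a b n u) w"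
    and weak_deriv_L2: "weak_deriv a b n u \<in> L2_vec a b n"
    and weak_deriv2_L2: "weak_deriv2 a b n u \<in> L2_vec a b n"
proof -
  note R = has_weak_deriv_reconstruction[OF \<open>a < b\<close> w, of c]
  note rL2 = reconstruction_L2[OF w]
  have d1: "has_weak_deriv a b n u (reconstruction_deriv a n c w)"
    by (rule has_weak_deriv_ae_eq[OF R(1) ae_eq_sym[OF ae] u ae_eq_refl rL2(2)])
  note d1' = has_weak_deriv_weak_deriv[OF d1]
  show 1: "weak_deriv a b n u \<in> L2_vec a b n" using d1' by (simp add: has_weak_deriv_def)
  show e1: "ae_eq a b (weak_deriv a b n u) (reconstruction_deriv a n c w)"
    by (rule has_weak_deriv_unique[OF \<open>a < b\<close> d1' d1])
  \<comment> \<open>\<open>weak_deriv2\<close> differentiates the chosen first derivative, so the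
    explicit relation is first carried over to that representative.\<close>
  have d2: "has_weak_deriv a b n (weak_deriv a b n u) w"
    by (rule has_weak_deriv_ae_eq[OF R(2) ae_eq_sym[OF e1] 1 ae_eq_refl w])
  note d2' = has_weak_deriv_weak_deriv[OF d2]
  show "weak_deriv2 a b n u \<in> L2_vec a b n" using d2' by (simp add: has_weak_deriv_def)
  show "ae_eq a b (weak_deriv2 a b n u) w"
    by (rule has_weak_deriv_unique[OF \<open>a < b\<close> d2' d2])
  show "u \<in> W22 a b n" using u d1' d2' by (auto simp: W22_def)
qed

text \<open>Integrating the second weak derivative twice recovers u. The constants of the outer and
  of the inner integration are u(a) and u_x(a), and they become the halves of c.\<close>

lemma W22_reconstruction:
  assumes "a < b" "u \<in> W22 a b n"
  obtains c where "c \<in> carrier_vec (2 * n)" "ae_eq a b u (reconstruction a n c (weak_deriv2 a b n u))"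
    "weak_deriv2 a b n u \<in> L2_vec a b n" "u \<in> L2_vec a b n"
proof -
  obtain g h where u: "u \<in> L2_vec a b n" and g: "has_weak_deriv a b n u g" and h: "has_weak_deriv a b n g h"
    using assms(2) by (auto simp: W22_def)
  have L2: "g \<in> L2_vec a b n" "h \<in> L2_vec a b n" using g h by (auto simp: has_weak_deriv_def)
  note g' = has_weak_deriv_weak_deriv[OF g]
  have L2': "weak_deriv a b n u \<in> L2_vec a b n" using g' by (simp add: has_weak_deriv_def)
  have "has_weak_deriv a b n (weak_deriv a b n u) h"
    by (rule has_weak_deriv_ae_eq[OF h has_weak_deriv_unique[OF assms(1) g g'] L2' ae_eq_refl L2(2)])
  note h' = has_weak_deriv_weak_deriv[OF this]
  have L2'': "weak_deriv2 a b n u \<in> L2_vec a b n" using h' by (simp add: has_weak_deriv_def)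
  obtain c where c: "ae_eq a b u (vec_primitive a n c (weak_deriv a b n u))"
    using has_weak_deriv_imp_vec_primitive[OF assms(1) g'] .
  obtain d where d: "ae_eq a b (weak_deriv a b n u) (vec_primitive a n d (weak_deriv2 a b n u))"
    using has_weak_deriv_imp_vec_primitive[OF assms(1) h'] .
  define e where "e = vec (2 * n) (\<lambda>i. if i < n then c i else d (i - n))"
  have "vec_primitive a n d (weak_deriv2 a b n u) = reconstruction_deriv a n e (weak_deriv2 a b n u)"
    unfolding reconstruction_deriv_def vec_primitive_def by (intro ext eq_vecI) (auto simp: e_def)
  with d have d': "ae_eq a b (weak_deriv a b n u) (reconstruction_deriv a n e (weak_deriv2 a b n u))" by simp
  have "vec_primitive a n c (weak_deriv a b n u) x = reconstruction a n e (weak_deriv2 a b n u) x"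
    if x: "x \<in> {a..b}" for x
  proof -
    have "vec_primitive a n c (weak_deriv a b n u) x
        = vec_primitive a n (\<lambda>i. e $ i) (reconstruction_deriv a n e (weak_deriv2 a b n u)) x"
    proof (rule eq_vecI)
      fix i assume "i < dim_vec (vec_primitive a n (\<lambda>i. e $ i) (reconstruction_deriv a n e (weak_deriv2 a b n u)) x)"
      then have i: "i < n" by (simp add: vec_primitive_def)
      have sub: "{a..x} \<subseteq> {a..b}" using x by auto
      note rL2 = reconstruction_L2(2)[OF L2'']
      \<comment> \<open>The chosen first derivative agrees with its explicit form only almost
        everywhere; under the outer integral this becomes an equality at every x.\<close>
      have "AE t in lebesgue_on {a..x}. weak_deriv a b n u t $ i = reconstruction_deriv a n e (weak_deriv2 a b n u) t $ i"
        using ae_eqD[OF d', of i] sub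
        by (auto simp: AE_restrict_space_iff elim!: eventually_mono)
      then have "(\<integral>t. weak_deriv a b n u t $ i \<partial>lebesgue_on {a..x})
          = (\<integral>t. reconstruction_deriv a n e (weak_deriv2 a b n u) t $ i \<partial>lebesgue_on {a..x})"
        using integrable_interval_mono[OF L2_vec_integrable[OF L2' i] sub]
          integrable_interval_mono[OF L2_vec_integrable[OF rL2 i] sub]
        by (intro integral_cong_AE borel_measurable_integrable)
      then show "vec_primitive a n c (weak_deriv a b n u) x $ i
          = vec_primitive a n (\<lambda>i. e $ i) (reconstruction_deriv a n e (weak_deriv2 a b n u)) x $ i"
        using i by (simp add: e_def del: reconstruction_index)
    qed (simp add: vec_primitive_def)
    also have "\<dots> = reconstruction a n e (weak_deriv2 a b n u) x"
      by (rule vec_primitive_reconstruction_deriv[OF L2'' x])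
    finally show ?thesis .
  qed
  then have "ae_eq a b u (reconstruction a n e (weak_deriv2 a b n u))"
    using ae_eq_trans[OF c ae_eq_on_interval] by blast
  moreover have "e \<in> carrier_vec (2 * n)" by (simp add: e_def)
  ultimately show ?thesis using that u L2'' by blast
qed

text \<open>The chosen representative is continuous and almost everywhere equal to g, hence equal to
  g on the closed interval. The boundary values in \<open>X_space\<close> can thus be computed from
  the Taylor form.\<close>

lemma cont_rep_eq:
  assumes "a < b" and ae: "ae_eq a b f g" and gc: "\<And>x. x \<in> {a..b} \<Longrightarrow> g x \<in> carrier_vec k"
    and g: "\<And>i. i < k \<Longrightarrow> continuous_on {a..b} (\<lambda>x. g x $ i)" and x: "x \<in> {a..b}"
  shows "cont_rep a b k f x = g x"
proof -
  let ?P = "\<lambda>g. (\<forall>x\<in>{a..b}. g x \<in> carrier_vec k) \<and>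
     (\<forall>i<k. continuous_on {a..b} (\<lambda>x. g x $ i)) \<and> ae_eq a b g f"
  have "?P g" using gc g ae_eq_sym[OF ae] by blast
  then have P: "?P (cont_rep a b k f)" unfolding cont_rep_def by (rule someI[where P = ?P])
  then have "cont_rep a b k f x \<in> carrier_vec k" using x by blast
  moreover have "ae_eq a b (cont_rep a b k f) g" using P ae_eq_trans[OF _ ae] by blast
  then have "cont_rep a b k f x $ i = g x $ i" if "i < k" for i
    using P that x by (intro continuous_AE_eq_interval[OF \<open>a < b\<close> _ g[OF that] ae_eqD]) auto
  ultimately show ?thesis using gc[OF x] by (auto intro!: eq_vecI)
qed

subsection \<open>Integration of vectors and matrices\<close>

lemma vec_integral_carrier [simp]: "vec_integral a b k f \<in> carrier_vec k"
  by (simp add: vec_integral_def)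

lemma dim_vec_integral [simp]: "dim_vec (vec_integral a b k f) = k"
  by (simp add: vec_integral_def)

lemma vec_integral_index [simp]:
  "i < k \<Longrightarrow> vec_integral a b k f $ i = (\<integral>x. f x $ i \<partial>lebesgue_on {a..b})"
  by (simp add: vec_integral_def)

lemma mat_integral_carrier [simp]: "mat_integral a b k l M \<in> carrier_mat k l"
  by (simp add: mat_integral_def)

lemma vec_integral_cong:
  "(\<And>x. x \<in> {a..b} \<Longrightarrow> f x = g x) \<Longrightarrow> vec_integral a b k f = vec_integral a b k g"
  unfolding vec_integral_def by (intro eq_vecI) (auto intro!: integral_interval_cong)

lemma vec_integral_add:
  assumes "\<And>i. i < k \<Longrightarrow> integrable (lebesgue_on {a..b}) (\<lambda>x. f x $ i)"
    and "\<And>i. i < k \<Longrightarrow> integrable (lebesgue_on {a..b}) (\<lambda>x. g x $ i)"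
    and "\<And>x. x \<in> {a..b} \<Longrightarrow> f x \<in> carrier_vec k" "\<And>x. x \<in> {a..b} \<Longrightarrow> g x \<in> carrier_vec k"
  shows "vec_integral a b k (\<lambda>x. f x + g x) = vec_integral a b k f + vec_integral a b k g"
proof (rule eq_vecI)
  fix i assume "i < dim_vec (vec_integral a b k f + vec_integral a b k g)"
  then have i: "i < k" by simp
  have "(\<integral>x. (f x + g x) $ i \<partial>lebesgue_on {a..b}) = (\<integral>x. f x $ i + g x $ i \<partial>lebesgue_on {a..b})"
    using assms(4) i by (intro integral_interval_cong index_add_vec) (metis carrier_vecD)
  then show "vec_integral a b k (\<lambda>x. f x + g x) $ i = (vec_integral a b k f + vec_integral a b k g) $ i"
    using assms(1,2) i by simp
qed simp

lemma vec_integral_append: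
  assumes "\<And>x. x \<in> {a..b} \<Longrightarrow> f x \<in> carrier_vec k" "\<And>x. x \<in> {a..b} \<Longrightarrow> g x \<in> carrier_vec l"
  shows "vec_integral a b (k + l) (\<lambda>x. f x @\<^sub>v g x) = vec_integral a b k f @\<^sub>v vec_integral a b l g"
proof (rule eq_vecI)
  fix i assume "i < dim_vec (vec_integral a b k f @\<^sub>v vec_integral a b l g)"
  then have i: "i < k + l" by simp
  have "(\<integral>x. (f x @\<^sub>v g x) $ i \<partial>lebesgue_on {a..b})
      = (\<integral>x. (if i < k then f x $ i else g x $ (i - k)) \<partial>lebesgue_on {a..b})"
  proof (rule integral_interval_cong)
    fix x assume "x \<in> {a..b}"
    then have "dim_vec (f x) = k" "dim_vec (g x) = l" using assms by auto
    then show "(f x @\<^sub>v g x) $ i = (if i < k then f x $ i else g x $ (i - k))" using i by simp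
  qed
  then show "vec_integral a b (k + l) (\<lambda>x. f x @\<^sub>v g x) $ i = (vec_integral a b k f @\<^sub>v vec_integral a b l g) $ i"
    using i by (auto split: if_splits)
qed simp

lemma mult_mat_vec_index_sum:
  "A \<in> carrier_mat r k \<Longrightarrow> v \<in> carrier_vec k \<Longrightarrow> i < r \<Longrightarrow> (A *\<^sub>v v) $ i = (\<Sum>j<k. A $$ (i, j) * v $ j)"
  by (simp add: scalar_prod_def atLeast0LessThan)

lemma mult_vec_integral:
  assumes E: "E \<in> carrier_mat r k" and f: "\<And>x. x \<in> {a..b} \<Longrightarrow> f x \<in> carrier_vec k"
    and fi: "\<And>i. i < k \<Longrightarrow> integrable (lebesgue_on {a..b}) (\<lambda>x. f x $ i)"
  shows "E *\<^sub>v vec_integral a b k f = vec_integral a b r (\<lambda>x. E *\<^sub>v f x)"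
proof (rule eq_vecI)
  fix i assume "i < dim_vec (vec_integral a b r (\<lambda>x. E *\<^sub>v f x))"
  then have i: "i < r" by simp
  have "(\<integral>x. (E *\<^sub>v f x) $ i \<partial>lebesgue_on {a..b}) = (\<integral>x. (\<Sum>j<k. E $$ (i, j) * f x $ j) \<partial>lebesgue_on {a..b})"
    using f by (intro integral_interval_cong mult_mat_vec_index_sum[OF E _ i])
  also have "\<dots> = (\<Sum>j<k. E $$ (i, j) * (\<integral>x. f x $ j \<partial>lebesgue_on {a..b}))"
    using fi by (subst Bochner_Integration.integral_sum) auto
  also have "\<dots> = (E *\<^sub>v vec_integral a b k f) $ i"
    using i by (subst mult_mat_vec_index_sum[OF E vec_integral_carrier i]) simp
  finally show "(E *\<^sub>v vec_integral a b k f) $ i = vec_integral a b r (\<lambda>x. E *\<^sub>v f x) $ i"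
    using i by simp
qed (use E in simp)

lemma mat_integral_mult_vec:
  assumes M: "\<And>x. x \<in> {a..b} \<Longrightarrow> M x \<in> carrier_mat r k" and c: "c \<in> carrier_vec k"
    and Mi: "\<And>i j. i < r \<Longrightarrow> j < k \<Longrightarrow> integrable (lebesgue_on {a..b}) (\<lambda>x. M x $$ (i, j))"
  shows "mat_integral a b r k M *\<^sub>v c = vec_integral a b r (\<lambda>x. M x *\<^sub>v c)"
proof (rule eq_vecI)
  fix i assume "i < dim_vec (vec_integral a b r (\<lambda>x. M x *\<^sub>v c))"
  then have i: "i < r" by simp
  have "(\<integral>x. (M x *\<^sub>v c) $ i \<partial>lebesgue_on {a..b}) = (\<integral>x. (\<Sum>j<k. M x $$ (i, j) * c $ j) \<partial>lebesgue_on {a..b})"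
    using M by (intro integral_interval_cong mult_mat_vec_index_sum[OF _ c i])
  also have "\<dots> = (\<Sum>j<k. (\<integral>x. M x $$ (i, j) \<partial>lebesgue_on {a..b}) * c $ j)"
    using Mi i by (subst Bochner_Integration.integral_sum) auto
  also have "\<dots> = (mat_integral a b r k M *\<^sub>v c) $ i"
    using i by (subst mult_mat_vec_index_sum[OF mat_integral_carrier c i]) (simp add: mat_integral_def)
  finally show "(mat_integral a b r k M *\<^sub>v c) $ i = vec_integral a b r (\<lambda>x. M x *\<^sub>v c) $ i"
    using i by simp
qed (simp add: mat_integral_def)

lemma L2_matD:
  assumes "F \<in> L2_mat a b k l"
  shows L2_mat_carrier: "x \<in> {a..b} \<Longrightarrow> F x \<in> carrier_mat k l"
    and L2_mat_square_integrable: "i < k \<Longrightarrow> j < l \<Longrightarrow> square_integrable a b (\<lambda>x. F x $$ (i, j))"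
  using assms by (auto simp: L2_mat_def)

lemma integrable_interval_cong:
  fixes f g :: "real \<Rightarrow> real"
  assumes "integrable (lebesgue_on {a..b}) f" "\<And>x. x \<in> {a..b} \<Longrightarrow> f x = g x"
  shows "integrable (lebesgue_on {a..b}) g"
  using assms Bochner_Integration.integrable_cong[of "lebesgue_on {a..b}" "lebesgue_on {a..b}" f g] by simp

text \<open>The entries are sums of products of two square-integrable functions, which are
  integrable but in general not square-integrable.\<close>

lemma integrable_L2_mat_mult_vec:
  assumes "F \<in> L2_mat a b r k" "u \<in> L2_vec a b k" "i < r"
  shows "integrable (lebesgue_on {a..b}) (\<lambda>x. (F x *\<^sub>v u x) $ i)"
proof -
  have "integrable (lebesgue_on {a..b}) (\<lambda>x. \<Sum>j<k. F x $$ (i, j) * u x $ j)"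
    using assms by (intro Bochner_Integration.integrable_sum square_integrable_integrable_mult
        L2_mat_square_integrable L2_vec_square_integrable) auto
  then show ?thesis
    by (rule integrable_interval_cong)
      (rule mult_mat_vec_index_sum[OF L2_mat_carrier[OF assms(1)] L2_vec_carrier[OF assms(2)] assms(3), symmetric])
qed

subsection \<open>The boundary functional on reconstructed functions\<close>

lemma append_cols_carrier [simp]:
  "A \<in> carrier_mat r k \<Longrightarrow> B \<in> carrier_mat r l \<Longrightarrow> append_cols A B \<in> carrier_mat r (k + l)"
  by (auto simp: append_cols_def)

lemma append_cols_mult_vec:
  assumes "A \<in> carrier_mat r k" "B \<in> carrier_mat r l" "c \<in> carrier_vec k" "d \<in> carrier_vec l"
  shows "append_cols A B *\<^sub>v (c @\<^sub>v d) = A *\<^sub>v c + B *\<^sub>v d"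
proof -
  \<comment> \<open>\<open>append_cols\<close> is a block matrix whose two lower blocks have no
    rows; they append an empty vector to the product.\<close>
  have "append_cols A B *\<^sub>v (c @\<^sub>v d) = (A *\<^sub>v c + B *\<^sub>v d) @\<^sub>v (0\<^sub>m 0 k *\<^sub>v c + 0\<^sub>m 0 l *\<^sub>v d)"
    unfolding append_cols_def using assms
    by (subst four_block_mat_mult_vec[of A r k B l _ 0]) auto
  also have "\<dots> = A *\<^sub>v c + B *\<^sub>v d" using assms by (intro eq_vecI) auto
  finally show ?thesis .
qed

lemma zero_mat_mult_vec: "v \<in> carrier_vec k \<Longrightarrow> 0\<^sub>m r k *\<^sub>v v = (0\<^sub>v r :: real vec)"
  by (intro eq_vecI) auto

lemma smult_one_mat_mult_vec: "v \<in> carrier_vec n \<Longrightarrow> (s \<cdot>\<^sub>m 1\<^sub>m n) *\<^sub>v v = s \<cdot>\<^sub>v (v :: real vec)"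
  by (intro eq_vecI) auto

lemma affine_row_carrier [simp]: "affine_row a n x \<in> carrier_mat n (2 * n)"
  using append_cols_carrier[of "1\<^sub>m n" n n "(x - a) \<cdot>\<^sub>m 1\<^sub>m n" n] by (simp add: affine_row_def mult_2)

text \<open>Lower and upper refer to the range of indices. For Cauchy data the halves are u(a) and
  u_x(a).\<close>

definition vec_lower :: "nat \<Rightarrow> real vec \<Rightarrow> real vec" where "vec_lower n c = vec n (\<lambda>i. c $ i)"
definition vec_upper :: "nat \<Rightarrow> real vec \<Rightarrow> real vec" where "vec_upper n c = vec n (\<lambda>i. c $ (n + i))"

lemma vec_halves_carrier [simp]: "vec_lower n c \<in> carrier_vec n" "vec_upper n c \<in> carrier_vec n"
  by (simp_all add: vec_lower_def vec_upper_def)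

lemma vec_halves_append: "c \<in> carrier_vec (2 * n) \<Longrightarrow> vec_lower n c @\<^sub>v vec_upper n c = c"
  by (intro eq_vecI) (auto simp: vec_lower_def vec_upper_def)

lemma append_cols_mult_halves:
  assumes "A \<in> carrier_mat r n" "B \<in> carrier_mat r n" "c \<in> carrier_vec (2 * n)"
  shows "append_cols A B *\<^sub>v c = A *\<^sub>v vec_lower n c + B *\<^sub>v vec_upper n c"
  using append_cols_mult_vec[OF assms(1,2) vec_halves_carrier] vec_halves_append[OF assms(3)] by metis

lemma affine_row_mult_vec:
  "c \<in> carrier_vec (2 * n) \<Longrightarrow> affine_row a n x *\<^sub>v c = vec_lower n c + (x - a) \<cdot>\<^sub>v vec_upper n c"
  by (simp add: affine_row_def append_cols_mult_halves[of _ n n] smult_one_mat_mult_vec)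

text \<open>Brings the Taylor form into the shape of \<open>T_op\<close>: an affine part applied to
  a coefficient vector plus a Volterra term.\<close>

lemma reconstruction_affine_row:
  assumes c: "c \<in> carrier_vec (2 * n)" and w: "\<And>t. t \<in> {a..x} \<Longrightarrow> w t \<in> carrier_vec n"
  shows "reconstruction a n c w x = affine_row a n x *\<^sub>v c + vec_integral a x n (\<lambda>t. (x - t) \<cdot>\<^sub>v w t)"
proof (rule eq_vecI)
  fix i assume "i < dim_vec (affine_row a n x *\<^sub>v c + vec_integral a x n (\<lambda>t. (x - t) \<cdot>\<^sub>v w t))"
  then have i: "i < n" by simp
  have "(\<integral>t. ((x - t) \<cdot>\<^sub>v w t) $ i \<partial>lebesgue_on {a..x}) = (\<integral>t. (x - t) * w t $ i \<partial>lebesgue_on {a..x})"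
    using w i by (intro integral_interval_cong index_smult_vec) (metis carrier_vecD)
  then show "reconstruction a n c w x $ i
      = (affine_row a n x *\<^sub>v c + vec_integral a x n (\<lambda>t. (x - t) \<cdot>\<^sub>v w t)) $ i"
    using i c by (simp add: affine_row_mult_vec vec_lower_def vec_upper_def del: index_mult_mat_vec)
qed (simp add: reconstruction_def)

text \<open>Maps Cauchy data to the boundary values [u(a); u(b); u_x(a); u_x(b)] of the affine
  function with these data. It is literally the matrix next to E in \<open>G_mat\<close>, so that
  definition can be folded.\<close>

definition boundary_affine :: "real \<Rightarrow> real \<Rightarrow> nat \<Rightarrow> real mat" where
  "boundary_affine a b n = append_cols (1\<^sub>m n) (0\<^sub>m n n)
          @\<^sub>r append_cols (1\<^sub>m n) ((b - a) \<cdot>\<^sub>m 1\<^sub>m n)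
          @\<^sub>r append_cols (0\<^sub>m n n) (1\<^sub>m n)
          @\<^sub>r append_cols (0\<^sub>m n n) (1\<^sub>m n)"

text \<open>The contribution of u_xx at the point x to the same four boundary values: nothing at a,
  weight b - x in u(b), weight 1 in u_x(b). It is the matrix next to E in \<open>H_mat\<close>,
  where it carries a minus sign.\<close>

definition boundary_kernel :: "real \<Rightarrow> nat \<Rightarrow> real \<Rightarrow> real mat" where
  "boundary_kernel b n x = 0\<^sub>m n n @\<^sub>r ((b - x) \<cdot>\<^sub>m 1\<^sub>m n) @\<^sub>r 0\<^sub>m n n @\<^sub>r 1\<^sub>m n"

text \<open>Nested to the right, because the stacking operators associate to the right and the
  dimensions of their blocks add up in this order.\<close>

lemma four_mult_eq_add: "4 * n = n + (n + (n + n :: nat))"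
  by simp

lemma boundary_affine_carrier [simp]: "boundary_affine a b n \<in> carrier_mat (4 * n) (2 * n)"
  unfolding boundary_affine_def four_mult_eq_add mult_2
  by (intro carrier_append_rows append_cols_carrier) auto

lemma boundary_kernel_carrier [simp]: "boundary_kernel b n x \<in> carrier_mat (4 * n) n"
  unfolding boundary_kernel_def four_mult_eq_add by (intro carrier_append_rows) auto

lemma append_rows4_mult_vec:
  assumes A: "A \<in> carrier_mat r1 k" and B: "B \<in> carrier_mat r2 k" and C: "C \<in> carrier_mat r3 k"
    and D: "D \<in> carrier_mat r4 k" and v: "v \<in> carrier_vec k"
  shows "(A @\<^sub>r B @\<^sub>r C @\<^sub>r D) *\<^sub>v v = A *\<^sub>v v @\<^sub>v B *\<^sub>v v @\<^sub>v C *\<^sub>v v @\<^sub>v D *\<^sub>v v"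
  by (simp only: mat_mult_append[OF A carrier_append_rows[OF B carrier_append_rows[OF C D]] v]
      mat_mult_append[OF B carrier_append_rows[OF C D] v] mat_mult_append[OF C D v])

lemma boundary_affine_mult:
  assumes c: "c \<in> carrier_vec (2 * n)"
  shows "boundary_affine a b n *\<^sub>v c = vec_lower n c @\<^sub>v (vec_lower n c + (b - a) \<cdot>\<^sub>v vec_upper n c)
     @\<^sub>v vec_upper n c @\<^sub>v vec_upper n c"
proof -
  have cc: "append_cols A B \<in> carrier_mat n (2 * n)" if "A \<in> carrier_mat n n" "B \<in> carrier_mat n n" for A B :: "real mat"
    unfolding mult_2 using that by simp
  have "boundary_affine a b n *\<^sub>v c = append_cols (1\<^sub>m n) (0\<^sub>m n n) *\<^sub>v c
      @\<^sub>v append_cols (1\<^sub>m n) ((b - a) \<cdot>\<^sub>m 1\<^sub>m n) *\<^sub>v c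
      @\<^sub>v append_cols (0\<^sub>m n n) (1\<^sub>m n) *\<^sub>v c @\<^sub>v append_cols (0\<^sub>m n n) (1\<^sub>m n) *\<^sub>v c"
    unfolding boundary_affine_def by (rule append_rows4_mult_vec[OF _ _ _ _ c]; rule cc; simp)
  then show ?thesis
    by (simp add: append_cols_mult_halves[of _ n n, OF _ _ c] smult_one_mat_mult_vec zero_mat_mult_vec)
qed

lemma boundary_kernel_mult:
  assumes w: "w \<in> carrier_vec n"
  shows "boundary_kernel b n x *\<^sub>v w = 0\<^sub>v n @\<^sub>v ((b - x) \<cdot>\<^sub>v w) @\<^sub>v 0\<^sub>v n @\<^sub>v w"
proof -
  have "boundary_kernel b n x *\<^sub>v w
      = 0\<^sub>m n n *\<^sub>v w @\<^sub>v ((b - x) \<cdot>\<^sub>m 1\<^sub>m n) *\<^sub>v w @\<^sub>v 0\<^sub>m n n *\<^sub>v w @\<^sub>v 1\<^sub>m n *\<^sub>v w"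
    unfolding boundary_kernel_def by (rule append_rows4_mult_vec[OF _ _ _ _ w]) auto
  then show ?thesis using w by (simp add: smult_one_mat_mult_vec zero_mat_mult_vec)
qed

text \<open>Taylor's formula and its derivative at both endpoints: at a the integrals are empty, at
  b they carry the weights of \<open>boundary_kernel\<close>.\<close>

lemma boundary_values_reconstruction:
  assumes "a < b" and c: "c \<in> carrier_vec (2 * n)" and w: "w \<in> L2_vec a b n"
  shows "reconstruction a n c w a @\<^sub>v reconstruction a n c w b
      @\<^sub>v reconstruction_deriv a n c w a @\<^sub>v reconstruction_deriv a n c w b
    = boundary_affine a b n *\<^sub>v c + vec_integral a b (4 * n) (\<lambda>x. boundary_kernel b n x *\<^sub>v w x)"
proof -
  let ?I0 = "vec_integral a b n (\<lambda>x. (b - x) \<cdot>\<^sub>v w x)" and ?I1 = "vec_integral a b n w"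
  note wc = L2_vec_carrier[OF w]
  have "vec_integral a b (4 * n) (\<lambda>x. boundary_kernel b n x *\<^sub>v w x)
      = vec_integral a b (n + (n + (n + n))) (\<lambda>x. 0\<^sub>v n @\<^sub>v ((b - x) \<cdot>\<^sub>v w x) @\<^sub>v 0\<^sub>v n @\<^sub>v w x)"
    unfolding four_mult_eq_add by (rule vec_integral_cong) (rule boundary_kernel_mult[OF wc])
  also have "\<dots> = vec_integral a b n (\<lambda>x. 0\<^sub>v n) @\<^sub>v ?I0 @\<^sub>v vec_integral a b n (\<lambda>x. 0\<^sub>v n) @\<^sub>v ?I1"
    using wc by (subst vec_integral_append; (intro append_carrier_vec)?; simp)+
  also have "vec_integral a b n (\<lambda>x. 0\<^sub>v n) = 0\<^sub>v n" by (intro eq_vecI) auto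
  finally have K: "vec_integral a b (4 * n) (\<lambda>x. boundary_kernel b n x *\<^sub>v w x) = 0\<^sub>v n @\<^sub>v ?I0 @\<^sub>v 0\<^sub>v n @\<^sub>v ?I1" .
  have 1: "reconstruction a n c w a = vec_lower n c" "reconstruction_deriv a n c w a = vec_upper n c"
    by (intro eq_vecI; simp add: reconstruction_def reconstruction_deriv_def vec_primitive_def vec_lower_def vec_upper_def)+
  have 2: "reconstruction a n c w b = (vec_lower n c + (b - a) \<cdot>\<^sub>v vec_upper n c) + ?I0"
    using reconstruction_affine_row[OF c wc] affine_row_mult_vec[OF c] by simp
  have 3: "reconstruction_deriv a n c w b = vec_upper n c + ?I1"
    by (intro eq_vecI) (simp_all add: reconstruction_deriv_def vec_primitive_def vec_upper_def)
  show ?thesis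
    \<comment> \<open>The sum of the two stacked vectors is split off one block at a time.\<close>
    unfolding K boundary_affine_mult[OF c] 1 2 3
    by (subst append_vec_add[of _ n _ _ "n + (n + n)"], (simp_all)[4],
        subst append_vec_add[of _ n _ _ "n + n"], (simp_all)[4],
        subst append_vec_add[of _ n _ _ n]) simp_all
qed

section \<open>Closure properties of L2 and the boundary functional\<close>

lemma L2_vec_const: "c \<in> carrier_vec k \<Longrightarrow> (\<lambda>x. c) \<in> L2_vec a b k"
  by (intro L2_vecI) auto

lemma L2_vec_mult_continuous:
  assumes u: "u \<in> L2_vec a b k" and M: "\<And>x. M x \<in> carrier_mat r k"
    and cont: "\<And>i j. i < r \<Longrightarrow> j < k \<Longrightarrow> continuous_on {a..b} (\<lambda>x. M x $$ (i, j))"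
  shows "(\<lambda>x. M x *\<^sub>v u x) \<in> L2_vec a b r"
proof (rule L2_vecI)
  show "M x *\<^sub>v u x \<in> carrier_vec r" if "x \<in> {a..b}" for x
    using mult_mat_vec_carrier[OF M L2_vec_carrier[OF u that]] .
  fix i assume i: "i < r"
  have "square_integrable a b (\<lambda>x. \<Sum>j<k. M x $$ (i, j) * u x $ j)"
    using i by (intro square_integrable_sum square_integrable_continuous_mult L2_vec_square_integrable[OF u] cont) auto
  then show "square_integrable a b (\<lambda>x. (M x *\<^sub>v u x) $ i)"
    by (rule square_integrable_cong) (rule mult_mat_vec_index_sum[OF M L2_vec_carrier[OF u] i, symmetric])
qed

lemma L2_vec_append:
  assumes f: "f \<in> L2_vec a b k" and g: "g \<in> L2_vec a b l"
  shows "(\<lambda>x. f x @\<^sub>v g x) \<in> L2_vec a b (k + l)"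
proof (rule L2_vecI)
  show "f x @\<^sub>v g x \<in> carrier_vec (k + l)" if "x \<in> {a..b}" for x
    using L2_vec_carrier[OF f that] L2_vec_carrier[OF g that] by simp
  fix i assume i: "i < k + l"
  have "square_integrable a b (\<lambda>x. if i < k then f x $ i else g x $ (i - k))"
    using i by (cases "i < k") (auto intro: L2_vec_square_integrable[OF f] L2_vec_square_integrable[OF g])
  then show "square_integrable a b (\<lambda>x. (f x @\<^sub>v g x) $ i)"
  proof (rule square_integrable_cong)
    fix x assume "x \<in> {a..b}"
    then have "dim_vec (f x) = k" "dim_vec (g x) = l" using L2_vec_carrier[OF f] L2_vec_carrier[OF g] by auto
    then show "(if i < k then f x $ i else g x $ (i - k)) = (f x @\<^sub>v g x) $ i" using i by simp
  qed
qed

lemma L2_vec_continuous_smult: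
  assumes f: "f \<in> L2_vec a b k" and s: "continuous_on {a..b} s"
  shows "(\<lambda>x. s x \<cdot>\<^sub>v f x) \<in> L2_vec a b k"
proof (rule L2_vecI)
  show "s x \<cdot>\<^sub>v f x \<in> carrier_vec k" if "x \<in> {a..b}" for x
    using L2_vec_carrier[OF f that] by simp
  fix i assume i: "i < k"
  show "square_integrable a b (\<lambda>x. (s x \<cdot>\<^sub>v f x) $ i)"
    by (rule square_integrable_cong[OF square_integrable_continuous_mult[OF L2_vec_square_integrable[OF f i] s]])
      (use carrier_vecD[OF L2_vec_carrier[OF f]] i in auto)
qed

lemma continuous_affine_row:
  assumes "i < n" "j < 2 * n"
  shows "continuous_on S (\<lambda>x. affine_row a n x $$ (i, j))"
proof -
  have "affine_row a n x $$ (i, j) = (if j < n then 1\<^sub>m n $$ (i, j) else (x - a) * 1\<^sub>m n $$ (i, j - n))" for x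
    using assms by (auto simp: affine_row_def append_cols_def)
  then show ?thesis by (cases "j < n") (auto intro!: continuous_intros)
qed

lemma L2_vec_add:
  assumes f: "f \<in> L2_vec a b k" and g: "g \<in> L2_vec a b k"
  shows "(\<lambda>x. f x + g x) \<in> L2_vec a b k"
proof (rule L2_vecI)
  show "f x + g x \<in> carrier_vec k" if "x \<in> {a..b}" for x
    using L2_vec_carrier[OF f that] L2_vec_carrier[OF g that] by simp
  fix i assume i: "i < k"
  show "square_integrable a b (\<lambda>x. (f x + g x) $ i)"
    by (rule square_integrable_cong[OF square_integrable_add[OF L2_vec_square_integrable[OF f i]
            L2_vec_square_integrable[OF g i]]])
      (use carrier_vecD[OF L2_vec_carrier[OF g]] i in auto)
qed

lemma L2_vec_diff:
  assumes f: "f \<in> L2_vec a b k" and g: "g \<in> L2_vec a b k"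
  shows "(\<lambda>x. f x - g x) \<in> L2_vec a b k"
proof (rule L2_vecI)
  show "f x - g x \<in> carrier_vec k" if "x \<in> {a..b}" for x
    using L2_vec_carrier[OF f that] L2_vec_carrier[OF g that] by simp
  fix i assume i: "i < k"
  show "square_integrable a b (\<lambda>x. (f x - g x) $ i)"
    by (rule square_integrable_cong[OF square_integrable_diff[OF L2_vec_square_integrable[OF f i]
            L2_vec_square_integrable[OF g i]]])
      (use carrier_vecD[OF L2_vec_carrier[OF g]] i in auto)
qed

text \<open>By linearity u splits into its affine part and a remainder V with zero Cauchy data. The
  affine part contributes G c. The remainder contributes through its values at b and through
  \<integral> F V; moving both primitives from w onto F turns this into an integral of a kernel
  against w, and that kernel is -H.\<close>

lemma boundary_functional:
  assumes "a < b" and E: "E \<in> carrier_mat r (4 * n)" and F: "F \<in> L2_mat a b r n"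
    and c: "c \<in> carrier_vec (2 * n)" and w: "w \<in> L2_vec a b n"
  shows L2_vec_H_mat_mult: "(\<lambda>x. H_mat b n E F x *\<^sub>v w x) \<in> L2_vec a b r"
    and boundary_functional_eq: "E *\<^sub>v (reconstruction a n c w a @\<^sub>v reconstruction a n c w b
      @\<^sub>v reconstruction_deriv a n c w a @\<^sub>v reconstruction_deriv a n c w b)
      + vec_integral a b r (\<lambda>x. F x *\<^sub>v reconstruction a n c w x)
    = G_mat a b n E F *\<^sub>v c - vec_integral a b r (\<lambda>x. H_mat b n E F x *\<^sub>v w x)"
proof -
  define V where "V = reconstruction a n (0\<^sub>v (2 * n)) w"
  \<comment> \<open>The integral term of \<open>H_mat\<close>, without its sign.\<close>
  define K where "K t = mat_integral t b r n (\<lambda>x. (x - t) \<cdot>\<^sub>m F x)" for t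
  have dim_E: "dim_row E = r" using E by simp
  note wc = L2_vec_carrier[OF w] and Fc = L2_mat_carrier[OF F]
  have VL2: "V \<in> L2_vec a b n" unfolding V_def by (rule reconstruction_L2(1)[OF w])
  have rec: "reconstruction a n c w x = affine_row a n x *\<^sub>v c + V x" for x
    unfolding V_def affine_row_mult_vec[OF c]
    by (intro eq_vecI) (simp_all add: reconstruction_def vec_lower_def vec_upper_def)
  have affL2: "(\<lambda>x. affine_row a n x *\<^sub>v c) \<in> L2_vec a b n"
    by (rule L2_vec_mult_continuous[OF L2_vec_const[OF c]]) (auto intro: continuous_affine_row)
  have Kc: "K t \<in> carrier_mat r n" for t by (simp add: K_def)
  have K_index: "K t $$ (i, j) = (\<integral>x. (x - t) * F x $$ (i, j) \<partial>lebesgue_on {t..b})"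
    if "i < r" "j < n" "t \<in> {a..b}" for t i j
  proof -
    have "(\<integral>x. ((x - t) \<cdot>\<^sub>m F x) $$ (i, j) \<partial>lebesgue_on {t..b}) = (\<integral>x. (x - t) * F x $$ (i, j) \<partial>lebesgue_on {t..b})"
    proof (rule integral_interval_cong)
      fix x assume "x \<in> {t..b}"
      then have "F x \<in> carrier_mat r n" using that by (intro Fc) auto
      then show "((x - t) \<cdot>\<^sub>m F x) $$ (i, j) = (x - t) * F x $$ (i, j)" using that by simp
    qed
    then show ?thesis using that by (simp add: K_def mat_integral_def)
  qed
  have K_cont: "continuous_on {a..b} (\<lambda>t. K t $$ (i, j))" if "i < r" "j < n" for i j
    by (rule continuous_on_eq[OF continuous_second_primitive_right
          [OF square_integrable_integrable[OF L2_mat_square_integrable[OF F that]]]])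
      (simp add: K_index[OF that])
  have KwL2: "(\<lambda>t. K t *\<^sub>v w t) \<in> L2_vec a b r"
    by (rule L2_vec_mult_continuous[OF w Kc K_cont])
  \<comment> \<open>Read blockwise, the stacked vector consists of zero blocks, a continuous
    multiple of \<open>w\<close>, and \<open>w\<close> itself.\<close>
  have BwL2: "(\<lambda>x. boundary_kernel b n x *\<^sub>v w x) \<in> L2_vec a b (4 * n)"
  proof (rule L2_vec_ae_eq[OF _ ae_eq_on_interval])
    show "(\<lambda>x. 0\<^sub>v n @\<^sub>v ((b - x) \<cdot>\<^sub>v w x) @\<^sub>v 0\<^sub>v n @\<^sub>v w x) \<in> L2_vec a b (4 * n)"
      unfolding four_mult_eq_add
      by (intro L2_vec_append L2_vec_const L2_vec_continuous_smult w continuous_intros) auto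
    show "0\<^sub>v n @\<^sub>v (b - x) \<cdot>\<^sub>v w x @\<^sub>v 0\<^sub>v n @\<^sub>v w x = boundary_kernel b n x *\<^sub>v w x" if "x \<in> {a..b}" for x
      by (rule boundary_kernel_mult[OF wc[OF that], symmetric])
    show "boundary_kernel b n x *\<^sub>v w x \<in> carrier_vec (4 * n)" if "x \<in> {a..b}" for x
      using wc[OF that] by (intro mult_mat_vec_carrier[OF boundary_kernel_carrier])
  qed
  have EBwL2: "(\<lambda>x. E *\<^sub>v (boundary_kernel b n x *\<^sub>v w x)) \<in> L2_vec a b r"
    by (rule L2_vec_mult_continuous[OF BwL2]) (use E in auto)
  have FV: "vec_integral a b r (\<lambda>x. F x *\<^sub>v V x) = vec_integral a b r (\<lambda>t. K t *\<^sub>v w t)"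
  proof (rule eq_vecI)
    fix i assume "i < dim_vec (vec_integral a b r (\<lambda>t. K t *\<^sub>v w t))"
    then have i: "i < r" by simp
    note Fi = L2_mat_square_integrable[OF F i]
    have "(\<integral>x. (F x *\<^sub>v V x) $ i \<partial>lebesgue_on {a..b})
        = (\<integral>x. (\<Sum>j<n. F x $$ (i, j) * V x $ j) \<partial>lebesgue_on {a..b})"
      by (intro integral_interval_cong mult_mat_vec_index_sum[OF Fc L2_vec_carrier[OF VL2] i])
    also have "\<dots> = (\<Sum>j<n. \<integral>x. F x $$ (i, j) * V x $ j \<partial>lebesgue_on {a..b})"
      by (intro Bochner_Integration.integral_sum square_integrable_integrable_mult Fi
          L2_vec_square_integrable[OF VL2]) auto
    also have "\<dots> = (\<Sum>j<n. \<integral>t. K t $$ (i, j) * w t $ j \<partial>lebesgue_on {a..b})"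
    proof (rule sum.cong[OF refl])
      fix j assume "j \<in> {..<n}"
      then have j: "j < n" by simp
      have "(\<integral>x. F x $$ (i, j) * V x $ j \<partial>lebesgue_on {a..b})
          = (\<integral>x. F x $$ (i, j) * (\<integral>t. (x - t) * w t $ j \<partial>lebesgue_on {a..x}) \<partial>lebesgue_on {a..b})"
        using j by (simp add: V_def)
      also have "\<dots> = (\<integral>t. (\<integral>x. (x - t) * F x $$ (i, j) \<partial>lebesgue_on {t..b}) * w t $ j \<partial>lebesgue_on {a..b})"
        by (intro integral_second_primitive_swap square_integrable_integrable Fi
            L2_vec_square_integrable[OF w] j)
      also have "\<dots> = (\<integral>t. K t $$ (i, j) * w t $ j \<partial>lebesgue_on {a..b})"
        by (intro integral_interval_cong) (simp add: K_index i j)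
      finally show "(\<integral>x. F x $$ (i, j) * V x $ j \<partial>lebesgue_on {a..b})
          = (\<integral>t. K t $$ (i, j) * w t $ j \<partial>lebesgue_on {a..b})" .
    qed
    also have "\<dots> = (\<integral>t. (\<Sum>j<n. K t $$ (i, j) * w t $ j) \<partial>lebesgue_on {a..b})"
      by (intro Bochner_Integration.integral_sum[symmetric] square_integrable_integrable_mult
          square_integrable_continuous[OF K_cont] i L2_vec_square_integrable[OF w]) auto
    also have "\<dots> = (\<integral>t. (K t *\<^sub>v w t) $ i \<partial>lebesgue_on {a..b})"
      by (intro integral_interval_cong mult_mat_vec_index_sum[OF Kc wc i, symmetric])
    finally show "vec_integral a b r (\<lambda>x. F x *\<^sub>v V x) $ i = vec_integral a b r (\<lambda>t. K t *\<^sub>v w t) $ i"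
      using i by simp
  qed simp
  have Faff: "vec_integral a b r (\<lambda>x. F x *\<^sub>v (affine_row a n x *\<^sub>v c))
      = mat_integral a b r (2 * n) (\<lambda>x. F x * affine_row a n x) *\<^sub>v c"
  proof -
    have "mat_integral a b r (2 * n) (\<lambda>x. F x * affine_row a n x) *\<^sub>v c
        = vec_integral a b r (\<lambda>x. (F x * affine_row a n x) *\<^sub>v c)"
    proof (rule mat_integral_mult_vec[OF _ c])
      show "F x * affine_row a n x \<in> carrier_mat r (2 * n)" if "x \<in> {a..b}" for x
        using Fc[OF that] by (intro mult_carrier_mat[OF _ affine_row_carrier])
      fix i j assume ij: "i < r" "j < 2 * n"
      \<comment> \<open>The columns of \<open>affine_row\<close> are continuous in x, so their
        products with \<open>F\<close> have integrable entries.\<close>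
      have "integrable (lebesgue_on {a..b}) (\<lambda>x. (F x *\<^sub>v col (affine_row a n x) j) $ i)"
      proof (rule integrable_L2_mat_mult_vec[OF F _ ij(1)])
        show "(\<lambda>x. col (affine_row a n x) j) \<in> L2_vec a b n"
        proof (rule L2_vecI)
          show "col (affine_row a n x) j \<in> carrier_vec n" for x
            by (rule col_carrier_vec[OF ij(2) affine_row_carrier])
          fix l assume l: "l < n"
          have "col (affine_row a n x) j $ l = affine_row a n x $$ (l, j)" for x
            using carrier_matD[OF affine_row_carrier[of a n x]] l ij(2) by simp
          then show "square_integrable a b (\<lambda>x. col (affine_row a n x) j $ l)"
            using continuous_affine_row[OF l ij(2)] by (simp add: square_integrable_continuous)
        qed
      qed
      then show "integrable (lebesgue_on {a..b}) (\<lambda>x. (F x * affine_row a n x) $$ (i, j))"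
      proof (rule integrable_interval_cong)
        fix x assume "x \<in> {a..b}"
        then have "F x \<in> carrier_mat r n" using Fc by simp
        then show "(F x *\<^sub>v col (affine_row a n x) j) $ i = (F x * affine_row a n x) $$ (i, j)"
          using carrier_matD[OF affine_row_carrier[of a n x]] ij by simp
      qed
    qed
    also have "\<dots> = vec_integral a b r (\<lambda>x. F x *\<^sub>v (affine_row a n x *\<^sub>v c))"
      by (rule vec_integral_cong) (rule assoc_mult_mat_vec[OF Fc affine_row_carrier c])
    finally show ?thesis ..
  qed
  have Frec: "vec_integral a b r (\<lambda>x. F x *\<^sub>v reconstruction a n c w x)
      = mat_integral a b r (2 * n) (\<lambda>x. F x * affine_row a n x) *\<^sub>v c + vec_integral a b r (\<lambda>t. K t *\<^sub>v w t)"
  proof -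
    have "vec_integral a b r (\<lambda>x. F x *\<^sub>v reconstruction a n c w x)
        = vec_integral a b r (\<lambda>x. F x *\<^sub>v (affine_row a n x *\<^sub>v c) + F x *\<^sub>v V x)"
      unfolding rec
      by (rule vec_integral_cong, rule mult_add_distrib_mat_vec[OF Fc])
        (auto intro: L2_vec_carrier[OF VL2] L2_vec_carrier[OF affL2])
    also have "\<dots> = vec_integral a b r (\<lambda>x. F x *\<^sub>v (affine_row a n x *\<^sub>v c)) + vec_integral a b r (\<lambda>x. F x *\<^sub>v V x)"
      by (intro vec_integral_add integrable_L2_mat_mult_vec[OF F] affL2 VL2 mult_mat_vec_carrier[OF Fc]
          L2_vec_carrier[OF affL2] L2_vec_carrier[OF VL2])
    finally show ?thesis unfolding FV Faff .
  qed
  have Ebd: "E *\<^sub>v (reconstruction a n c w a @\<^sub>v reconstruction a n c w b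
      @\<^sub>v reconstruction_deriv a n c w a @\<^sub>v reconstruction_deriv a n c w b)
      = (E * boundary_affine a b n) *\<^sub>v c + vec_integral a b r (\<lambda>x. E *\<^sub>v (boundary_kernel b n x *\<^sub>v w x))"
    unfolding boundary_values_reconstruction[OF \<open>a < b\<close> c w]
    using mult_vec_integral[OF E L2_vec_carrier[OF BwL2] L2_vec_integrable[OF BwL2]]
    by (simp add: mult_add_distrib_mat_vec[OF E mult_mat_vec_carrier[OF boundary_affine_carrier c] vec_integral_carrier]
        assoc_mult_mat_vec[OF E boundary_affine_carrier c])
  have G: "G_mat a b n E F *\<^sub>v c = (E * boundary_affine a b n) *\<^sub>v c
      + mat_integral a b r (2 * n) (\<lambda>x. F x * affine_row a n x) *\<^sub>v c"
    unfolding G_mat_def dim_E boundary_affine_def[symmetric]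
    by (rule add_mult_distrib_mat_vec[OF mult_carrier_mat[OF E boundary_affine_carrier] mat_integral_carrier c])
  have Hw: "H_mat b n E F x *\<^sub>v w x = - (E *\<^sub>v (boundary_kernel b n x *\<^sub>v w x)) - K x *\<^sub>v w x"
    if x: "x \<in> {a..b}" for x
  proof -
    note EB = mult_carrier_mat[OF E boundary_kernel_carrier, of b x]
    have "H_mat b n E F x *\<^sub>v w x = (- (E * boundary_kernel b n x)) *\<^sub>v w x - K x *\<^sub>v w x"
      unfolding H_mat_def dim_E boundary_kernel_def[symmetric] K_def[symmetric]
      by (rule minus_mult_distrib_mat_vec[OF _ Kc wc[OF x]]) (use EB in simp)
    also have "(- (E * boundary_kernel b n x)) *\<^sub>v w x = - (E *\<^sub>v (boundary_kernel b n x *\<^sub>v w x))"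
      using EB wc[OF x] assoc_mult_mat_vec[OF E boundary_kernel_carrier wc[OF x], of b x]
      by (subst uminus_mult_mat_vec) auto
    finally show ?thesis .
  qed
  show "(\<lambda>x. H_mat b n E F x *\<^sub>v w x) \<in> L2_vec a b r"
  proof (rule L2_vec_ae_eq[OF _ ae_eq_on_interval])
    \<comment> \<open>The negative is written as a difference from zero, so that closure under
      differences covers it.\<close>
    show "(\<lambda>x. (0\<^sub>v r - E *\<^sub>v (boundary_kernel b n x *\<^sub>v w x)) - K x *\<^sub>v w x) \<in> L2_vec a b r"
      by (intro L2_vec_diff L2_vec_const EBwL2 KwL2) simp
    fix x assume x: "x \<in> {a..b}"
    then show "(0\<^sub>v r - E *\<^sub>v (boundary_kernel b n x *\<^sub>v w x)) - K x *\<^sub>v w x = H_mat b n E F x *\<^sub>v w x"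
      using L2_vec_carrier[OF EBwL2 x] L2_vec_carrier[OF KwL2 x] by (simp add: Hw)
    show "H_mat b n E F x *\<^sub>v w x \<in> carrier_vec r"
      using x L2_vec_carrier[OF EBwL2 x] L2_vec_carrier[OF KwL2 x] by (simp add: Hw)
  qed
  have H: "vec_integral a b r (\<lambda>x. H_mat b n E F x *\<^sub>v w x)
      = - (vec_integral a b r (\<lambda>x. E *\<^sub>v (boundary_kernel b n x *\<^sub>v w x)) + vec_integral a b r (\<lambda>t. K t *\<^sub>v w t))"
  proof (rule eq_vecI)
    fix i
    assume "i < dim_vec (- (vec_integral a b r (\<lambda>x. E *\<^sub>v (boundary_kernel b n x *\<^sub>v w x)) + vec_integral a b r (\<lambda>t. K t *\<^sub>v w t)))"
    then have i: "i < r" by simp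
    have "(\<integral>x. (H_mat b n E F x *\<^sub>v w x) $ i \<partial>lebesgue_on {a..b})
        = (\<integral>x. - ((E *\<^sub>v (boundary_kernel b n x *\<^sub>v w x)) $ i) - (K x *\<^sub>v w x) $ i \<partial>lebesgue_on {a..b})"
    proof (rule integral_interval_cong)
      fix x assume x: "x \<in> {a..b}"
      show "(H_mat b n E F x *\<^sub>v w x) $ i = - ((E *\<^sub>v (boundary_kernel b n x *\<^sub>v w x)) $ i) - (K x *\<^sub>v w x) $ i"
        unfolding Hw[OF x] using i E Kc[of x] by (simp del: index_mult_mat_vec)
    qed
    also have "\<dots> = - (\<integral>x. (E *\<^sub>v (boundary_kernel b n x *\<^sub>v w x)) $ i \<partial>lebesgue_on {a..b})
        - (\<integral>x. (K x *\<^sub>v w x) $ i \<partial>lebesgue_on {a..b})"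
      using L2_vec_integrable[OF EBwL2 i] L2_vec_integrable[OF KwL2 i]
      by (subst Bochner_Integration.integral_diff) auto
    finally show "vec_integral a b r (\<lambda>x. H_mat b n E F x *\<^sub>v w x) $ i
        = (- (vec_integral a b r (\<lambda>x. E *\<^sub>v (boundary_kernel b n x *\<^sub>v w x)) + vec_integral a b r (\<lambda>t. K t *\<^sub>v w t))) $ i"
      using i by simp
  qed simp
  \<comment> \<open>On the left, boundary term and integral term, each split into its affine part
    and its remainder; on the right, the two affine parts forming G c and the two remainders forming
    -\<integral> H w.\<close>
  have add_swap: "(p + q) + (s + t) = (p + s) - (- (q + t))"
    if "p \<in> carrier_vec r" "q \<in> carrier_vec r" "s \<in> carrier_vec r" "t \<in> carrier_vec r" for p q s t :: "real vec"
    using that by (intro eq_vecI) auto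
  then show "E *\<^sub>v (reconstruction a n c w a @\<^sub>v reconstruction a n c w b
      @\<^sub>v reconstruction_deriv a n c w a @\<^sub>v reconstruction_deriv a n c w b)
      + vec_integral a b r (\<lambda>x. F x *\<^sub>v reconstruction a n c w x)
    = G_mat a b n E F *\<^sub>v c - vec_integral a b r (\<lambda>x. H_mat b n E F x *\<^sub>v w x)"
    unfolding Ebd Frec G H
    by (intro add_swap vec_integral_carrier mult_mat_vec_carrier[OF mat_integral_carrier c]
        mult_mat_vec_carrier[OF mult_carrier_mat[OF E boundary_affine_carrier] c])
qed

subsection \<open>The operators associated with the boundary data\<close>

lemma eval_pmat_carrier [simp]: "P \<in> carrier_mat r k \<Longrightarrow> eval_pmat P x \<in> carrier_mat r k"
  by (simp add: eval_pmat_def)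

lemma continuous_eval_pmat:
  "P \<in> carrier_mat r k \<Longrightarrow> i < r \<Longrightarrow> j < k \<Longrightarrow> continuous_on S (\<lambda>x. eval_pmat P x $$ (i, j))"
  by (auto simp: eval_pmat_def intro!: continuous_intros)

lemma first_rows_carrier [simp]: "M \<in> carrier_mat r k \<Longrightarrow> first_rows l M \<in> carrier_mat l k"
  by (simp add: first_rows_def)

lemma last_rows_carrier [simp]: "M \<in> carrier_mat r k \<Longrightarrow> last_rows l M \<in> carrier_mat l k"
  by (simp add: last_rows_def)

lemma first_rows_mult_vec:
  "M \<in> carrier_mat r k \<Longrightarrow> v \<in> carrier_vec k \<Longrightarrow> i < l \<Longrightarrow> l \<le> r \<Longrightarrow> (first_rows l M *\<^sub>v v) $ i = (M *\<^sub>v v) $ i"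
  by (simp add: mult_mat_vec_index_sum[of _ l k] mult_mat_vec_index_sum[of _ r k] del: index_mult_mat_vec)
    (simp add: first_rows_def)

lemma last_rows_mult_vec:
  "M \<in> carrier_mat r k \<Longrightarrow> v \<in> carrier_vec k \<Longrightarrow> i < l \<Longrightarrow> l \<le> r \<Longrightarrow>
    (last_rows l M *\<^sub>v v) $ i = (M *\<^sub>v v) $ (r - l + i)"
  by (simp add: mult_mat_vec_index_sum[of _ l k] mult_mat_vec_index_sum[of _ r k] del: index_mult_mat_vec)
    (simp add: last_rows_def)

section \<open>Square-integrable matrix functions under row operations\<close>

lemma L2_mat_eval_pmat: "P \<in> carrier_mat r k \<Longrightarrow> eval_pmat P \<in> L2_mat a b r k"
  by (auto simp: L2_mat_def intro!: square_integrable_continuous continuous_eval_pmat)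

lemma L2_mat_mult_left:
  assumes J: "J \<in> carrier_mat r k" and F: "F \<in> L2_mat a b k l"
  shows "(\<lambda>x. J * F x) \<in> L2_mat a b r l"
  unfolding L2_mat_def
proof (intro CollectI conjI ballI allI impI)
  show "J * F x \<in> carrier_mat r l" if "x \<in> {a..b}" for x
    using mult_carrier_mat[OF J L2_mat_carrier[OF F that]] .
  fix i j assume ij: "i < r" "j < l"
  have "square_integrable a b (\<lambda>x. \<Sum>h<k. J $$ (i, h) * F x $$ (h, j))"
    using ij by (intro square_integrable_sum square_integrable_cmult L2_mat_square_integrable[OF F]) auto
  then show "square_integrable a b (\<lambda>x. (J * F x) $$ (i, j))"
  proof (rule square_integrable_cong)
    fix x assume "x \<in> {a..b}"
    then have "F x \<in> carrier_mat k l" by (rule L2_mat_carrier[OF F])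
    then show "(\<Sum>h<k. J $$ (i, h) * F x $$ (h, j)) = (J * F x) $$ (i, j)"
      using J ij by (simp add: scalar_prod_def atLeast0LessThan)
  qed
qed

lemma L2_mat_rows:
  assumes F: "F \<in> L2_mat a b r k" and l: "l \<le> r"
  shows "(\<lambda>x. first_rows l (F x)) \<in> L2_mat a b l k" "(\<lambda>x. last_rows l (F x)) \<in> L2_mat a b l k"
proof -
  have 1: "square_integrable a b (\<lambda>x. first_rows l (F x) $$ (i, j))" if "i < l" "j < k" for i j
    using that l by (intro square_integrable_cong[OF L2_mat_square_integrable[OF F, of i j]])
      (use carrier_matD[OF L2_mat_carrier[OF F]] in \<open>auto simp: first_rows_def\<close>)
  have 2: "square_integrable a b (\<lambda>x. last_rows l (F x) $$ (i, j))" if "i < l" "j < k" for i j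
    using that l by (intro square_integrable_cong[OF L2_mat_square_integrable[OF F, of "r - l + i" j]])
      (use carrier_matD[OF L2_mat_carrier[OF F]] in \<open>auto simp: last_rows_def\<close>)
  show "(\<lambda>x. first_rows l (F x)) \<in> L2_mat a b l k" "(\<lambda>x. last_rows l (F x)) \<in> L2_mat a b l k"
    using 1 2 first_rows_carrier[OF L2_mat_carrier[OF F]] last_rows_carrier[OF L2_mat_carrier[OF F]]
    by (auto simp: L2_mat_def)
qed

lemma L2_mat_append_rows:
  assumes F: "F \<in> L2_mat a b r k" and G: "G \<in> L2_mat a b l k"
  shows "(\<lambda>x. F x @\<^sub>r G x) \<in> L2_mat a b (r + l) k"
  unfolding L2_mat_def
proof (intro CollectI conjI ballI allI impI)
  show "F x @\<^sub>r G x \<in> carrier_mat (r + l) k" if "x \<in> {a..b}" for x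
    using L2_mat_carrier[OF F that] L2_mat_carrier[OF G that] by simp
  fix i j assume ij: "i < r + l" "j < k"
  have "square_integrable a b (\<lambda>x. if i < r then F x $$ (i, j) else G x $$ (i - r, j))"
    using ij by (cases "i < r") (auto intro: L2_mat_square_integrable[OF F] L2_mat_square_integrable[OF G])
  then show "square_integrable a b (\<lambda>x. (F x @\<^sub>r G x) $$ (i, j))"
  proof (rule square_integrable_cong)
    fix x assume "x \<in> {a..b}"
    then have "F x \<in> carrier_mat r k" "G x \<in> carrier_mat l k"
      using L2_mat_carrier[OF F] L2_mat_carrier[OF G] by auto
    then show "(if i < r then F x $$ (i, j) else G x $$ (i - r, j)) = (F x @\<^sub>r G x) $$ (i, j)"
      using ij by (simp add: append_rows_def)
  qed
qed

lemma vec_integral_mult_ae_eq: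
  assumes F: "F \<in> L2_mat a b r k" and u: "u \<in> L2_vec a b k" and v: "v \<in> L2_vec a b k" and ae: "ae_eq a b u v"
  shows "vec_integral a b r (\<lambda>x. F x *\<^sub>v u x) = vec_integral a b r (\<lambda>x. F x *\<^sub>v v x)"
proof (rule eq_vecI)
  fix i assume "i < dim_vec (vec_integral a b r (\<lambda>x. F x *\<^sub>v v x))"
  then have i: "i < r" by simp
  have "AE x in lebesgue_on {a..b}. (F x *\<^sub>v u x) $ i = (F x *\<^sub>v v x) $ i"
    using ae unfolding ae_eq_def by (rule eventually_mono) simp
  then show "vec_integral a b r (\<lambda>x. F x *\<^sub>v u x) $ i = vec_integral a b r (\<lambda>x. F x *\<^sub>v v x) $ i"
    using i integrable_L2_mat_mult_vec[OF F u i] integrable_L2_mat_mult_vec[OF F v i]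
    by (simp del: index_mult_mat_vec) (intro integral_cong_AE borel_measurable_integrable)
qed simp

section \<open>Derivatives of affine kernels and inverse matrices\<close>

lemma affine_row_mult_mat_index:
  assumes M: "M \<in> carrier_mat (2 * n) k" and ij: "i < n" "j < k"
  shows "(affine_row a n x * M) $$ (i, j) = M $$ (i, j) + (x - a) * M $$ (n + i, j)"
proof -
  have col: "col M j \<in> carrier_vec (2 * n)" using col_carrier_vec[OF ij(2) M] .
  have "(affine_row a n x * M) $$ (i, j) = (affine_row a n x *\<^sub>v col M j) $ i"
    using carrier_matD[OF affine_row_carrier[of a n x]] M ij by simp
  also have "\<dots> = M $$ (i, j) + (x - a) * M $$ (n + i, j)"
    unfolding affine_row_mult_vec[OF col] using ij carrier_matD[OF M] by (simp add: vec_lower_def vec_upper_def)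
  finally show ?thesis .
qed

text \<open>Differentiation replaces the row [I, (x - a) I] by [0, I]. The kernels of
  \<open>R_op\<close> are therefore those of \<open>T_op\<close> with another left factor.\<close>

lemma mat_deriv_affine_row:
  assumes M: "M \<in> carrier_mat (2 * n) k"
  shows "mat_deriv (\<lambda>y. affine_row a n y * M) x = append_cols (0\<^sub>m n n) (1\<^sub>m n) * M"
proof (rule eq_matI)
  have D: "append_cols (0\<^sub>m n n) (1\<^sub>m n) \<in> (carrier_mat n (2 * n) :: real mat set)"
    unfolding mult_2 by simp
  fix i j assume "i < dim_row (append_cols (0\<^sub>m n n) (1\<^sub>m n) * M)" "j < dim_col (append_cols (0\<^sub>m n n) (1\<^sub>m n) * M)"
  then have ij: "i < n" "j < k"
    unfolding index_mult_mat(2,3) carrier_matD[OF D] carrier_matD[OF M] by auto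
  have col: "col M j \<in> carrier_vec (2 * n)" using col_carrier_vec[OF ij(2) M] .
  have "mat_deriv (\<lambda>y. affine_row a n y * M) x $$ (i, j) = deriv (\<lambda>y. (affine_row a n y * M) $$ (i, j)) x"
    using carrier_matD[OF affine_row_carrier[of a n x]] M ij by (simp add: mat_deriv_def)
  also have "\<dots> = deriv (\<lambda>y. M $$ (i, j) + (y - a) * M $$ (n + i, j)) x"
    by (simp only: affine_row_mult_mat_index[OF M ij])
  also have "\<dots> = M $$ (n + i, j)"
    by (rule DERIV_imp_deriv) (auto intro!: derivative_eq_intros)
  also have "\<dots> = (append_cols (0\<^sub>m n n) (1\<^sub>m n) *\<^sub>v col M j) $ i"
    using ij carrier_matD[OF M]
    by (simp add: append_cols_mult_halves[of _ n n, OF _ _ col] zero_mat_mult_vec vec_upper_def)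
  also have "\<dots> = (append_cols (0\<^sub>m n n) (1\<^sub>m n) * M) $$ (i, j)"
    using carrier_matD[OF D] M ij by simp
  finally show "mat_deriv (\<lambda>y. affine_row a n y * M) x $$ (i, j) = (append_cols (0\<^sub>m n n) (1\<^sub>m n) * M) $$ (i, j)" .
qed (use carrier_matD[OF affine_row_carrier[of a n x]] M in \<open>auto simp: mat_deriv_def append_cols_def\<close>)

text \<open>\<open>invertible_mat\<close> provides an inverse B of unspecified size. The size is
  read off from the products with A; then A is a unit of the matrix ring and
  \<open>mat_inverse\<close> succeeds.\<close>

lemma mat_inverse_of_invertible:
  fixes A :: "real mat"
  assumes A: "A \<in> carrier_mat k k" and inv: "invertible_mat A"
  shows "the (mat_inverse A) \<in> carrier_mat k k" "the (mat_inverse A) * A = 1\<^sub>m k" "A * the (mat_inverse A) = 1\<^sub>m k"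
proof -
  obtain B where B: "inverts_mat A B" "inverts_mat B A" using inv by (auto simp: invertible_mat_def)
  have AB: "A * B = 1\<^sub>m k" using B(1) A by (simp add: inverts_mat_def)
  have BA: "B * A = 1\<^sub>m (dim_row B)" using B(2) by (simp add: inverts_mat_def)
  have "dim_col (B * A) = dim_row B" using BA by simp
  then have r: "dim_row B = k" using A by simp
  have "dim_col (A * B) = k" using AB by simp
  then have "B \<in> carrier_mat k k" using r by auto
  then have "A \<in> Units (ring_mat TYPE(real) k ())"
    using A AB BA r by (auto simp: Units_def ring_mat_simps)
  then have "mat_inverse A \<noteq> None" using mat_inverse(1)[OF A, where b = "()"] by metis
  then obtain C where "mat_inverse A = Some C" by blast
  with mat_inverse(2)[OF A this]
  show "the (mat_inverse A) \<in> carrier_mat k k" "the (mat_inverse A) * A = 1\<^sub>m k" "A * the (mat_inverse A) = 1\<^sub>m k"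
    by auto
qed

lemma minus_add_cancel_vec:
  "p \<in> carrier_vec k \<Longrightarrow> q \<in> carrier_vec k \<Longrightarrow> (p - q) + q = (p :: real vec)"
  by (intro eq_vecI) auto

lemma invertible_mult_vec_eq_0_iff:
  fixes A :: "real mat"
  assumes A: "A \<in> carrier_mat k k" "invertible_mat A" and v: "v \<in> carrier_vec k"
  shows "A *\<^sub>v v = 0\<^sub>v k \<longleftrightarrow> v = 0\<^sub>v k"
proof
  note I = mat_inverse_of_invertible[OF A]
  assume "A *\<^sub>v v = 0\<^sub>v k"
  then have "the (mat_inverse A) *\<^sub>v (A *\<^sub>v v) = 0\<^sub>v k" using I(1) by (intro eq_vecI) auto
  then show "v = 0\<^sub>v k" unfolding assoc_mult_mat_vec[OF I(1) A(1) v, symmetric] I(2) using v by simp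
qed (use A in \<open>auto intro!: eq_vecI\<close>)

section \<open>The operators in Taylor form and the split boundary condition\<close>

locale boundary_data =
  fixes a b :: real and n m :: nat and J E :: "real mat" and F :: "real poly mat"
    and F3 :: "real \<Rightarrow> real mat"
  assumes ab: "a < b" and m_le: "m \<le> 2 * n"
    and E: "E \<in> carrier_mat (2 * n) (4 * n)" and F: "F \<in> carrier_mat (2 * n) n"
    and J: "J \<in> carrier_mat (2 * n) (2 * n)" and J_inv: "invertible_mat J"
    and G2: "G_mat a b n (E2 m J E) (F2 m J F) = 0\<^sub>m m (2 * n)"
    and F3: "F3 \<in> L2_mat a b m n"
    and G_hat_inv: "invertible_mat (G_hat a b n m J E F F3)"
begin

abbreviation "EE \<equiv> E_hat n m J E"
abbreviation "FF \<equiv> F_hat n m J F F3"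
abbreviation "GG \<equiv> G_hat a b n m J E F F3"
abbreviation "HH \<equiv> H_hat b n m J E F F3"
abbreviation "GI \<equiv> the (mat_inverse GG)"
abbreviation "Top \<equiv> T_op a b n m J E F F3"
abbreviation "Rop \<equiv> R_op a b n m J E F F3"
abbreviation "That \<equiv> T_hat a b n m J E F F3"
abbreviation "Aop \<equiv> A_op a b n m J E F F3"
abbreviation "Ahat \<equiv> A_hat a b n m J E F F3"
abbreviation "Dop \<equiv> D_op a b n m F3"
abbreviation "Kop \<equiv> K_op a b n m J E F"
abbreviation "Fop \<equiv> F_op a b m F3"
abbreviation "X \<equiv> X_space a b n E (eval_pmat F)"
abbreviation "Y \<equiv> Y_space a b m n Kop"

lemma row_sum: "2 * n - m + m = 2 * n"
  using m_le by simp

lemma JE: "J * E \<in> carrier_mat (2 * n) (4 * n)"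
  using J E by (rule mult_carrier_mat)

lemma JF: "(\<lambda>x. J * eval_pmat F x) \<in> L2_mat a b (2 * n) n"
  by (rule L2_mat_mult_left[OF J L2_mat_eval_pmat[OF F]])

lemma E1_carrier: "E1 n m J E \<in> carrier_mat (2 * n - m) (4 * n)"
  unfolding E1_def by (rule first_rows_carrier[OF JE])

lemma E2_carrier: "E2 m J E \<in> carrier_mat m (4 * n)"
  unfolding E2_def by (rule last_rows_carrier[OF JE])

lemma EE_carrier: "EE \<in> carrier_mat (2 * n) (4 * n)"
  using carrier_append_rows[OF E1_carrier, of "0\<^sub>m m (4 * n)" m] by (simp add: E_hat_def row_sum)

lemma F1_L2: "F1 n m J F \<in> L2_mat a b (2 * n - m) n"
  unfolding F1_def[abs_def] by (rule L2_mat_rows(1)[OF JF]) simp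

lemma F2_L2: "F2 m J F \<in> L2_mat a b m n"
  unfolding F2_def[abs_def] by (rule L2_mat_rows(2)[OF JF]) (rule m_le)

lemma FF_L2: "FF \<in> L2_mat a b (2 * n) n"
  using L2_mat_append_rows[OF F1_L2 F3] unfolding F_hat_def[abs_def] row_sum .

lemma GG_carrier: "GG \<in> carrier_mat (2 * n) (2 * n)"
  unfolding G_hat_def G_mat_def using EE_carrier by simp

lemma GI: "GI \<in> carrier_mat (2 * n) (2 * n)" "GI * GG = 1\<^sub>m (2 * n)" "GG * GI = 1\<^sub>m (2 * n)"
  using mat_inverse_of_invertible[OF GG_carrier G_hat_inv] by auto

lemma HH_carrier: "HH x \<in> carrier_mat (2 * n) n"
proof -
  have "dim_row EE = 2 * n" using EE_carrier by simp
  then show ?thesis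
    unfolding H_hat_def H_mat_def by (metis mat_integral_carrier minus_carrier_mat)
qed

text \<open>The Cauchy data of T v, obtained by solving G_hat c - \<integral> H_hat v1 = [0; v0] for
  c. By the boundary functional of the augmented data, the left side stacks the value of the rows
  \<open>E1\<close>, \<open>F1\<close> on top of \<integral> F3 u; these are required to be 0 and
  v0.\<close>

definition coef :: "state \<Rightarrow> real vec" where
  "coef v = GI *\<^sub>v ((0\<^sub>v (2 * n - m) @\<^sub>v fst v) + vec_integral a b (2 * n) (\<lambda>x. HH x *\<^sub>v snd v x))"

lemma HHw_L2: "w \<in> L2_vec a b n \<Longrightarrow> (\<lambda>x. HH x *\<^sub>v w x) \<in> L2_vec a b (2 * n)"
  \<comment> \<open>Square-integrability of H w does not involve Cauchy data, so zero data are
    supplied.\<close>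
  unfolding H_hat_def by (rule L2_vec_H_mat_mult[OF ab EE_carrier FF_L2 zero_carrier_vec])

lemma pad_carrier: "v0 \<in> carrier_vec m \<Longrightarrow> 0\<^sub>v (2 * n - m) @\<^sub>v v0 \<in> carrier_vec (2 * n)"
  using append_carrier_vec[of "0\<^sub>v (2 * n - m)" "2 * n - m" v0 m] by (simp add: row_sum)

lemma coef_carrier: "v \<in> RL2 a b m n \<Longrightarrow> coef v \<in> carrier_vec (2 * n)"
  unfolding coef_def
  by (intro mult_mat_vec_carrier[OF GI(1)] add_carrier_vec pad_carrier vec_integral_carrier) (auto simp: RL2_def)

lemma pad_mat_carrier: "0\<^sub>m (2 * n - m) m @\<^sub>r 1\<^sub>m m \<in> (carrier_mat (2 * n) m :: real mat set)"
  using carrier_append_rows[of "0\<^sub>m (2 * n - m) m" "2 * n - m" m "1\<^sub>m m" m] by (simp add: row_sum)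

text \<open>A common form of both operators: for B = \<open>affine_row a n x\<close> the left side
  is the first two terms of \<open>T_op\<close>, for B = [0, I] those of
  \<open>R_op\<close>.\<close>

lemma linear_image_coef:
  assumes v: "v \<in> RL2 a b m n" and B: "B \<in> carrier_mat n (2 * n)"
  shows "(B * GI * (0\<^sub>m (2 * n - m) m @\<^sub>r 1\<^sub>m m)) *\<^sub>v fst v + vec_integral a b n (\<lambda>x. (B * GI * HH x) *\<^sub>v snd v x)
    = B *\<^sub>v coef v"
proof -
  have v0: "fst v \<in> carrier_vec m" and w: "snd v \<in> L2_vec a b n" using v by (auto simp: RL2_def)
  have BG: "B * GI \<in> carrier_mat n (2 * n)" by (rule mult_carrier_mat[OF B GI(1)])
  note S = pad_mat_carrier
  have Sv: "(0\<^sub>m (2 * n - m) m @\<^sub>r 1\<^sub>m m) *\<^sub>v fst v = 0\<^sub>v (2 * n - m) @\<^sub>v fst v"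
    using mat_mult_append[of "0\<^sub>m (2 * n - m) m" "2 * n - m" m "1\<^sub>m m" m "fst v"] v0
    by (simp add: zero_mat_mult_vec)
  have "vec_integral a b n (\<lambda>x. (B * GI * HH x) *\<^sub>v snd v x)
      = vec_integral a b n (\<lambda>x. (B * GI) *\<^sub>v (HH x *\<^sub>v snd v x))"
    by (rule vec_integral_cong) (rule assoc_mult_mat_vec[OF BG HH_carrier L2_vec_carrier[OF w]])
  also have "\<dots> = (B * GI) *\<^sub>v vec_integral a b (2 * n) (\<lambda>x. HH x *\<^sub>v snd v x)"
    by (rule mult_vec_integral[OF BG L2_vec_carrier[OF HHw_L2[OF w]] L2_vec_integrable[OF HHw_L2[OF w]], symmetric])
  finally have "(B * GI * (0\<^sub>m (2 * n - m) m @\<^sub>r 1\<^sub>m m)) *\<^sub>v fst v + vec_integral a b n (\<lambda>x. (B * GI * HH x) *\<^sub>v snd v x)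
      = (B * GI) *\<^sub>v ((0\<^sub>v (2 * n - m) @\<^sub>v fst v) + vec_integral a b (2 * n) (\<lambda>x. HH x *\<^sub>v snd v x))"
    unfolding assoc_mult_mat_vec[OF BG S v0] Sv
    by (simp add: mult_add_distrib_mat_vec[OF BG pad_carrier[OF v0] vec_integral_carrier])
  also have "\<dots> = B *\<^sub>v coef v"
    unfolding coef_def by (rule assoc_mult_mat_vec[OF B GI(1)]) (intro add_carrier_vec pad_carrier v0 vec_integral_carrier)
  finally show ?thesis .
qed

text \<open>On [a, b] the function T v is the Taylor form with Cauchy data \<open>coef v\<close> and
  second derivative v1, so it inherits all facts about Taylor forms. The state ranges over the whole
  product space, not only over Y.\<close>

lemma T_op_eq:
  assumes v: "v \<in> RL2 a b m n" and x: "x \<in> {a..b}"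
  shows "Top v x = reconstruction a n (coef v) (snd v) x"
proof -
  have w: "snd v t \<in> carrier_vec n" if "t \<in> {a..x}" for t
    using v x that by (auto simp: RL2_def intro: L2_vec_carrier)
  show ?thesis
    unfolding T_op_def T0_def T1_def linear_image_coef[OF v affine_row_carrier]
    by (rule reconstruction_affine_row[OF coef_carrier[OF v] w, symmetric])
qed

lemma R_op_eq:
  assumes v: "v \<in> RL2 a b m n" and x: "x \<in> {a..b}"
  shows "Rop v x = reconstruction_deriv a n (coef v) (snd v) x"
proof -
  let ?D = "append_cols (0\<^sub>m n n) (1\<^sub>m n) :: real mat" and ?S = "0\<^sub>m (2 * n - m) m @\<^sub>r 1\<^sub>m m :: real mat"
  have D: "?D \<in> carrier_mat n (2 * n)" unfolding mult_2 by simp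
  note S = pad_mat_carrier
  have deriv: "mat_deriv (\<lambda>y. affine_row a n y * GI * M) x = ?D * GI * M" if M: "M \<in> carrier_mat (2 * n) k" for M k
    using mat_deriv_affine_row[OF mult_carrier_mat[OF GI(1) M], of a x]
    by (simp only: assoc_mult_mat[OF affine_row_carrier GI(1) M] assoc_mult_mat[OF D GI(1) M])
  have "Rop v x = (?D * GI * ?S) *\<^sub>v fst v + vec_integral a b n (\<lambda>t. (?D * GI * HH t) *\<^sub>v snd v t)
      + vec_integral a x n (snd v)"
    unfolding R_op_def T0_def[abs_def] T1_def deriv[OF S] deriv[OF HH_carrier] ..
  also have "\<dots> = ?D *\<^sub>v coef v + vec_integral a x n (snd v)"
    unfolding linear_image_coef[OF v D] ..
  also have "?D *\<^sub>v coef v = vec_upper n (coef v)"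
    by (simp add: append_cols_mult_halves[of _ n n, OF _ _ coef_carrier[OF v]] zero_mat_mult_vec)
  also have "vec_upper n (coef v) + vec_integral a x n (snd v) = reconstruction_deriv a n (coef v) (snd v) x"
    by (intro eq_vecI) (simp_all add: vec_upper_def reconstruction_deriv_def vec_primitive_def)
  finally show ?thesis .
qed

lemma GG_coef:
  assumes v: "v \<in> RL2 a b m n"
  shows "GG *\<^sub>v coef v - vec_integral a b (2 * n) (\<lambda>x. HH x *\<^sub>v snd v x) = 0\<^sub>v (2 * n - m) @\<^sub>v fst v"
proof -
  let ?p = "0\<^sub>v (2 * n - m) @\<^sub>v fst v" and ?I = "vec_integral a b (2 * n) (\<lambda>x. HH x *\<^sub>v snd v x)"
  have p: "?p \<in> carrier_vec (2 * n)" using v by (intro pad_carrier) (auto simp: RL2_def)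
  then have pI: "?p + ?I \<in> carrier_vec (2 * n)" by simp
  have "GG *\<^sub>v coef v = ?p + ?I"
    unfolding coef_def assoc_mult_mat_vec[OF GG_carrier GI(1) pI, symmetric] GI(3) using pI by simp
  moreover have "(p + q) - q = p" if "p \<in> carrier_vec k" "q \<in> carrier_vec k" for p q :: "real vec" and k
    using that by (intro eq_vecI) auto
  ultimately show ?thesis using p by simp
qed

text \<open>Converse of \<open>GG_coef\<close>: as G_hat is invertible, the linear system has no
  other solution.\<close>

lemma coef_unique:
  assumes c: "c \<in> carrier_vec (2 * n)" and v0: "v0 \<in> carrier_vec m"
    and eq: "GG *\<^sub>v c - vec_integral a b (2 * n) (\<lambda>x. HH x *\<^sub>v w x) = 0\<^sub>v (2 * n - m) @\<^sub>v v0"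
  shows "coef (v0, w) = c"
proof -
  let ?I = "vec_integral a b (2 * n) (\<lambda>x. HH x *\<^sub>v w x)"
  have Gc: "GG *\<^sub>v c \<in> carrier_vec (2 * n)" by (rule mult_mat_vec_carrier[OF GG_carrier c])
  have "(0\<^sub>v (2 * n - m) @\<^sub>v v0) + ?I = GG *\<^sub>v c"
    unfolding eq[symmetric] by (rule minus_add_cancel_vec[OF Gc vec_integral_carrier])
  then have "coef (v0, w) = GI *\<^sub>v (GG *\<^sub>v c)" by (simp add: coef_def)
  also have "\<dots> = c" unfolding assoc_mult_mat_vec[OF GI(1) GG_carrier c, symmetric] GI(2) using c by simp
  finally show ?thesis .
qed

text \<open>J turns the boundary value B into [B1; B2]. The augmented data \<open>EE\<close>,
  \<open>FF\<close> reproduce B1 and put F u in the place of B2, because the last rows of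
  \<open>EE\<close> vanish and those of \<open>FF\<close> are \<open>F3\<close>. As G vanishes on
  the second block, B2 = -\<integral> H w. The first claim presupposes no boundary condition and so
  can be evaluated on T v for every state v.\<close>

lemma boundary_rows:
  assumes c: "c \<in> carrier_vec (2 * n)" and w: "w \<in> L2_vec a b n"
  defines "z \<equiv> reconstruction a n c w a @\<^sub>v reconstruction a n c w b
      @\<^sub>v reconstruction_deriv a n c w a @\<^sub>v reconstruction_deriv a n c w b"
  shows boundary_value_F_op: "\<exists>p\<in>carrier_vec (2 * n - m).
      GG *\<^sub>v c - vec_integral a b (2 * n) (\<lambda>x. HH x *\<^sub>v w x) = p @\<^sub>v Fop (reconstruction a n c w)"
    and boundary_condition_split: "E *\<^sub>v z + vec_integral a b (2 * n) (\<lambda>x. eval_pmat F x *\<^sub>v reconstruction a n c w x) = 0\<^sub>v (2 * n) \<longleftrightarrow>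
    GG *\<^sub>v c - vec_integral a b (2 * n) (\<lambda>x. HH x *\<^sub>v w x)
        = 0\<^sub>v (2 * n - m) @\<^sub>v Fop (reconstruction a n c w)
    \<and> vec_integral a b m (\<lambda>x. H_mat b n (E2 m J E) (F2 m J F) x *\<^sub>v w x) = 0\<^sub>v m"
proof -
  let ?u = "reconstruction a n c w"
  let ?l = "2 * n - m"
  define B where "B = E *\<^sub>v z + vec_integral a b (2 * n) (\<lambda>x. eval_pmat F x *\<^sub>v ?u x)"
  define B1 where "B1 = E1 n m J E *\<^sub>v z + vec_integral a b ?l (\<lambda>x. F1 n m J F x *\<^sub>v ?u x)"
  define B2 where "B2 = E2 m J E *\<^sub>v z + vec_integral a b m (\<lambda>x. F2 m J F x *\<^sub>v ?u x)"
  have z: "z \<in> carrier_vec (4 * n)"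
    unfolding z_def four_mult_eq_add by (intro append_carrier_vec reconstruction_carrier)
  note uL2 = reconstruction_L2(1)[OF w, of c]
  note Fe = L2_mat_eval_pmat[OF F, of a b]
  have uc: "?u x \<in> carrier_vec n" for x by simp
  have Bc: "B \<in> carrier_vec (2 * n)"
    unfolding B_def by (intro add_carrier_vec mult_mat_vec_carrier[OF E z] vec_integral_carrier)
  have JFc: "J * eval_pmat F x \<in> carrier_mat (2 * n) n" for x using J F by simp
  have JB: "J *\<^sub>v B = (J * E) *\<^sub>v z + vec_integral a b (2 * n) (\<lambda>x. (J * eval_pmat F x) *\<^sub>v ?u x)"
  proof -
    have "J *\<^sub>v vec_integral a b (2 * n) (\<lambda>x. eval_pmat F x *\<^sub>v ?u x)
        = vec_integral a b (2 * n) (\<lambda>x. J *\<^sub>v (eval_pmat F x *\<^sub>v ?u x))"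
      by (rule mult_vec_integral[OF J _ integrable_L2_mat_mult_vec[OF Fe uL2]])
        (rule mult_mat_vec_carrier[OF eval_pmat_carrier[OF F] uc])
    also have "\<dots> = vec_integral a b (2 * n) (\<lambda>x. (J * eval_pmat F x) *\<^sub>v ?u x)"
      by (simp only: assoc_mult_mat_vec[OF J eval_pmat_carrier[OF F] uc])
    finally show ?thesis
      unfolding B_def
      by (simp add: mult_add_distrib_mat_vec[OF J mult_mat_vec_carrier[OF E z] vec_integral_carrier]
          assoc_mult_mat_vec[OF J E z])
  qed
  have B1_index: "B1 $ i = (J *\<^sub>v B) $ i" if "i < ?l" for i
    unfolding B1_def JB using that J E
    by (simp add: E1_def F1_def first_rows_mult_vec[OF JE z] first_rows_mult_vec[OF JFc uc] del: index_mult_mat_vec)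
  have B2_index: "B2 $ i = (J *\<^sub>v B) $ (?l + i)" if "i < m" for i
    unfolding B2_def JB using that J E m_le
    by (simp add: E2_def F2_def last_rows_mult_vec[OF JE z] last_rows_mult_vec[OF JFc uc] del: index_mult_mat_vec)
  have B1c: "B1 \<in> carrier_vec ?l"
    unfolding B1_def by (intro add_carrier_vec mult_mat_vec_carrier[OF E1_carrier z] vec_integral_carrier)
  have B2c: "B2 \<in> carrier_vec m"
    unfolding B2_def by (intro add_carrier_vec mult_mat_vec_carrier[OF E2_carrier z] vec_integral_carrier)
  have JBc: "J *\<^sub>v B \<in> carrier_vec (2 * n)" by (rule mult_mat_vec_carrier[OF J Bc])
  have JB_app: "J *\<^sub>v B = B1 @\<^sub>v B2"
  proof (rule eq_vecI)
    fix i assume "i < dim_vec (B1 @\<^sub>v B2)"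
    then have "i < ?l + m" using B1c B2c by simp
    then show "(J *\<^sub>v B) $ i = (B1 @\<^sub>v B2) $ i"
      using B1_index[of i] B2_index[of "i - ?l"] carrier_vecD[OF B1c] carrier_vecD[OF B2c]
      by (cases "i < ?l") (simp_all del: index_mult_mat_vec)
  qed (use carrier_vecD[OF JBc] carrier_vecD[OF B1c] carrier_vecD[OF B2c] row_sum in simp)
  have zero: "0\<^sub>v (2 * n) = 0\<^sub>v ?l @\<^sub>v (0\<^sub>v m :: real vec)"
    using m_le by (intro eq_vecI) auto
  have "J *\<^sub>v B = 0\<^sub>v (2 * n) \<longleftrightarrow> B1 = 0\<^sub>v ?l \<and> B2 = 0\<^sub>v m"
    unfolding JB_app zero using B1c by (intro append_vec_eq) auto
  then have B_iff: "B = 0\<^sub>v (2 * n) \<longleftrightarrow> B1 = 0\<^sub>v ?l \<and> B2 = 0\<^sub>v m"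
    using invertible_mult_vec_eq_0_iff[OF J J_inv Bc] by simp
  have "EE *\<^sub>v z + vec_integral a b (2 * n) (\<lambda>x. FF x *\<^sub>v ?u x) = B1 @\<^sub>v Fop ?u"
  proof -
    have "EE *\<^sub>v z = E1 n m J E *\<^sub>v z @\<^sub>v 0\<^sub>v m"
      unfolding E_hat_def mat_mult_append[OF E1_carrier zero_carrier_mat z] zero_mat_mult_vec[OF z] ..
    moreover have "vec_integral a b (2 * n) (\<lambda>x. FF x *\<^sub>v ?u x)
        = vec_integral a b (?l + m) (\<lambda>x. F1 n m J F x *\<^sub>v ?u x @\<^sub>v F3 x *\<^sub>v ?u x)"
      unfolding row_sum F_hat_def
      by (rule vec_integral_cong) (rule mat_mult_append[OF L2_mat_carrier[OF F1_L2] L2_mat_carrier[OF F3] uc])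
    moreover have "\<dots> = vec_integral a b ?l (\<lambda>x. F1 n m J F x *\<^sub>v ?u x) @\<^sub>v Fop ?u"
      unfolding F_op_def
      by (rule vec_integral_append) (rule mult_mat_vec_carrier[OF L2_mat_carrier[OF F1_L2] uc] mult_mat_vec_carrier[OF L2_mat_carrier[OF F3] uc]; assumption)+
    ultimately show ?thesis
      unfolding B1_def
      using append_vec_add[OF mult_mat_vec_carrier[OF E1_carrier z] vec_integral_carrier, of "0\<^sub>v m" m "Fop ?u"]
      by (simp add: F_op_def)
  qed
  \<comment> \<open>The boundary functional of the augmented data in its two forms: as a stack of
    rows and as G c - \<integral> H w.\<close>
  then have 1: "GG *\<^sub>v c - vec_integral a b (2 * n) (\<lambda>x. HH x *\<^sub>v w x) = B1 @\<^sub>v Fop ?u"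
    unfolding G_hat_def H_hat_def z_def boundary_functional_eq[OF ab EE_carrier FF_L2 c w] by simp
  show "\<exists>p\<in>carrier_vec ?l. GG *\<^sub>v c - vec_integral a b (2 * n) (\<lambda>x. HH x *\<^sub>v w x) = p @\<^sub>v Fop ?u"
    using 1 B1c by blast
  have "B2 = G_mat a b n (E2 m J E) (F2 m J F) *\<^sub>v c
      - vec_integral a b m (\<lambda>x. H_mat b n (E2 m J E) (F2 m J F) x *\<^sub>v w x)"
    unfolding B2_def z_def by (rule boundary_functional_eq[OF ab E2_carrier F2_L2 c w])
  then have 2: "B2 = - vec_integral a b m (\<lambda>x. H_mat b n (E2 m J E) (F2 m J F) x *\<^sub>v w x)"
    unfolding G2 zero_mat_mult_vec[OF c] by simp
  have "B2 = 0\<^sub>v m \<longleftrightarrow> vec_integral a b m (\<lambda>x. H_mat b n (E2 m J E) (F2 m J F) x *\<^sub>v w x) = 0\<^sub>v m"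
    unfolding 2 by (simp add: uminus_zero_vec_eq)
  moreover have "B1 = 0\<^sub>v ?l \<longleftrightarrow> B1 @\<^sub>v Fop ?u = 0\<^sub>v ?l @\<^sub>v Fop ?u"
    using append_vec_eq[OF B1c zero_carrier_vec] by simp
  ultimately show "E *\<^sub>v z + vec_integral a b (2 * n) (\<lambda>x. eval_pmat F x *\<^sub>v ?u x) = 0\<^sub>v (2 * n) \<longleftrightarrow>
    GG *\<^sub>v c - vec_integral a b (2 * n) (\<lambda>x. HH x *\<^sub>v w x) = 0\<^sub>v ?l @\<^sub>v Fop ?u
    \<and> vec_integral a b m (\<lambda>x. H_mat b n (E2 m J E) (F2 m J F) x *\<^sub>v w x) = 0\<^sub>v m"
    unfolding B_iff[unfolded B_def] 1 by simp
qed

text \<open>Membership in X is a condition on the Taylor data (c, w) alone: the first block of rows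
  determines c through the linear system, the second is the constraint K. \<open>v0\<close> is free
  because K reads only the function component of a state.\<close>

lemma X_space_iff:
  assumes c: "c \<in> carrier_vec (2 * n)" and w: "w \<in> L2_vec a b n" and u: "u \<in> L2_vec a b n"
    and ae: "ae_eq a b u (reconstruction a n c w)"
  shows "u \<in> X \<longleftrightarrow> coef (Fop u, w) = c \<and> Kop (v0, w) = 0\<^sub>v m"
proof -
  note W = W22_weak_derivs[OF ab u w ae]
  note Fe = L2_mat_eval_pmat[OF F, of a b]
  note rL2 = reconstruction_L2[OF w, of c]
  have cr: "cont_rep a b n u x = reconstruction a n c w x" if "x \<in> {a..b}" for x
    by (rule cont_rep_eq[OF ab ae _ continuous_reconstruction(1)[OF w] that]) simp_all
  have cr': "cont_rep a b n (weak_deriv a b n u) x = reconstruction_deriv a n c w x" if "x \<in> {a..b}" for x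
    by (rule cont_rep_eq[OF ab W(2) _ continuous_reconstruction(2)[OF w] that]) simp_all
  have Fu: "Fop u = Fop (reconstruction a n c w)"
    unfolding F_op_def by (rule vec_integral_mult_ae_eq[OF F3 u rL2(1) ae])
  have Fu_c: "Fop u \<in> carrier_vec m" by (simp add: F_op_def)
  have "u \<in> X \<longleftrightarrow>
      E *\<^sub>v (reconstruction a n c w a @\<^sub>v reconstruction a n c w b
        @\<^sub>v reconstruction_deriv a n c w a @\<^sub>v reconstruction_deriv a n c w b)
      + vec_integral a b (2 * n) (\<lambda>x. eval_pmat F x *\<^sub>v reconstruction a n c w x) = 0\<^sub>v (2 * n)"
    using W(1) E ab vec_integral_mult_ae_eq[OF Fe u rL2(1) ae]
    by (simp add: X_space_def cr cr')
  also have "\<dots> \<longleftrightarrow> GG *\<^sub>v c - vec_integral a b (2 * n) (\<lambda>x. HH x *\<^sub>v w x) = 0\<^sub>v (2 * n - m) @\<^sub>v Fop u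
      \<and> Kop (v0, w) = 0\<^sub>v m"
    unfolding boundary_condition_split[OF c w] K_op_def Fu by simp
  also have "GG *\<^sub>v c - vec_integral a b (2 * n) (\<lambda>x. HH x *\<^sub>v w x) = 0\<^sub>v (2 * n - m) @\<^sub>v Fop u
      \<longleftrightarrow> coef (Fop u, w) = c"
    using coef_unique[OF c Fu_c] GG_coef[of "(Fop u, w)"] w Fu_c by (auto simp: RL2_def)
  finally show ?thesis .
qed
end

subsection \<open>Remainders of first order in the norms of the state spaces\<close>

text \<open>The norms of the state spaces are roots of sums of squares. After squaring, the summands
  can be treated one at a time.\<close>

lemma sqrt_small_iff:
  fixes A r :: "real \<Rightarrow> real"
  assumes "\<And>s. 0 \<le> A s"
  shows "((\<lambda>s. sqrt (A s) / \<bar>r s\<bar>) \<longlongrightarrow> 0) \<F> \<longleftrightarrow> ((\<lambda>s. A s / (r s)\<^sup>2) \<longlongrightarrow> 0) \<F>"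
proof
  assume "((\<lambda>s. sqrt (A s) / \<bar>r s\<bar>) \<longlongrightarrow> 0) \<F>"
  then have "((\<lambda>s. (sqrt (A s) / \<bar>r s\<bar>)\<^sup>2) \<longlongrightarrow> 0\<^sup>2) \<F>" by (rule tendsto_power)
  then show "((\<lambda>s. A s / (r s)\<^sup>2) \<longlongrightarrow> 0) \<F>" using assms by (simp add: power_divide)
next
  assume "((\<lambda>s. A s / (r s)\<^sup>2) \<longlongrightarrow> 0) \<F>"
  then have "((\<lambda>s. sqrt (A s / (r s)\<^sup>2)) \<longlongrightarrow> sqrt 0) \<F>" by (rule tendsto_real_sqrt)
  then show "((\<lambda>s. sqrt (A s) / \<bar>r s\<bar>) \<longlongrightarrow> 0) \<F>" by (simp add: real_sqrt_divide)
qed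

lemma square_small_iff:
  fixes q r :: "real \<Rightarrow> real"
  shows "((\<lambda>s. (q s)\<^sup>2 / (r s)\<^sup>2) \<longlongrightarrow> 0) \<F> \<longleftrightarrow> ((\<lambda>s. q s / r s) \<longlongrightarrow> 0) \<F>"
proof -
  have "((\<lambda>s. q s / r s) \<longlongrightarrow> 0) \<F> \<longleftrightarrow> ((\<lambda>s. \<bar>q s / r s\<bar>) \<longlongrightarrow> 0) \<F>" by (rule tendsto_rabs_zero_iff[symmetric])
  also have "\<dots> \<longleftrightarrow> ((\<lambda>s. (q s)\<^sup>2 / (r s)\<^sup>2) \<longlongrightarrow> 0) \<F>"
    using sqrt_small_iff[of "\<lambda>s. (q s)\<^sup>2" r \<F>] by simp
  finally show ?thesis ..
qed

text \<open>The form in which boundedness of a linear map is used: a bound between squared norms,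
  valid eventually along the filter, transfers smallness.\<close>

lemma small_mono:
  fixes A B r :: "real \<Rightarrow> real"
  assumes B: "((\<lambda>s. B s / (r s)\<^sup>2) \<longlongrightarrow> 0) \<F>"
    and le: "\<forall>\<^sub>F s in \<F>. A s \<le> C * B s" and nonneg: "\<And>s. 0 \<le> A s"
  shows "((\<lambda>s. A s / (r s)\<^sup>2) \<longlongrightarrow> 0) \<F>"
proof (rule tendsto_sandwich[OF _ _ tendsto_const])
  show "\<forall>\<^sub>F s in \<F>. 0 \<le> A s / (r s)\<^sup>2" using nonneg by simp
  show "\<forall>\<^sub>F s in \<F>. A s / (r s)\<^sup>2 \<le> C * (B s / (r s)\<^sup>2)"
    using le by eventually_elim (simp add: divide_right_mono)
  show "((\<lambda>s. C * (B s / (r s)\<^sup>2)) \<longlongrightarrow> 0) \<F>" using tendsto_mult_left[OF B, of C] by simp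
qed

lemma sum_small_iff:
  fixes h :: "'i \<Rightarrow> real \<Rightarrow> real" and r :: "real \<Rightarrow> real"
  assumes "finite I" and nonneg: "\<And>i s. 0 \<le> h i s"
  shows "((\<lambda>s. (\<Sum>i\<in>I. h i s) / (r s)\<^sup>2) \<longlongrightarrow> 0) \<F> \<longleftrightarrow> (\<forall>i\<in>I. ((\<lambda>s. h i s / (r s)\<^sup>2) \<longlongrightarrow> 0) \<F>)"
proof (intro iffI ballI)
  fix i assume i: "i \<in> I" and *: "((\<lambda>s. (\<Sum>i\<in>I. h i s) / (r s)\<^sup>2) \<longlongrightarrow> 0) \<F>"
  have "h i s \<le> 1 * (\<Sum>i\<in>I. h i s)" for s
    using member_le_sum[of i I "\<lambda>i. h i s"] i assms by simp
  then show "((\<lambda>s. h i s / (r s)\<^sup>2) \<longlongrightarrow> 0) \<F>"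
    by (intro small_mono[OF * _ nonneg, where C = 1] always_eventually allI)
next
  assume "\<forall>i\<in>I. ((\<lambda>s. h i s / (r s)\<^sup>2) \<longlongrightarrow> 0) \<F>"
  then have "((\<lambda>s. \<Sum>i\<in>I. h i s / (r s)\<^sup>2) \<longlongrightarrow> (\<Sum>i\<in>I. 0)) \<F>" by (intro tendsto_sum) auto
  then show "((\<lambda>s. (\<Sum>i\<in>I. h i s) / (r s)\<^sup>2) \<longlongrightarrow> 0) \<F>" by (simp add: sum_divide_distrib)
qed

lemma add_small_iff:
  fixes A B r :: "real \<Rightarrow> real"
  assumes "\<And>s. 0 \<le> A s" "\<And>s. 0 \<le> B s"
  shows "((\<lambda>s. (A s + B s) / (r s)\<^sup>2) \<longlongrightarrow> 0) \<F> \<longleftrightarrow>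
    ((\<lambda>s. A s / (r s)\<^sup>2) \<longlongrightarrow> 0) \<F> \<and> ((\<lambda>s. B s / (r s)\<^sup>2) \<longlongrightarrow> 0) \<F>"
  using sum_small_iff[of "UNIV :: bool set" "\<lambda>i. if i then A else B" r \<F>] assms
  by (simp add: UNIV_bool ex_bool_eq conj_commute add.commute)

text \<open>f(s) is o(r(s)) in the norm of L2 along the filter. Square-integrability is demanded
  separately, since the integral of a nonintegrable function is 0 by convention and the limit alone
  would then say nothing. It is demanded only eventually, because solutions are constrained for s
  \<ge> 0 only.\<close>

definition L2_small :: "real \<Rightarrow> real \<Rightarrow> real filter \<Rightarrow> (real \<Rightarrow> real) \<Rightarrow> (real \<Rightarrow> real \<Rightarrow> real) \<Rightarrow> bool" where
  "L2_small a b \<F> r f \<longleftrightarrow> (\<forall>\<^sub>F s in \<F>. square_integrable a b (f s)) \<and>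
     ((\<lambda>s. (\<integral>x. (f s x)\<^sup>2 \<partial>lebesgue_on {a..b}) / (r s)\<^sup>2) \<longlongrightarrow> 0) \<F>"

lemma L2_small_AE:
  assumes f: "L2_small a b \<F> r f" and ae: "\<forall>\<^sub>F s in \<F>. AE x in lebesgue_on {a..b}. f s x = g s x"
  shows "L2_small a b \<F> r g"
proof -
  have sf: "\<forall>\<^sub>F s in \<F>. square_integrable a b (f s)" using f by (simp add: L2_small_def)
  then have sg: "\<forall>\<^sub>F s in \<F>. square_integrable a b (g s)"
    using ae by eventually_elim (rule square_integrable_AE)
  have le: "\<forall>\<^sub>F s in \<F>. (\<integral>x. (g s x)\<^sup>2 \<partial>lebesgue_on {a..b}) \<le> 1 * (\<integral>x. (f s x)\<^sup>2 \<partial>lebesgue_on {a..b})"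
    using sf sg ae
  proof eventually_elim
    case (elim s)
    have "(\<integral>x. (g s x)\<^sup>2 \<partial>lebesgue_on {a..b}) = (\<integral>x. (f s x)\<^sup>2 \<partial>lebesgue_on {a..b})"
      using elim by (intro integral_cong_AE) (auto simp: square_integrable_def)
    then show ?case by simp
  qed
  have "((\<lambda>s. (\<integral>x. (g s x)\<^sup>2 \<partial>lebesgue_on {a..b}) / (r s)\<^sup>2) \<longlongrightarrow> 0) \<F>"
    by (rule small_mono[OF _ le]) (use f in \<open>simp_all add: L2_small_def\<close>)
  with sg show ?thesis by (simp add: L2_small_def)
qed

lemma L2_small_cong:
  assumes "L2_small a b \<F> r f" "\<forall>\<^sub>F s in \<F>. \<forall>x\<in>{a..b}. f s x = g s x"
  shows "L2_small a b \<F> r g"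
  by (rule L2_small_AE[OF assms(1)], rule eventually_mono[OF assms(2)], intro AE_I2) simp

lemma L2_small_add:
  assumes f: "L2_small a b \<F> r f" and g: "L2_small a b \<F> r g"
  shows "L2_small a b \<F> r (\<lambda>s x. f s x + g s x)"
proof -
  let ?I = "\<lambda>f s. \<integral>x. (f s x)\<^sup>2 \<partial>lebesgue_on {a..b}"
  have sq: "\<forall>\<^sub>F s in \<F>. square_integrable a b (f s) \<and> square_integrable a b (g s)"
    using f g by (simp add: L2_small_def eventually_conj_iff)
  have "((\<lambda>s. (?I f s + ?I g s) / (r s)\<^sup>2) \<longlongrightarrow> 0) \<F>"
    using f g by (subst add_small_iff) (auto simp: L2_small_def)
  moreover have "\<forall>\<^sub>F s in \<F>. ?I (\<lambda>s x. f s x + g s x) s \<le> 2 * (?I f s + ?I g s)"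
    using sq
  proof eventually_elim
    case (elim s)
    have "?I (\<lambda>s x. f s x + g s x) s \<le> (\<integral>x. 2 * ((f s x)\<^sup>2 + (g s x)\<^sup>2) \<partial>lebesgue_on {a..b})"
    proof (rule integral_mono)
      show "integrable (lebesgue_on {a..b}) (\<lambda>x. (f s x + g s x)\<^sup>2)"
        using elim square_integrable_add by (auto simp: square_integrable_def)
      show "integrable (lebesgue_on {a..b}) (\<lambda>x. 2 * ((f s x)\<^sup>2 + (g s x)\<^sup>2))"
        using elim by (auto simp: square_integrable_def)
      show "(f s x + g s x)\<^sup>2 \<le> 2 * ((f s x)\<^sup>2 + (g s x)\<^sup>2)" for x
        using sum_squares_bound[of "f s x" "g s x"] by (simp add: power2_sum)
    qed
    also have "\<dots> = 2 * (?I f s + ?I g s)"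
      using elim by (simp add: square_integrable_def)
    finally show ?case .
  qed
  ultimately have "((\<lambda>s. ?I (\<lambda>s x. f s x + g s x) s / (r s)\<^sup>2) \<longlongrightarrow> 0) \<F>"
    by (rule small_mono) simp
  moreover have "\<forall>\<^sub>F s in \<F>. square_integrable a b (\<lambda>x. f s x + g s x)"
    using sq by eventually_elim (auto intro: square_integrable_add)
  ultimately show ?thesis by (simp add: L2_small_def)
qed

lemma L2_small_scaled:
  assumes q: "((\<lambda>s. q s / r s) \<longlongrightarrow> 0) \<F>" and k: "square_integrable a b k"
  shows "L2_small a b \<F> r (\<lambda>s x. q s * k x)"
proof -
  have "((\<lambda>s. (q s / r s)\<^sup>2 * (\<integral>x. (k x)\<^sup>2 \<partial>lebesgue_on {a..b})) \<longlongrightarrow> 0\<^sup>2 * (\<integral>x. (k x)\<^sup>2 \<partial>lebesgue_on {a..b})) \<F>"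
    by (intro tendsto_intros q)
  then show ?thesis
    using k by (simp add: L2_small_def square_integrable_cmult power_mult_distrib power_divide)
qed

text \<open>The Volterra operator has norm at most b - a: Cauchy-Schwarz against the constant 1
  bounds the square of the primitive at x by (x - a) \<integral> f^2, and integrating over [a, b]
  supplies the second factor b - a.\<close>

lemma L2_small_primitive:
  assumes f: "L2_small a b \<F> r f" and "a < b"
  shows "L2_small a b \<F> r (\<lambda>s x. \<integral>t. f s t \<partial>lebesgue_on {a..x})"
proof -
  let ?P = "\<lambda>s x. \<integral>t. f s t \<partial>lebesgue_on {a..x}"
  let ?I = "\<lambda>f s. \<integral>x. (f s x)\<^sup>2 \<partial>lebesgue_on {a..b}"
  have sf: "\<forall>\<^sub>F s in \<F>. square_integrable a b (f s)" using f by (simp add: L2_small_def)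
  have sP: "\<forall>\<^sub>F s in \<F>. square_integrable a b (?P s)"
    using sf by eventually_elim
      (rule square_integrable_continuous[OF continuous_primitive[OF square_integrable_integrable]])
  have le: "\<forall>\<^sub>F s in \<F>. ?I ?P s \<le> (b - a)\<^sup>2 * ?I f s"
    using sf sP
  proof eventually_elim
    case (elim s)
    have pt: "(?P s x)\<^sup>2 \<le> (b - a) * ?I f s" if x: "x \<in> {a..b}" for x
    proof -
      have sub: "{a..x} \<subseteq> {a..b}" using x by auto
      have fx: "square_integrable a x (f s)" by (rule square_integrable_mono[OF elim(1) sub])
      have "(?P s x)\<^sup>2 \<le> (x - a) * (\<integral>t. (f s t)\<^sup>2 \<partial>lebesgue_on {a..x})"
        using square_integrable_Cauchy_Schwarz[OF square_integrable_const[of a x 1] fx] x by simp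
      also have "\<dots> \<le> (b - a) * ?I f s"
      proof (rule mult_mono)
        show "(\<integral>t. (f s t)\<^sup>2 \<partial>lebesgue_on {a..x}) \<le> ?I f s"
          using elim(1) sub by (intro integral_mono_lebesgue_on_AE) (auto simp: square_integrable_def)
      qed (use x in auto)
      finally show ?thesis .
    qed
    have "?I ?P s \<le> (\<integral>x. (b - a) * ?I f s \<partial>lebesgue_on {a..b})"
    proof (rule integral_mono)
      show "integrable (lebesgue_on {a..b}) (\<lambda>x. (?P s x)\<^sup>2)" using elim(2) by (simp add: square_integrable_def)
      show "integrable (lebesgue_on {a..b}) (\<lambda>x. (b - a) * ?I f s)"
        using square_integrable_integrable[OF square_integrable_const] by blast
    qed (use pt in simp)
    also have "\<dots> = (b - a)\<^sup>2 * ?I f s" using \<open>a < b\<close> by (simp add: power2_eq_square)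
    finally show ?case .
  qed
  have "((\<lambda>s. ?I ?P s / (r s)\<^sup>2) \<longlongrightarrow> 0) \<F>"
    by (rule small_mono[OF _ le]) (use f in \<open>simp_all add: L2_small_def\<close>)
  with sP show ?thesis by (simp add: L2_small_def)
qed

text \<open>Integration against a fixed square-integrable k is a bounded functional, by
  Cauchy-Schwarz.\<close>

lemma L2_small_functional:
  assumes f: "L2_small a b \<F> r f" and k: "square_integrable a b k"
  shows "((\<lambda>s. (\<integral>x. k x * f s x \<partial>lebesgue_on {a..b}) / r s) \<longlongrightarrow> 0) \<F>"
proof -
  let ?I = "\<lambda>f s. \<integral>x. (f s x)\<^sup>2 \<partial>lebesgue_on {a..b}"
  have sf: "\<forall>\<^sub>F s in \<F>. square_integrable a b (f s)" using f by (simp add: L2_small_def)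
  have "((\<lambda>s. (\<integral>x. k x * f s x \<partial>lebesgue_on {a..b})\<^sup>2 / (r s)\<^sup>2) \<longlongrightarrow> 0) \<F>"
  proof (rule small_mono)
    show "((\<lambda>s. ?I f s / (r s)\<^sup>2) \<longlongrightarrow> 0) \<F>" using f by (simp add: L2_small_def)
    show "\<forall>\<^sub>F s in \<F>. (\<integral>x. k x * f s x \<partial>lebesgue_on {a..b})\<^sup>2 \<le> (\<integral>x. (k x)\<^sup>2 \<partial>lebesgue_on {a..b}) * ?I f s"
      using sf by eventually_elim (rule square_integrable_Cauchy_Schwarz[OF k])
  qed simp
  then show ?thesis by (simp only: square_small_iff)
qed

text \<open>Uniqueness of derivatives: if r(s) k is o(r(s)), then the quotient of squared norms is
  eventually the constant \<integral> k^2, which along a proper filter must equal its limit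
  0.\<close>

lemma L2_small_linear_imp_AE_zero:
  assumes f: "L2_small a b \<F> r (\<lambda>s x. r s * k x)" and k: "square_integrable a b k"
    and r: "\<forall>\<^sub>F s in \<F>. r s \<noteq> 0" and "\<F> \<noteq> bot"
  shows "AE x in lebesgue_on {a..b}. k x = 0"
proof -
  let ?I = "\<integral>x. (k x)\<^sup>2 \<partial>lebesgue_on {a..b}"
  have "((\<lambda>s. (r s)\<^sup>2 * ?I / (r s)\<^sup>2) \<longlongrightarrow> 0) \<F>"
    using f by (simp add: L2_small_def power_mult_distrib)
  then have "((\<lambda>s. ?I) \<longlongrightarrow> 0) \<F>"
    by (rule Lim_transform_eventually) (use r in \<open>eventually_elim, simp\<close>)
  then have "?I = 0" using \<open>\<F> \<noteq> bot\<close> by (simp add: tendsto_const_iff)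
  then show ?thesis using AE_interval_zero_iff_integral[OF k] by simp
qed

section \<open>Differentiability in the state spaces, entry by entry\<close>

lemma L2_norm_square: "(L2_norm a b k f)\<^sup>2 = (\<Sum>i<k. \<integral>x. (f x $ i)\<^sup>2 \<partial>lebesgue_on {a..b})"
  unfolding L2_norm_def by (intro real_sqrt_pow2 sum_nonneg) simp

lemma L2_norm_small_iff:
  assumes "\<forall>\<^sub>F s in \<F>. f s \<in> L2_vec a b k"
  shows "((\<lambda>s. (L2_norm a b k (f s))\<^sup>2 / (r s)\<^sup>2) \<longlongrightarrow> 0) \<F> \<longleftrightarrow> (\<forall>i<k. L2_small a b \<F> r (\<lambda>s x. f s x $ i))"
proof -
  have "\<forall>\<^sub>F s in \<F>. square_integrable a b (\<lambda>x. f s x $ i)" if "i < k" for i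
    using assms by eventually_elim (rule L2_vec_square_integrable[OF _ that])
  then show ?thesis
    unfolding L2_norm_square L2_small_def by (subst sum_small_iff) auto
qed

text \<open>Reduces differentiability to scalar remainders. Membership of v s is available for s
  \<ge> 0 only, and the filter \<open>at t within {0..}\<close> sees no other times.\<close>

lemma has_RL2_deriv_iff:
  assumes "w \<in> RL2 a b m n" "\<And>s. 0 \<le> s \<Longrightarrow> v s \<in> RL2 a b m n" and t: "0 \<le> t"
  shows "has_RL2_deriv a b m n v w t \<longleftrightarrow>
    (\<forall>i<m. ((\<lambda>s. (fst (v s) $ i - fst (v t) $ i - (s - t) * fst w $ i) / (s - t)) \<longlongrightarrow> 0) (at t within {0..})) \<and>
    (\<forall>i<n. L2_small a b (at t within {0..}) (\<lambda>s. s - t)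
        (\<lambda>s x. snd (v s) x $ i - snd (v t) x $ i - (s - t) * snd w x $ i))"
proof -
  let ?F = "at t within {0..}"
  let ?f = "\<lambda>s. fst (v s) - fst (v t) - (s - t) \<cdot>\<^sub>v fst w"
  let ?g = "\<lambda>s x. snd (v s) x - snd (v t) x - (s - t) \<cdot>\<^sub>v snd w x"
  have ev: "\<forall>\<^sub>F s in ?F. 0 \<le> s" by (simp add: eventually_at_filter)
  have c: "fst w \<in> carrier_vec m" "fst (v s) \<in> carrier_vec m" "snd w \<in> L2_vec a b n" "snd (v s) \<in> L2_vec a b n"
    if "0 \<le> s" for s
    using assms(1) assms(2)[OF that] by (auto simp: RL2_def mem_Times_iff)
  have gL2: "\<forall>\<^sub>F s in ?F. ?g s \<in> L2_vec a b n"
    using ev by eventually_elim (intro L2_vec_diff L2_vec_continuous_smult c t continuous_on_const)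
  have sp: "?f s \<bullet> ?f s = (\<Sum>i<m. (fst (v s) $ i - fst (v t) $ i - (s - t) * fst w $ i)\<^sup>2)" for s
  proof -
    have d: "dim_vec (fst w) = m" using c t by auto
    then have "?f s \<bullet> ?f s = (\<Sum>i<m. (?f s $ i)\<^sup>2)"
      by (simp add: scalar_prod_def power2_eq_square atLeast0LessThan)
    also have "\<dots> = (\<Sum>i<m. (fst (v s) $ i - fst (v t) $ i - (s - t) * fst w $ i)\<^sup>2)"
      using d carrier_vecD[OF c(2)[OF t]] by (intro sum.cong) auto
    finally show ?thesis .
  qed
  have "has_RL2_deriv a b m n v w t \<longleftrightarrow>
      ((\<lambda>s. (\<Sum>i<m. (fst (v s) $ i - fst (v t) $ i - (s - t) * fst w $ i)\<^sup>2) / (s - t)\<^sup>2) \<longlongrightarrow> 0) ?F \<and>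
      ((\<lambda>s. (L2_norm a b n (?g s))\<^sup>2 / (s - t)\<^sup>2) \<longlongrightarrow> 0) ?F"
    using assms(1) unfolding has_RL2_deriv_def RL2_norm_def fst_conv snd_conv sp
    by (subst sqrt_small_iff, simp add: sum_nonneg, subst add_small_iff) (simp_all add: sum_nonneg)
  also have "((\<lambda>s. (\<Sum>i<m. (fst (v s) $ i - fst (v t) $ i - (s - t) * fst w $ i)\<^sup>2) / (s - t)\<^sup>2) \<longlongrightarrow> 0) ?F \<longleftrightarrow>
      (\<forall>i<m. ((\<lambda>s. (fst (v s) $ i - fst (v t) $ i - (s - t) * fst w $ i) / (s - t)) \<longlongrightarrow> 0) ?F)"
    by (subst sum_small_iff) (auto simp: square_small_iff)
  also have "((\<lambda>s. (L2_norm a b n (?g s))\<^sup>2 / (s - t)\<^sup>2) \<longlongrightarrow> 0) ?F \<longleftrightarrow>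
      (\<forall>i<n. L2_small a b ?F (\<lambda>s. s - t) (\<lambda>s x. ?g s x $ i))"
    by (rule L2_norm_small_iff[OF gL2])
  also have "\<dots> \<longleftrightarrow> (\<forall>i<n. L2_small a b ?F (\<lambda>s. s - t)
        (\<lambda>s x. snd (v s) x $ i - snd (v t) x $ i - (s - t) * snd w x $ i))"
  proof -
    have eq: "\<forall>\<^sub>F s in ?F. \<forall>x\<in>{a..b}. ?g s x $ i = snd (v s) x $ i - snd (v t) x $ i - (s - t) * snd w x $ i"
      if "i < n" for i
    proof (intro always_eventually allI ballI)
      fix s x assume "x \<in> {a..b}"
      then have "dim_vec (snd w x) = n" "dim_vec (snd (v t) x) = n"
        using L2_vec_carrier[OF c(3)[OF t]] L2_vec_carrier[OF c(4)[OF t]] by auto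
      then show "?g s x $ i = snd (v s) x $ i - snd (v t) x $ i - (s - t) * snd w x $ i"
        using that by simp
    qed
    have "L2_small a b ?F (\<lambda>s. s - t) (\<lambda>s x. ?g s x $ i) \<longleftrightarrow> L2_small a b ?F (\<lambda>s. s - t)
        (\<lambda>s x. snd (v s) x $ i - snd (v t) x $ i - (s - t) * snd w x $ i)" if "i < n" for i
    proof
      assume *: "L2_small a b ?F (\<lambda>s. s - t) (\<lambda>s x. snd (v s) x $ i - snd (v t) x $ i - (s - t) * snd w x $ i)"
      have "\<forall>\<^sub>F s in ?F. \<forall>x\<in>{a..b}. snd (v s) x $ i - snd (v t) x $ i - (s - t) * snd w x $ i = ?g s x $ i"
        using eq[OF that] by eventually_elim simp
      from L2_small_cong[OF * this] show "L2_small a b ?F (\<lambda>s. s - t) (\<lambda>s x. ?g s x $ i)" .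
    next
      assume "L2_small a b ?F (\<lambda>s. s - t) (\<lambda>s x. ?g s x $ i)"
      from L2_small_cong[OF this eq[OF that]]
      show "L2_small a b ?F (\<lambda>s. s - t) (\<lambda>s x. snd (v s) x $ i - snd (v t) x $ i - (s - t) * snd w x $ i)" .
    qed
    then show ?thesis by simp
  qed
  finally show ?thesis .
qed

text \<open>With r = s - t the left side is the remainder in a derivative: the remainder of a Taylor
  form is the Taylor form of the remainders of its data.\<close>

lemma reconstruction_linear:
  assumes "c1 \<in> carrier_vec (2 * n)" "c2 \<in> carrier_vec (2 * n)" "c3 \<in> carrier_vec (2 * n)"
    and w: "w1 \<in> L2_vec a b n" "w2 \<in> L2_vec a b n" "w3 \<in> L2_vec a b n" and x: "x \<in> {a..b}"
  shows "reconstruction a n c1 w1 x - reconstruction a n c2 w2 x - r \<cdot>\<^sub>v reconstruction a n c3 w3 x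
    = reconstruction a n (c1 - c2 - r \<cdot>\<^sub>v c3) (\<lambda>x. w1 x - w2 x - r \<cdot>\<^sub>v w3 x) x"
proof (rule eq_vecI)
  fix i assume "i < dim_vec (reconstruction a n (c1 - c2 - r \<cdot>\<^sub>v c3) (\<lambda>x. w1 x - w2 x - r \<cdot>\<^sub>v w3 x) x)"
  then have i: "i < n" by (simp add: reconstruction_def)
  have sub: "{a..x} \<subseteq> {a..b}" using x by auto
  have int: "integrable (lebesgue_on {a..x}) (\<lambda>t. (x - t) * w t $ i)" if "w \<in> L2_vec a b n" for w
    by (intro square_integrable_integrable square_integrable_continuous_mult continuous_intros
        square_integrable_mono[OF L2_vec_square_integrable[OF that i] sub])
  have "(\<integral>t. (x - t) * (w1 t - w2 t - r \<cdot>\<^sub>v w3 t) $ i \<partial>lebesgue_on {a..x})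
      = (\<integral>t. (x - t) * w1 t $ i - (x - t) * w2 t $ i - r * ((x - t) * w3 t $ i) \<partial>lebesgue_on {a..x})"
  proof (rule integral_interval_cong)
    fix t assume "t \<in> {a..x}"
    then have "dim_vec (w2 t) = n" "dim_vec (w3 t) = n"
      using sub L2_vec_carrier[OF w(2)] L2_vec_carrier[OF w(3)] by (auto dest!: subsetD)
    then show "(x - t) * (w1 t - w2 t - r \<cdot>\<^sub>v w3 t) $ i
        = (x - t) * w1 t $ i - (x - t) * w2 t $ i - r * ((x - t) * w3 t $ i)"
      using i by (simp add: algebra_simps)
  qed
  also have "\<dots> = (\<integral>t. (x - t) * w1 t $ i \<partial>lebesgue_on {a..x}) - (\<integral>t. (x - t) * w2 t $ i \<partial>lebesgue_on {a..x})
      - r * (\<integral>t. (x - t) * w3 t $ i \<partial>lebesgue_on {a..x})"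
    using int[OF w(1)] int[OF w(2)] int[OF w(3)] by simp
  finally have I: "(\<integral>t. (x - t) * (w1 t - w2 t - r \<cdot>\<^sub>v w3 t) $ i \<partial>lebesgue_on {a..x})
      = (\<integral>t. (x - t) * w1 t $ i \<partial>lebesgue_on {a..x}) - (\<integral>t. (x - t) * w2 t $ i \<partial>lebesgue_on {a..x})
      - r * (\<integral>t. (x - t) * w3 t $ i \<partial>lebesgue_on {a..x})" .
  have c: "(c1 - c2 - r \<cdot>\<^sub>v c3) $ j = c1 $ j - c2 $ j - r * c3 $ j" if "j < 2 * n" for j
    using that assms(1-3) by simp
  have d: "dim_vec (reconstruction a n c w x) = n" for c w by (simp add: reconstruction_def)
  have l: "(reconstruction a n c1 w1 x - reconstruction a n c2 w2 x - r \<cdot>\<^sub>v reconstruction a n c3 w3 x) $ i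
      = reconstruction a n c1 w1 x $ i - reconstruction a n c2 w2 x $ i - r * reconstruction a n c3 w3 x $ i"
    using i by (simp add: d del: reconstruction_index)
  have "p + e * q + A - (p' + e * q' + B) - r * (p'' + e * q'' + D)
      = (p - p' - r * p'') + e * (q - q' - r * q'') + (A - B - r * D)" for p q A p' q' B p'' q'' D e :: real
    by (simp add: algebra_simps)
  then show "(reconstruction a n c1 w1 x - reconstruction a n c2 w2 x - r \<cdot>\<^sub>v reconstruction a n c3 w3 x) $ i
      = reconstruction a n (c1 - c2 - r \<cdot>\<^sub>v c3) (\<lambda>x. w1 x - w2 x - r \<cdot>\<^sub>v w3 x) x $ i"
    using i by (simp only: l reconstruction_index(1)[OF i] I c[of i] c[of "n + i"])
qed (simp add: reconstruction_def)

text \<open>The chosen derivatives inside \<open>W22_norm\<close> are exchanged for the explicit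
  ones of a Taylor form, which for each s is a change on a null set.\<close>

lemma W22_norm_small_iff:
  assumes ab: "a < b" and ev: "\<forall>\<^sub>F s in \<F>. f s \<in> L2_vec a b n \<and> d s \<in> L2_vec a b n \<and> ae_eq a b (f s) (reconstruction a n (c s) (d s))"
  shows "((\<lambda>s. W22_norm a b n (f s) / \<bar>r s\<bar>) \<longlongrightarrow> 0) \<F> \<longleftrightarrow>
    (\<forall>i<n. L2_small a b \<F> r (\<lambda>s x. f s x $ i)) \<and>
    (\<forall>i<n. L2_small a b \<F> r (\<lambda>s x. reconstruction_deriv a n (c s) (d s) x $ i)) \<and>
    (\<forall>i<n. L2_small a b \<F> r (\<lambda>s x. d s x $ i))"
proof -
  have swap: "(\<forall>i<n. L2_small a b \<F> r (\<lambda>s x. g s x $ i)) \<longleftrightarrow> (\<forall>i<n. L2_small a b \<F> r (\<lambda>s x. h s x $ i))"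
    if "\<forall>\<^sub>F s in \<F>. ae_eq a b (g s) (h s)" for g h
  proof -
    have 1: "\<forall>\<^sub>F s in \<F>. AE x in lebesgue_on {a..b}. g s x $ i = h s x $ i" for i
      using that by eventually_elim (rule ae_eqD)
    have 2: "\<forall>\<^sub>F s in \<F>. AE x in lebesgue_on {a..b}. h s x $ i = g s x $ i" for i
      using that by eventually_elim (rule ae_eqD[OF ae_eq_sym])
    show ?thesis using L2_small_AE[OF _ 1] L2_small_AE[OF _ 2] by blast
  qed
  have e0: "\<forall>\<^sub>F s in \<F>. f s \<in> L2_vec a b n" using ev by eventually_elim simp
  have e1: "\<forall>\<^sub>F s in \<F>. weak_deriv a b n (f s) \<in> L2_vec a b n"
    using ev by eventually_elim (blast intro: weak_deriv_L2[OF ab])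
  have e2: "\<forall>\<^sub>F s in \<F>. weak_deriv2 a b n (f s) \<in> L2_vec a b n"
    using ev by eventually_elim (blast intro: weak_deriv2_L2[OF ab])
  have a1: "\<forall>\<^sub>F s in \<F>. ae_eq a b (weak_deriv a b n (f s)) (reconstruction_deriv a n (c s) (d s))"
    using ev by eventually_elim (blast intro: ae_eq_weak_deriv[OF ab])
  have a2: "\<forall>\<^sub>F s in \<F>. ae_eq a b (weak_deriv2 a b n (f s)) (d s)"
    using ev by eventually_elim (blast intro: ae_eq_weak_deriv2[OF ab])
  show ?thesis
    unfolding W22_norm_def
    by (subst sqrt_small_iff, simp, subst add_small_iff, simp, simp, subst add_small_iff, simp, simp)
      (simp only: L2_norm_small_iff[OF e0] L2_norm_small_iff[OF e1] L2_norm_small_iff[OF e2]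
        swap[OF a1] swap[OF a2] conj_assoc)
qed

subsection \<open>Equivalence of the two evolution equations\<close>

text \<open>w enters only under an integral, so a change on a null set leaves the value at every
  single x unaltered.\<close>

lemma reconstruction_ae_cong:
  assumes w: "w \<in> L2_vec a b n" and w': "w' \<in> L2_vec a b n" and ae: "ae_eq a b w w'" and x: "x \<in> {a..b}"
  shows "reconstruction a n c w x = reconstruction a n c w' x"
proof (rule eq_vecI)
  fix i assume "i < dim_vec (reconstruction a n c w' x)"
  then have i: "i < n" by (simp add: reconstruction_def)
  have sub: "{a..x} \<subseteq> {a..b}" using x by auto
  have int: "integrable (lebesgue_on {a..x}) (\<lambda>t. (x - t) * w t $ i)" if "w \<in> L2_vec a b n" for w
    by (intro square_integrable_integrable square_integrable_continuous_mult continuous_intros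
        square_integrable_mono[OF L2_vec_square_integrable[OF that i] sub])
  have "AE t in lebesgue_on {a..x}. (x - t) * w t $ i = (x - t) * w' t $ i"
    using ae_eqD[OF ae, of i] sub by (auto simp: AE_restrict_space_iff elim!: eventually_mono)
  then have "(\<integral>t. (x - t) * w t $ i \<partial>lebesgue_on {a..x}) = (\<integral>t. (x - t) * w' t $ i \<partial>lebesgue_on {a..x})"
    using int[OF w] int[OF w'] by (intro integral_cong_AE borel_measurable_integrable)
  then show "reconstruction a n c w x $ i = reconstruction a n c w' x $ i" using i by simp
qed (simp add: reconstruction_def)

context boundary_data
begin

section \<open>T and D as mutually inverse maps between the state spaces\<close>

lemma RL2D: "v \<in> RL2 a b m n \<Longrightarrow> fst v \<in> carrier_vec m" "v \<in> RL2 a b m n \<Longrightarrow> snd v \<in> L2_vec a b n"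
  by (auto simp: RL2_def)

lemma T_op_L2: "v \<in> RL2 a b m n \<Longrightarrow> Top v \<in> L2_vec a b n"
  by (rule L2_vec_ae_eq[OF reconstruction_L2(1)[OF RL2D(2)] ae_eq_on_interval]) (simp_all add: T_op_eq)

lemma R_op_L2: "v \<in> RL2 a b m n \<Longrightarrow> Rop v \<in> L2_vec a b n"
  by (rule L2_vec_ae_eq[OF reconstruction_L2(2)[OF RL2D(2)] ae_eq_on_interval]) (simp_all add: R_op_eq)

lemma T_op_weak_derivs:
  assumes v: "v \<in> RL2 a b m n"
  shows T_op_W22: "Top v \<in> W22 a b n"
    and T_op_weak_deriv: "ae_eq a b (weak_deriv a b n (Top v)) (Rop v)"
    and T_op_weak_deriv2: "ae_eq a b (weak_deriv2 a b n (Top v)) (snd v)"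
proof -
  note W = W22_weak_derivs[OF ab T_op_L2[OF v] RL2D(2)[OF v] ae_eq_on_interval[OF T_op_eq[OF v]]]
  show "Top v \<in> W22 a b n" "ae_eq a b (weak_deriv2 a b n (Top v)) (snd v)"
    using W by auto
  show "ae_eq a b (weak_deriv a b n (Top v)) (Rop v)"
    by (rule ae_eq_trans[OF W(2) ae_eq_sym[OF ae_eq_on_interval[OF R_op_eq[OF v]]]])
qed

lemma F_op_cong: "u \<in> L2_vec a b n \<Longrightarrow> v \<in> L2_vec a b n \<Longrightarrow> ae_eq a b u v \<Longrightarrow> Fop u = Fop v"
  unfolding F_op_def by (rule vec_integral_mult_ae_eq[OF F3])

lemma F_op_carrier [simp]: "Fop u \<in> carrier_vec m"
  by (simp add: F_op_def)

text \<open>G_hat c - \<integral> H_hat v1 has two expressions, one ending in v0 by the choice of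
  \<open>coef\<close> and one ending in F (T v). Comparing the last m entries gives the claim for
  every state.\<close>

lemma F_op_T_op:
  assumes v: "v \<in> RL2 a b m n"
  shows "Fop (Top v) = fst v"
proof -
  have "Fop (Top v) = Fop (reconstruction a n (coef v) (snd v))"
    by (rule F_op_cong[OF T_op_L2[OF v] reconstruction_L2(1)[OF RL2D(2)[OF v]]])
      (rule ae_eq_on_interval[OF T_op_eq[OF v]])
  moreover obtain p where "p \<in> carrier_vec (2 * n - m)"
    "0\<^sub>v (2 * n - m) @\<^sub>v fst v = p @\<^sub>v Fop (reconstruction a n (coef v) (snd v))"
    using boundary_value_F_op[OF coef_carrier[OF v] RL2D(2)[OF v]] GG_coef[OF v] by auto
  ultimately show ?thesis using append_vec_eq[of "0\<^sub>v (2 * n - m)" "2 * n - m" p] by auto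
qed

lemma T_op_in_X_space:
  assumes "v \<in> Y"
  shows "Top v \<in> X"
proof -
  have v: "v \<in> RL2 a b m n" and K: "Kop v = 0\<^sub>v m" using assms by (auto simp: Y_space_def)
  then have "coef (Fop (Top v), snd v) = coef v" "Kop (undefined, snd v) = 0\<^sub>v m"
    by (simp_all add: F_op_T_op K_op_def)
  then show ?thesis
    using X_space_iff[OF coef_carrier[OF v] RL2D(2)[OF v] T_op_L2[OF v] ae_eq_on_interval[OF T_op_eq[OF v]], of undefined]
    by blast
qed

text \<open>u has a Taylor form with some c and with w = u_xx, and the boundary condition forces c =
  \<open>coef (Dop u)\<close>. Hence T rebuilds the same Taylor form from D u.\<close>

lemma X_spaceD:
  assumes u: "u \<in> X"
  shows X_space_L2: "u \<in> L2_vec a b n"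
    and D_op_Y_space: "Dop u \<in> Y"
    and T_op_D_op: "ae_eq a b (Top (Dop u)) u"
    and R_op_D_op: "ae_eq a b (Rop (Dop u)) (weak_deriv a b n u)"
proof -
  have "u \<in> W22 a b n" using u by (simp add: X_space_def)
  then obtain c where c: "c \<in> carrier_vec (2 * n)"
    and ae: "ae_eq a b u (reconstruction a n c (weak_deriv2 a b n u))"
    and w: "weak_deriv2 a b n u \<in> L2_vec a b n" and uL2: "u \<in> L2_vec a b n"
    using W22_reconstruction[OF ab] by blast
  show "u \<in> L2_vec a b n" by (rule uL2)
  have co: "coef (Dop u) = c" and K: "Kop (Dop u) = 0\<^sub>v m"
    using X_space_iff[OF c w uL2 ae, of "Fop u"] u by (simp_all add: D_op_def)
  have D: "Dop u \<in> RL2 a b m n" using w by (simp add: D_op_def RL2_def)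
  then show "Dop u \<in> Y" using K by (simp add: Y_space_def)
  have "Top (Dop u) x = reconstruction a n c (weak_deriv2 a b n u) x" if "x \<in> {a..b}" for x
    using T_op_eq[OF D that] co by (simp add: D_op_def)
  then show "ae_eq a b (Top (Dop u)) u"
    using ae_eq_trans[OF ae_eq_on_interval ae_eq_sym[OF ae]] by blast
  have "Rop (Dop u) x = reconstruction_deriv a n c (weak_deriv2 a b n u) x" if "x \<in> {a..b}" for x
    using R_op_eq[OF D that] co by (simp add: D_op_def)
  then show "ae_eq a b (Rop (Dop u)) (weak_deriv a b n u)"
    using ae_eq_trans[OF ae_eq_on_interval ae_eq_sym[OF ae_eq_weak_deriv[OF ab uL2 w ae]]] by blast
qed

section \<open>Continuity of the Cauchy data as functions of the state\<close>

lemma HH_entry: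
  assumes "k < 2 * n" "j < n"
  shows "square_integrable a b (\<lambda>x. HH x $$ (k, j))"
proof -
  \<comment> \<open>An entry of the kernel is read off by applying it to a constant unit vector,
    whose image is already known to be square-integrable.\<close>
  have "square_integrable a b (\<lambda>x. (HH x *\<^sub>v unit_vec n j) $ k)"
    by (rule L2_vec_square_integrable[OF HHw_L2[OF L2_vec_const] assms(1)]) simp
  moreover have "(HH x *\<^sub>v unit_vec n j) $ k = HH x $$ (k, j)" for x
    using carrier_matD[OF HH_carrier[of x]] assms by simp
  ultimately show ?thesis by simp
qed

lemma HH_L2: "HH \<in> L2_mat a b (2 * n) n"
  using HH_entry HH_carrier by (simp add: L2_mat_def)

lemma coef_cong:
  assumes v: "v \<in> RL2 a b m n" and v': "v' \<in> RL2 a b m n"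
    and "fst v = fst v'" "ae_eq a b (snd v) (snd v')"
  shows "coef v = coef v'"
  unfolding coef_def vec_integral_mult_ae_eq[OF HH_L2 RL2D(2)[OF v] RL2D(2)[OF v'] assms(4)] assms(3) ..

text \<open>Written out, each entry of the Cauchy data is a finite linear combination of entries of
  v0 and of integrals of v1 against the fixed square-integrable entries of
  \<open>HH\<close>.\<close>

lemma coef_index:
  assumes v: "v \<in> RL2 a b m n" and i: "i < 2 * n"
  shows "coef v $ i = (\<Sum>k<2 * n. GI $$ (i, k) *
    ((if k < 2 * n - m then 0 else fst v $ (k - (2 * n - m)))
      + (\<Sum>j<n. \<integral>x. HH x $$ (k, j) * snd v x $ j \<partial>lebesgue_on {a..b})))"
proof -
  let ?p = "0\<^sub>v (2 * n - m) @\<^sub>v fst v" and ?I = "vec_integral a b (2 * n) (\<lambda>x. HH x *\<^sub>v snd v x)"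
  have p: "?p \<in> carrier_vec (2 * n)" by (rule pad_carrier[OF RL2D(1)[OF v]])
  have I: "?I $ k = (\<Sum>j<n. \<integral>x. HH x $$ (k, j) * snd v x $ j \<partial>lebesgue_on {a..b})" if k: "k < 2 * n" for k
  proof -
    have "?I $ k = (\<integral>x. (\<Sum>j<n. HH x $$ (k, j) * snd v x $ j) \<partial>lebesgue_on {a..b})"
      unfolding vec_integral_index[OF k]
      by (intro integral_interval_cong mult_mat_vec_index_sum[OF HH_carrier L2_vec_carrier[OF RL2D(2)[OF v]] k])
    also have "\<dots> = (\<Sum>j<n. \<integral>x. HH x $$ (k, j) * snd v x $ j \<partial>lebesgue_on {a..b})"
      by (intro Bochner_Integration.integral_sum square_integrable_integrable_mult HH_entry k
          L2_vec_square_integrable[OF RL2D(2)[OF v]]) auto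
    finally show ?thesis .
  qed
  have pk: "?p $ k = (if k < 2 * n - m then 0 else fst v $ (k - (2 * n - m)))" if "k < 2 * n" for k
    using that carrier_vecD[OF p] carrier_vecD[OF RL2D(1)[OF v]] row_sum by auto
  have "coef v $ i = (\<Sum>k<2 * n. GI $$ (i, k) * (?p + ?I) $ k)"
    unfolding coef_def by (rule mult_mat_vec_index_sum[OF GI(1) _ i]) (use p in simp)
  also have "\<dots> = (\<Sum>k<2 * n. GI $$ (i, k) * (?p $ k + ?I $ k))"
    by (rule sum.cong) simp_all
  also have "\<dots> = (\<Sum>k<2 * n. GI $$ (i, k) *
    ((if k < 2 * n - m then 0 else fst v $ (k - (2 * n - m)))
      + (\<Sum>j<n. \<integral>x. HH x $$ (k, j) * snd v x $ j \<partial>lebesgue_on {a..b})))"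
    by (intro sum.cong refl) (simp only: I pk lessThan_iff)
  finally show ?thesis .
qed

text \<open>Every term of that finite combination is a bounded linear functional of the state, so it
  sends first-order remainders to first-order remainders.\<close>

lemma coef_small:
  assumes v: "\<And>s. 0 \<le> s \<Longrightarrow> v s \<in> RL2 a b m n" and w: "w \<in> RL2 a b m n" and t: "0 \<le> t"
    and d: "has_RL2_deriv a b m n v w t" and i: "i < 2 * n"
  shows "((\<lambda>s. (coef (v s) $ i - coef (v t) $ i - (s - t) * coef w $ i) / (s - t)) \<longlongrightarrow> 0) (at t within {0..})"
proof -
  let ?F = "at t within {0..}"
  let ?e = "\<lambda>s k. fst (v s) $ k - fst (v t) $ k - (s - t) * fst w $ k"
  let ?d = "\<lambda>s x j. snd (v s) x $ j - snd (v t) x $ j - (s - t) * snd w x $ j"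
  let ?l = "2 * n - m"
  have D: "(\<forall>i<m. ((\<lambda>s. ?e s i / (s - t)) \<longlongrightarrow> 0) ?F) \<and> (\<forall>j<n. L2_small a b ?F (\<lambda>s. s - t) (\<lambda>s x. ?d s x j))"
    by (rule iffD1[OF has_RL2_deriv_iff d]) (use v w t in auto)
  have ev: "\<forall>\<^sub>F s in ?F. 0 \<le> s" by (simp add: eventually_at_filter)
  have e: "((\<lambda>s. (if k < ?l then 0 else ?e s (k - ?l)) / (s - t)) \<longlongrightarrow> 0) ?F" if "k < 2 * n" for k
  proof (cases "k < ?l")
    case False
    then have "k - ?l < m" using that m_le by linarith
    then have "((\<lambda>s. ?e s (k - ?l) / (s - t)) \<longlongrightarrow> 0) ?F" using D by blast
    then show ?thesis using False by simp
  qed simp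
  have h: "((\<lambda>s. (\<integral>x. HH x $$ (k, j) * ?d s x j \<partial>lebesgue_on {a..b}) / (s - t)) \<longlongrightarrow> 0) ?F"
    if "k < 2 * n" "j < n" for k j
    using D that by (intro L2_small_functional HH_entry) auto
  have "((\<lambda>s. \<Sum>k<2 * n. GI $$ (i, k) * ((if k < ?l then 0 else ?e s (k - ?l)) / (s - t)
      + (\<Sum>j<n. (\<integral>x. HH x $$ (k, j) * ?d s x j \<partial>lebesgue_on {a..b}) / (s - t)))) \<longlongrightarrow>
      (\<Sum>k<2 * n. GI $$ (i, k) * (0 + (\<Sum>j<n. 0)))) ?F"
    by (intro tendsto_sum tendsto_mult_left tendsto_add e h) auto
  then have "((\<lambda>s. \<Sum>k<2 * n. GI $$ (i, k) * ((if k < ?l then 0 else ?e s (k - ?l)) / (s - t)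
      + (\<Sum>j<n. (\<integral>x. HH x $$ (k, j) * ?d s x j \<partial>lebesgue_on {a..b}) / (s - t)))) \<longlongrightarrow> 0) ?F"
    by simp
  then show ?thesis
  proof (rule Lim_transform_eventually)
    show "\<forall>\<^sub>F s in ?F. (\<Sum>k<2 * n. GI $$ (i, k) * ((if k < ?l then 0 else ?e s (k - ?l)) / (s - t)
        + (\<Sum>j<n. (\<integral>x. HH x $$ (k, j) * ?d s x j \<partial>lebesgue_on {a..b}) / (s - t))))
      = (coef (v s) $ i - coef (v t) $ i - (s - t) * coef w $ i) / (s - t)"
      using ev
    proof eventually_elim
      case (elim s)
      let ?I = "\<lambda>k j u. \<integral>x. HH x $$ (k, j) * snd u x $ j \<partial>lebesgue_on {a..b}"
      have I: "(\<integral>x. HH x $$ (k, j) * ?d s x j \<partial>lebesgue_on {a..b}) = ?I k j (v s) - ?I k j (v t) - (s - t) * ?I k j w"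
        if "k < 2 * n" "j < n" for k j
      proof -
        have int: "integrable (lebesgue_on {a..b}) (\<lambda>x. HH x $$ (k, j) * snd u x $ j)" if "u \<in> RL2 a b m n" for u
          by (intro square_integrable_integrable_mult HH_entry L2_vec_square_integrable[OF RL2D(2)[OF that]])
            (fact \<open>k < 2 * n\<close> \<open>j < n\<close>)+
        have "(\<integral>x. HH x $$ (k, j) * ?d s x j \<partial>lebesgue_on {a..b})
            = (\<integral>x. HH x $$ (k, j) * snd (v s) x $ j - HH x $$ (k, j) * snd (v t) x $ j
                - (s - t) * (HH x $$ (k, j) * snd w x $ j) \<partial>lebesgue_on {a..b})"
          by (simp add: algebra_simps)
        then show ?thesis using int[OF v[OF elim]] int[OF v[OF t]] int[OF w] by simp
      qed
      have summand: "GI $$ (i, k) * ((if k < ?l then 0 else ?e s (k - ?l)) / (s - t)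
          + (\<Sum>j<n. (\<integral>x. HH x $$ (k, j) * ?d s x j \<partial>lebesgue_on {a..b}) / (s - t)))
        = (GI $$ (i, k) * ((if k < ?l then 0 else fst (v s) $ (k - ?l)) + (\<Sum>j<n. ?I k j (v s)))
          - GI $$ (i, k) * ((if k < ?l then 0 else fst (v t) $ (k - ?l)) + (\<Sum>j<n. ?I k j (v t)))
          - (s - t) * (GI $$ (i, k) * ((if k < ?l then 0 else fst w $ (k - ?l)) + (\<Sum>j<n. ?I k j w)))) / (s - t)"
        if k: "k < 2 * n" for k
      proof -
        have S: "(\<Sum>j<n. (\<integral>x. HH x $$ (k, j) * ?d s x j \<partial>lebesgue_on {a..b}) / (s - t))
            = ((\<Sum>j<n. ?I k j (v s)) - (\<Sum>j<n. ?I k j (v t)) - (s - t) * (\<Sum>j<n. ?I k j w)) / (s - t)"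
          by (simp add: I[OF k] sum_subtractf sum_distrib_left flip: sum_divide_distrib)
        \<comment> \<open>Linear rearrangement: p is the remainder of the padded finite-dimensional
          component, while A, B, D are the integral sums for \<open>v s\<close>, \<open>v t\<close>
          and \<open>w\<close>.\<close>
        have comb: "g * (p / r + (A - B - r * D) / r) = (g * (p1 + A) - g * (p2 + B) - r * (g * (p3 + D))) / r"
          if "p = p1 - p2 - r * p3" for g p r A B D p1 p2 p3 :: real
          unfolding that by (simp add: algebra_simps add_divide_distrib diff_divide_distrib)
        show ?thesis unfolding S by (rule comb) simp
      qed
      have sum_comb: "(\<Sum>k\<in>I. (p k - q k - r * z k) / r) = (sum p I - sum q I - r * sum z I) / r"
        for p q z :: "nat \<Rightarrow> real" and r I
        by (simp add: sum_subtractf sum_distrib_left flip: sum_divide_distrib)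
      show ?case
        unfolding coef_index[OF v[OF elim] i] coef_index[OF v[OF t] i] coef_index[OF w i]
        by (rule trans[OF sum.cong[OF refl summand] sum_comb]) simp
    qed
  qed
qed

text \<open>The remainder of T v is the Taylor form of the remainders of the Cauchy data and of v1.
  Both are small, and primitives preserve smallness, so the function and its two derivatives are
  small. The L2 part is stated separately, to be compared later with another derivative of T
  v.\<close>

lemma T_op_deriv:
  assumes v: "\<And>s. 0 \<le> s \<Longrightarrow> v s \<in> RL2 a b m n" and w: "w \<in> RL2 a b m n" and t: "0 \<le> t"
    and d: "has_RL2_deriv a b m n v w t"
  shows T_op_W22_deriv: "has_W22_deriv a b n (\<lambda>s. Top (v s)) (Top w) t"
    and T_op_small: "\<And>i. i < n \<Longrightarrow> L2_small a b (at t within {0..}) (\<lambda>s. s - t)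
      (\<lambda>s x. (Top (v s) x - Top (v t) x - (s - t) \<cdot>\<^sub>v Top w x) $ i)"
proof -
  let ?F = "at t within {0..}" and ?r = "\<lambda>s. s - t"
  define c where "c s = coef (v s) - coef (v t) - (s - t) \<cdot>\<^sub>v coef w" for s
  define e where "e s = (\<lambda>x. snd (v s) x - snd (v t) x - (s - t) \<cdot>\<^sub>v snd w x)" for s
  define f where "f s = (\<lambda>x. Top (v s) x - Top (v t) x - (s - t) \<cdot>\<^sub>v Top w x)" for s
  have ev: "\<forall>\<^sub>F s in ?F. 0 \<le> s" by (simp add: eventually_at_filter)
  have eL2: "e s \<in> L2_vec a b n" if "0 \<le> s" for s
    unfolding e_def by (intro L2_vec_diff L2_vec_continuous_smult RL2D(2) v that t w continuous_on_const)
  have fL2: "f s \<in> L2_vec a b n" if "0 \<le> s" for s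
    unfolding f_def by (intro L2_vec_diff L2_vec_continuous_smult T_op_L2 v that t w continuous_on_const)
  have f_eq: "f s x = reconstruction a n (c s) (e s) x" if "0 \<le> s" "x \<in> {a..b}" for s x
    unfolding f_def c_def e_def T_op_eq[OF v[OF that(1)] that(2)] T_op_eq[OF v[OF t] that(2)] T_op_eq[OF w that(2)]
    by (intro reconstruction_linear[where b = b] coef_carrier RL2D(2) v that t w)
  have c_small: "((\<lambda>s. c s $ i / (s - t)) \<longlongrightarrow> 0) ?F" if "i < 2 * n" for i
  proof -
    have "c s $ i = coef (v s) $ i - coef (v t) $ i - (s - t) * coef w $ i" for s
      using that carrier_vecD[OF coef_carrier[OF v[OF t]]] carrier_vecD[OF coef_carrier[OF w]] by (simp add: c_def)
    then show ?thesis using coef_small[OF v w t d that] by simp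
  qed
  have e_small: "L2_small a b ?F ?r (\<lambda>s x. e s x $ i)" if i: "i < n" for i
  proof (rule L2_small_cong)
    show "L2_small a b ?F ?r (\<lambda>s x. snd (v s) x $ i - snd (v t) x $ i - (s - t) * snd w x $ i)"
      using iffD1[OF has_RL2_deriv_iff d] v w t i by blast
    show "\<forall>\<^sub>F s in ?F. \<forall>x\<in>{a..b}. snd (v s) x $ i - snd (v t) x $ i - (s - t) * snd w x $ i = e s x $ i"
    proof (intro always_eventually allI ballI)
      fix s x assume "x \<in> {a..b}"
      then have "dim_vec (snd w x) = n" "dim_vec (snd (v t) x) = n"
        using L2_vec_carrier[OF RL2D(2)[OF w]] L2_vec_carrier[OF RL2D(2)[OF v[OF t]]] by auto
      then show "snd (v s) x $ i - snd (v t) x $ i - (s - t) * snd w x $ i = e s x $ i"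
        using i by (simp add: e_def)
    qed
  qed
  have rd_small: "L2_small a b ?F ?r (\<lambda>s x. reconstruction_deriv a n (c s) (e s) x $ i)" if i: "i < n" for i
  proof -
    \<comment> \<open>The constant is a scalar remainder times the function 1, the shape that
      \<open>L2_small_scaled\<close> expects.\<close>
    have "L2_small a b ?F ?r (\<lambda>s x. c s $ (n + i) * 1 + (\<integral>t. e s t $ i \<partial>lebesgue_on {a..x}))"
      using i by (intro L2_small_add L2_small_scaled L2_small_primitive e_small c_small ab square_integrable_const) simp_all
    then show ?thesis using i by simp
  qed
  have f_small: "L2_small a b ?F ?r (\<lambda>s x. f s x $ i)" if i: "i < n" for i
  proof -
    \<comment> \<open>The Volterra term appears as a repeated primitive, so that boundedness of
      primitives applies twice.\<close>
    have "L2_small a b ?F ?r (\<lambda>s x. c s $ i * 1 + c s $ (n + i) * (x - a)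
        + (\<integral>t. (\<integral>z. e s z $ i \<partial>lebesgue_on {a..t}) \<partial>lebesgue_on {a..x}))"
      using i by (intro L2_small_add L2_small_scaled L2_small_primitive e_small c_small ab square_integrable_const
          square_integrable_continuous continuous_intros) simp_all
    then show ?thesis
    proof (rule L2_small_cong)
      show "\<forall>\<^sub>F s in ?F. \<forall>x\<in>{a..b}. c s $ i * 1 + c s $ (n + i) * (x - a)
        + (\<integral>t. (\<integral>z. e s z $ i \<partial>lebesgue_on {a..t}) \<partial>lebesgue_on {a..x}) = f s x $ i"
        using ev
      proof (eventually_elim, intro ballI)
        fix s x :: real assume s: "0 \<le> s" and x: "x \<in> {a..b}"
        then have "{a..x} \<subseteq> {a..b}" by auto
        from integral_primitive_left[OF integrable_interval_mono[OF L2_vec_integrable[OF eL2[OF s] i] this]]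
        show "c s $ i * 1 + c s $ (n + i) * (x - a)
          + (\<integral>t. (\<integral>z. e s z $ i \<partial>lebesgue_on {a..t}) \<partial>lebesgue_on {a..x}) = f s x $ i"
          unfolding f_eq[OF s x] using i by simp
      qed
    qed
  qed
  show "L2_small a b ?F ?r (\<lambda>s x. (Top (v s) x - Top (v t) x - (s - t) \<cdot>\<^sub>v Top w x) $ i)" if "i < n" for i
    using f_small[OF that] by (simp only: f_def)
  have "\<forall>\<^sub>F s in ?F. f s \<in> L2_vec a b n \<and> e s \<in> L2_vec a b n \<and> ae_eq a b (f s) (reconstruction a n (c s) (e s))"
    using ev by eventually_elim (auto intro: fL2 eL2 ae_eq_on_interval f_eq)
  then have "((\<lambda>s. W22_norm a b n (f s) / \<bar>s - t\<bar>) \<longlongrightarrow> 0) ?F"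
    by (subst W22_norm_small_iff[OF ab]) (use f_small rd_small e_small in auto)
  then show "has_W22_deriv a b n (\<lambda>s. Top (v s)) (Top w) t"
    using T_op_W22[OF w] by (simp add: has_W22_deriv_def f_def)
qed

section \<open>Transfer of solutions between the two equations\<close>

lemma A_op_L2:
  assumes v: "v \<in> RL2 a b m n" and A: "A0 \<in> carrier_mat n n" "A1 \<in> carrier_mat n n" "A2 \<in> carrier_mat n n"
  shows "Aop A0 A1 A2 v \<in> L2_vec a b n"
  unfolding A_op_def[abs_def]
  by (intro L2_vec_add L2_vec_mult_continuous[where k = n] T_op_L2 R_op_L2 RL2D(2) v eval_pmat_carrier
      continuous_eval_pmat[where r = n and k = n] A)

lemma A_op_ae_eq:
  assumes "ae_eq a b (Top v) u" "ae_eq a b (Rop v) u_x" "ae_eq a b (snd v) u_xx"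
  shows "ae_eq a b (Aop A0 A1 A2 v)
    (\<lambda>x. eval_pmat A0 x *\<^sub>v u x + eval_pmat A1 x *\<^sub>v u_x x + eval_pmat A2 x *\<^sub>v u_xx x)"
  using assms unfolding ae_eq_def by eventually_elim (simp add: A_op_def)

text \<open>The norm of W22 controls the second derivative of the remainder of u, so u_xx is
  differentiable in L2; F u is differentiable as an L2 functional. For the equation, T (D u) = u
  almost everywhere, so T_hat (D u) has derivative (F u_t, u_t), and the PDE says that u_t = A (D
  u).\<close>

lemma pde_solution_imp_pie_solution:
  assumes A: "A0 \<in> carrier_mat n n" "A1 \<in> carrier_mat n n" "A2 \<in> carrier_mat n n"
    and sol: "pde_solution a b n A0 A1 A2 E F u u0"
  shows "pie_solution a b m n (That) (Ahat A0 A1 A2) Kop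
      (\<lambda>t. Dop (u t)) (Dop u0)"
proof -
  have u0: "u0 \<in> X" and init: "ae_eq a b (u 0) u0" and uX: "\<And>t. 0 \<le> t \<Longrightarrow> u t \<in> X"
    using sol by (auto simp: pde_solution_def)
  have D_RL2: "Dop f \<in> RL2 a b m n" if "f \<in> X" for f
    using D_op_Y_space[OF that] by (simp add: Y_space_def)
  have fst_0: "fst (Dop (u 0)) = fst (Dop u0)"
    using F_op_cong[OF X_space_L2[OF uX] X_space_L2[OF u0] init] by (simp add: D_op_def)
  have snd_0: "ae_eq a b (snd (Dop (u 0))) (snd (Dop u0))"
  proof -
    \<comment> \<open>The second derivatives of two almost everywhere equal functions are compared
      through the Taylor form of one of them.\<close>
    obtain c where "ae_eq a b u0 (reconstruction a n c (weak_deriv2 a b n u0))" "weak_deriv2 a b n u0 \<in> L2_vec a b n"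
      using W22_reconstruction[OF ab] u0 unfolding X_space_def by blast
    then show ?thesis
      using ae_eq_weak_deriv2[OF ab X_space_L2[OF uX] _ ae_eq_trans[OF init]] by (simp add: D_op_def)
  qed
  have step: "(\<exists>v_t. has_RL2_deriv a b m n (\<lambda>s. Dop (u s)) v_t t) \<and>
      has_RL2_deriv a b m n (\<lambda>s. That (Dop (u s))) (Ahat A0 A1 A2 (Dop (u t))) t"
    if t: "0 \<le> t" for t
  proof -
    let ?F = "at t within {0..}" and ?r = "\<lambda>s. s - t"
    let ?A = "Aop A0 A1 A2 (Dop (u t))"
    have ev: "\<forall>\<^sub>F s in ?F. 0 \<le> s" by (simp add: eventually_at_filter)
    obtain u_t where d: "has_W22_deriv a b n u u_t t"
      and eq: "ae_eq a b u_t (\<lambda>x. eval_pmat A0 x *\<^sub>v u t x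
             + eval_pmat A1 x *\<^sub>v weak_deriv a b n (u t) x + eval_pmat A2 x *\<^sub>v weak_deriv2 a b n (u t) x)"
      using sol t by (auto simp: pde_solution_def)
    have utW: "u_t \<in> W22 a b n" using d by (simp add: has_W22_deriv_def)
    obtain c' where c': "c' \<in> carrier_vec (2 * n)" and ae': "ae_eq a b u_t (reconstruction a n c' (weak_deriv2 a b n u_t))"
      and w': "weak_deriv2 a b n u_t \<in> L2_vec a b n" and utL2: "u_t \<in> L2_vec a b n"
      by (rule W22_reconstruction[OF ab utW])
    have AL2: "?A \<in> L2_vec a b n" by (rule A_op_L2[OF D_RL2[OF uX[OF t]] A])
    have A_eq: "ae_eq a b ?A u_t"
      by (rule ae_eq_trans[OF A_op_ae_eq[OF T_op_D_op[OF uX[OF t]] R_op_D_op[OF uX[OF t]]] ae_eq_sym[OF eq]])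
        (simp add: D_op_def)
    define f where "f s = (\<lambda>x. u s x - u t x - (s - t) \<cdot>\<^sub>v u_t x)" for s
    define e where "e s = (\<lambda>x. weak_deriv2 a b n (u s) x - weak_deriv2 a b n (u t) x - (s - t) \<cdot>\<^sub>v weak_deriv2 a b n u_t x)" for s
    \<comment> \<open>For \<open>u_t\<close> only membership in W22 is given, not in X, so its
      Cauchy data \<open>c'\<close> come from its own Taylor form instead of
      \<open>coef\<close>.\<close>
    define c where "c s = coef (Dop (u s)) - coef (Dop (u t)) - (s - t) \<cdot>\<^sub>v c'" for s
    have wL2: "weak_deriv2 a b n g \<in> L2_vec a b n" if "g \<in> X" for g
      using D_RL2[OF that] by (simp add: RL2_def D_op_def)
    have fL2: "f s \<in> L2_vec a b n" if "0 \<le> s" for s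
      unfolding f_def by (intro L2_vec_diff L2_vec_continuous_smult X_space_L2 uX that t utL2 continuous_on_const)
    have eL2: "e s \<in> L2_vec a b n" if "0 \<le> s" for s
      unfolding e_def by (intro L2_vec_diff L2_vec_continuous_smult wL2 uX that t w' continuous_on_const)
    have f_eq: "ae_eq a b (f s) (reconstruction a n (c s) (e s))" if s: "0 \<le> s" for s
    proof -
      have T: "ae_eq a b (u s) (reconstruction a n (coef (Dop (u s))) (weak_deriv2 a b n (u s)))" if "0 \<le> s" for s
        using ae_eq_trans[OF ae_eq_sym[OF T_op_D_op[OF uX[OF that]]] ae_eq_on_interval[OF T_op_eq[OF D_RL2[OF uX[OF that]]]]]
        by (simp add: D_op_def)
      have "ae_eq a b (f s) (\<lambda>x. reconstruction a n (coef (Dop (u s))) (weak_deriv2 a b n (u s)) x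
          - reconstruction a n (coef (Dop (u t))) (weak_deriv2 a b n (u t)) x
          - (s - t) \<cdot>\<^sub>v reconstruction a n c' (weak_deriv2 a b n u_t) x)"
        using T[OF s] T[OF t] ae' unfolding ae_eq_def by eventually_elim (simp add: f_def)
      also have "ae_eq a b \<dots> (reconstruction a n (c s) (e s))"
        unfolding c_def e_def
        by (intro ae_eq_on_interval reconstruction_linear[where b = b] coef_carrier D_RL2 uX s t c' wL2 w')
      finally (ae_eq_trans) show ?thesis .
    qed
    have "((\<lambda>s. W22_norm a b n (f s) / \<bar>s - t\<bar>) \<longlongrightarrow> 0) ?F"
      using d by (simp add: has_W22_deriv_def f_def)
    moreover have "\<forall>\<^sub>F s in ?F. f s \<in> L2_vec a b n \<and> e s \<in> L2_vec a b n \<and> ae_eq a b (f s) (reconstruction a n (c s) (e s))"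
      using ev by eventually_elim (auto intro: fL2 eL2 f_eq)
    ultimately have f_small: "L2_small a b ?F ?r (\<lambda>s x. f s x $ i)" and e_small: "L2_small a b ?F ?r (\<lambda>s x. e s x $ i)"
      if "i < n" for i
      using W22_norm_small_iff[OF ab, where f = f and c = c and d = e and \<F> = ?F and r = ?r] that by blast+
    have F_small: "((\<lambda>s. (Fop (u s) $ i - Fop (u t) $ i - (s - t) * Fop u_t $ i) / (s - t)) \<longlongrightarrow> 0) ?F" if i: "i < m" for i
    proof -
      have "((\<lambda>s. \<Sum>j<n. (\<integral>x. F3 x $$ (i, j) * f s x $ j \<partial>lebesgue_on {a..b}) / (s - t)) \<longlongrightarrow> (\<Sum>j<n. 0)) ?F"
        by (intro tendsto_sum L2_small_functional f_small L2_mat_square_integrable[OF F3 i]) auto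
      then have "((\<lambda>s. \<Sum>j<n. (\<integral>x. F3 x $$ (i, j) * f s x $ j \<partial>lebesgue_on {a..b}) / (s - t)) \<longlongrightarrow> 0) ?F" by simp
      then show ?thesis
      proof (rule Lim_transform_eventually)
        show "\<forall>\<^sub>F s in ?F. (\<Sum>j<n. (\<integral>x. F3 x $$ (i, j) * f s x $ j \<partial>lebesgue_on {a..b}) / (s - t))
          = (Fop (u s) $ i - Fop (u t) $ i - (s - t) * Fop u_t $ i) / (s - t)"
          using ev
        proof eventually_elim
          case (elim s)
          note int = integrable_L2_mat_mult_vec[OF F3 _ i]
          have "(\<Sum>j<n. \<integral>x. F3 x $$ (i, j) * f s x $ j \<partial>lebesgue_on {a..b})
              = (\<integral>x. (\<Sum>j<n. F3 x $$ (i, j) * f s x $ j) \<partial>lebesgue_on {a..b})"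
            by (intro Bochner_Integration.integral_sum[symmetric] square_integrable_integrable_mult
                L2_mat_square_integrable[OF F3 i] L2_vec_square_integrable[OF fL2[OF elim]]) auto
          also have "\<dots> = (\<integral>x. (F3 x *\<^sub>v u s x) $ i - (F3 x *\<^sub>v u t x) $ i - (s - t) * (F3 x *\<^sub>v u_t x) $ i \<partial>lebesgue_on {a..b})"
          proof (rule integral_interval_cong)
            fix x assume x: "x \<in> {a..b}"
            note c = L2_vec_carrier[OF X_space_L2[OF uX[OF elim]] x] L2_vec_carrier[OF X_space_L2[OF uX[OF t]] x]
              L2_vec_carrier[OF utL2 x]
            note ix = mult_mat_vec_index_sum[OF L2_mat_carrier[OF F3 x] _ i]
            have "(\<Sum>j<n. F3 x $$ (i, j) * f s x $ j)
                = (\<Sum>j<n. F3 x $$ (i, j) * u s x $ j - F3 x $$ (i, j) * u t x $ j - (s - t) * (F3 x $$ (i, j) * u_t x $ j))"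
              using carrier_vecD[OF c(2)] carrier_vecD[OF c(3)]
              by (intro sum.cong) (simp_all add: f_def algebra_simps)
            then show "(\<Sum>j<n. F3 x $$ (i, j) * f s x $ j)
                = (F3 x *\<^sub>v u s x) $ i - (F3 x *\<^sub>v u t x) $ i - (s - t) * (F3 x *\<^sub>v u_t x) $ i"
              unfolding ix[OF c(1)] ix[OF c(2)] ix[OF c(3)] by (simp add: sum_subtractf sum_distrib_left)
          qed
          also have "\<dots> = Fop (u s) $ i - Fop (u t) $ i - (s - t) * Fop u_t $ i"
            using int[OF X_space_L2[OF uX[OF elim]]] int[OF X_space_L2[OF uX[OF t]]] int[OF utL2] i
            by (simp add: F_op_def del: index_mult_mat_vec)
          finally show ?case by (simp flip: sum_divide_distrib)
        qed
      qed
    qed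
    have "has_RL2_deriv a b m n (\<lambda>s. Dop (u s)) (Dop u_t) t"
    proof (subst has_RL2_deriv_iff)
      show "Dop u_t \<in> RL2 a b m n" using w' by (simp add: D_op_def RL2_def)
      have "L2_small a b ?F ?r (\<lambda>s x. weak_deriv2 a b n (u s) x $ i - weak_deriv2 a b n (u t) x $ i
          - (s - t) * weak_deriv2 a b n u_t x $ i)" if i: "i < n" for i
      proof (rule L2_small_cong[OF e_small[OF i]], intro always_eventually allI ballI)
        fix s x assume x: "x \<in> {a..b}"
        show "e s x $ i = weak_deriv2 a b n (u s) x $ i - weak_deriv2 a b n (u t) x $ i - (s - t) * weak_deriv2 a b n u_t x $ i"
          using i carrier_vecD[OF L2_vec_carrier[OF wL2[OF uX[OF t]] x]] carrier_vecD[OF L2_vec_carrier[OF w' x]]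
          by (simp add: e_def)
      qed
      with F_small show "(\<forall>i<m. ((\<lambda>s. (fst (Dop (u s)) $ i - fst (Dop (u t)) $ i - (s - t) * fst (Dop u_t) $ i) / (s - t)) \<longlongrightarrow> 0) ?F) \<and>
        (\<forall>i<n. L2_small a b ?F ?r (\<lambda>s x. snd (Dop (u s)) x $ i - snd (Dop (u t)) x $ i - (s - t) * snd (Dop u_t) x $ i))"
        by (simp add: D_op_def)
    qed (use D_RL2 uX t in auto)
    moreover have "has_RL2_deriv a b m n (\<lambda>s. That (Dop (u s))) (Ahat A0 A1 A2 (Dop (u t))) t"
    proof (subst has_RL2_deriv_iff)
      show "Ahat A0 A1 A2 (Dop (u t)) \<in> RL2 a b m n"
        using AL2 by (simp add: A_hat_def RL2_def)
      show "That (Dop (u s)) \<in> RL2 a b m n" if "0 \<le> s" for s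
        using T_op_L2[OF D_RL2[OF uX[OF that]]] by (simp add: T_hat_def RL2_def D_op_def)
      \<comment> \<open>F is insensitive to null sets, so the finite component of A_hat can be
        computed from \<open>u_t\<close>.\<close>
      have FA: "Fop ?A = Fop u_t" by (rule F_op_cong[OF AL2 utL2 A_eq])
      have "L2_small a b ?F ?r (\<lambda>s x. Top (Dop (u s)) x $ i - Top (Dop (u t)) x $ i - (s - t) * ?A x $ i)" if i: "i < n" for i
      proof (rule L2_small_AE[OF f_small[OF i]])
        show "\<forall>\<^sub>F s in ?F. AE x in lebesgue_on {a..b}. f s x $ i = Top (Dop (u s)) x $ i - Top (Dop (u t)) x $ i - (s - t) * ?A x $ i"
          using ev
        proof eventually_elim
          case (elim s)
          have "AE x in lebesgue_on {a..b}. dim_vec (u t x) = n \<and> dim_vec (u_t x) = n"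
            using carrier_vecD[OF L2_vec_carrier[OF X_space_L2[OF uX[OF t]]]] carrier_vecD[OF L2_vec_carrier[OF utL2]]
            by (intro AE_I2) simp
          then show ?case
            using T_op_D_op[OF uX[OF elim]] T_op_D_op[OF uX[OF t]] A_eq unfolding ae_eq_def
            by eventually_elim (use i in \<open>simp add: f_def\<close>)
        qed
      qed
      with F_small show "(\<forall>i<m. ((\<lambda>s. (fst (That (Dop (u s))) $ i - fst (That (Dop (u t))) $ i
            - (s - t) * fst (Ahat A0 A1 A2 (Dop (u t))) $ i) / (s - t)) \<longlongrightarrow> 0) ?F) \<and>
        (\<forall>i<n. L2_small a b ?F ?r (\<lambda>s x. snd (That (Dop (u s))) x $ i - snd (That (Dop (u t))) x $ i
            - (s - t) * snd (Ahat A0 A1 A2 (Dop (u t))) x $ i))"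
        unfolding T_hat_def A_hat_def fst_conv snd_conv FA by (simp add: D_op_def)
    qed (use t in auto)
    ultimately show ?thesis by blast
  qed
  show ?thesis
    unfolding pie_solution_def using D_op_Y_space[OF u0] fst_0 snd_0 D_op_Y_space[OF uX] step by blast
qed

text \<open>Two derivatives of T v are at hand: T w in W22, where w is the derivative of v, and A v
  in L2, from the PIE. Both being derivatives in L2, they agree almost everywhere. Differentiability
  of v itself is what supplies the stronger norm.\<close>

lemma pie_solution_imp_pde_solution:
  assumes A: "A0 \<in> carrier_mat n n" "A1 \<in> carrier_mat n n" "A2 \<in> carrier_mat n n"
    and sol: "pie_solution a b m n (That) (Ahat A0 A1 A2) Kop v v0"
  shows "pde_solution a b n A0 A1 A2 E F (\<lambda>t. Top (v t)) (Top v0)"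
proof -
  have v0: "v0 \<in> Y" and init: "fst (v 0) = fst v0" "ae_eq a b (snd (v 0)) (snd v0)" and vY: "\<And>t. 0 \<le> t \<Longrightarrow> v t \<in> Y"
    using sol by (auto simp: pie_solution_def)
  have Y_RL2: "y \<in> RL2 a b m n" if "y \<in> Y" for y using that by (simp add: Y_space_def)
  note vR = Y_RL2[OF vY]
  have init_T: "ae_eq a b (Top (v 0)) (Top v0)"
  proof (rule ae_eq_on_interval)
    fix x assume x: "x \<in> {a..b}"
    have "coef (v 0) = coef v0" by (rule coef_cong[OF vR Y_RL2[OF v0] init]) simp
    then show "Top (v 0) x = Top v0 x"
      using T_op_eq[OF vR x] T_op_eq[OF Y_RL2[OF v0] x]
        reconstruction_ae_cong[OF RL2D(2)[OF vR] RL2D(2)[OF Y_RL2[OF v0]] init(2) x] by simp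
  qed
  have step: "\<exists>u_t. has_W22_deriv a b n (\<lambda>s. Top (v s)) u_t t \<and>
      ae_eq a b u_t (\<lambda>x. eval_pmat A0 x *\<^sub>v Top (v t) x
         + eval_pmat A1 x *\<^sub>v weak_deriv a b n (Top (v t)) x + eval_pmat A2 x *\<^sub>v weak_deriv2 a b n (Top (v t)) x)"
    if t: "0 \<le> t" for t
  proof -
    let ?F = "at t within {0..}" and ?r = "\<lambda>s. s - t"
    let ?A = "Aop A0 A1 A2 (v t)"
    let ?rhs = "\<lambda>x. eval_pmat A0 x *\<^sub>v Top (v t) x
         + eval_pmat A1 x *\<^sub>v weak_deriv a b n (Top (v t)) x + eval_pmat A2 x *\<^sub>v weak_deriv2 a b n (Top (v t)) x"
    obtain w where d: "has_RL2_deriv a b m n v w t"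
      and dT: "has_RL2_deriv a b m n (\<lambda>s. That (v s)) (Ahat A0 A1 A2 (v t)) t"
      using sol t by (auto simp: pie_solution_def)
    have w: "w \<in> RL2 a b m n" using d by (simp add: has_RL2_deriv_def)
    have AL2: "?A \<in> L2_vec a b n" by (rule A_op_L2[OF vR[OF t] A])
    have A_small: "L2_small a b ?F ?r (\<lambda>s x. Top (v s) x $ i - Top (v t) x $ i - (s - t) * ?A x $ i)" if "i < n" for i
    proof -
      have "Ahat A0 A1 A2 (v t) \<in> RL2 a b m n" using AL2 by (simp add: A_hat_def RL2_def)
      moreover have "That (v s) \<in> RL2 a b m n" if "0 \<le> s" for s
        using T_op_L2[OF vR[OF that]] RL2D(1)[OF vR[OF that]] by (simp add: T_hat_def RL2_def)
      ultimately have "\<forall>i<n. L2_small a b ?F ?r (\<lambda>s x. snd (That (v s)) x $ i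
          - snd (That (v t)) x $ i - (s - t) * snd (Ahat A0 A1 A2 (v t)) x $ i)"
        using dT has_RL2_deriv_iff[where v = "\<lambda>s. That (v s)"] t by blast
      with that show ?thesis by (simp add: T_hat_def A_hat_def)
    qed
    have "ae_eq a b (Top w) ?A"
    proof (rule ae_eqI[where k = n])
      fix i assume i: "i < n"
      let ?k = "\<lambda>x. Top w x $ i - ?A x $ i"
      note T_small = T_op_small[OF vR w t d i]
      \<comment> \<open>Both remainders contain the increment of T v from t to s, which cancels in
        their difference.\<close>
      have "L2_small a b ?F ?r (\<lambda>s x. (s - t) * ?k x)"
      proof (rule L2_small_cong)
        have "L2_small a b ?F ?r (\<lambda>s x. - ((Top (v s) x - Top (v t) x - (s - t) \<cdot>\<^sub>v Top w x) $ i))"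
          using T_small by (simp add: L2_small_def square_integrable_def)
        from L2_small_add[OF A_small[OF i] this]
        show "L2_small a b ?F ?r (\<lambda>s x. (Top (v s) x $ i - Top (v t) x $ i - (s - t) * ?A x $ i)
            + - ((Top (v s) x - Top (v t) x - (s - t) \<cdot>\<^sub>v Top w x) $ i))" .
        show "\<forall>\<^sub>F s in ?F. \<forall>x\<in>{a..b}. (Top (v s) x $ i - Top (v t) x $ i - (s - t) * ?A x $ i)
            + - ((Top (v s) x - Top (v t) x - (s - t) \<cdot>\<^sub>v Top w x) $ i) = (s - t) * ?k x"
        proof (intro always_eventually allI ballI)
          fix s x assume x: "x \<in> {a..b}"
          show "(Top (v s) x $ i - Top (v t) x $ i - (s - t) * ?A x $ i)
            + - ((Top (v s) x - Top (v t) x - (s - t) \<cdot>\<^sub>v Top w x) $ i) = (s - t) * ?k x"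
            using i carrier_vecD[OF L2_vec_carrier[OF T_op_L2[OF w] x]] carrier_vecD[OF L2_vec_carrier[OF T_op_L2[OF vR[OF t]] x]]
            by (simp add: algebra_simps)
        qed
      qed
      moreover have "square_integrable a b ?k"
        by (intro square_integrable_diff L2_vec_square_integrable[where k = n] T_op_L2 w AL2 i)
      moreover have "\<forall>\<^sub>F s in ?F. s - t \<noteq> 0" by (simp add: eventually_at_filter)
      moreover have "?F \<noteq> bot"
      proof -
        have "at_right t \<le> ?F" by (rule at_le) (use t in auto)
        then show ?thesis using trivial_limit_at_right_real[of t] by (auto simp: bot_unique)
      qed
      ultimately have "AE x in lebesgue_on {a..b}. ?k x = 0" by (rule L2_small_linear_imp_AE_zero)
      then show "AE x in lebesgue_on {a..b}. Top w x $ i = ?A x $ i" by simp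
    qed (use L2_vec_carrier[OF T_op_L2[OF w]] L2_vec_carrier[OF AL2] in auto)
    moreover have "ae_eq a b ?A ?rhs"
      by (rule A_op_ae_eq[OF ae_eq_refl ae_eq_sym[OF T_op_weak_deriv[OF vR[OF t]]] ae_eq_sym[OF T_op_weak_deriv2[OF vR[OF t]]]])
    ultimately have "ae_eq a b (Top w) ?rhs"
      by (rule ae_eq_trans)
    with T_op_W22_deriv[OF vR w t d] show ?thesis by blast
  qed
  show ?thesis
    unfolding pde_solution_def using T_op_in_X_space[OF v0] init_T T_op_in_X_space[OF vY] step by blast
qed

end

theorem theorem14:
  fixes a b :: real and n m :: nat
    and A0 A1 A2 F :: "real poly mat" and E J :: "real mat" and F3 :: "real \<Rightarrow> real mat"
  assumes "a < b" and "n \<ge> 1" and "m \<le> 2 * n"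
    and "A0 \<in> carrier_mat n n" and "A1 \<in> carrier_mat n n" and "A2 \<in> carrier_mat n n"
    and "E \<in> carrier_mat (2 * n) (4 * n)" and "F \<in> carrier_mat (2 * n) n"
    and "J \<in> carrier_mat (2 * n) (2 * n)" and "invertible_mat J"
    and "vec_space.rank (2 * n - m) (G_mat a b n (E1 n m J E) (F1 n m J F)) = 2 * n - m"
    and "G_mat a b n (E2 m J E) (F2 m J F) = 0\<^sub>m m (2 * n)"
    and "F3 \<in> L2_mat a b m n"
    and "invertible_mat (G_hat a b n m J E F F3)"
  shows "(\<forall>u u0. pde_solution a b n A0 A1 A2 E F u u0 \<longrightarrow>
            pie_solution a b m n
              (T_hat a b n m J E F F3) (A_hat a b n m J E F F3 A0 A1 A2) (K_op a b n m J E F)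
              (\<lambda>t. D_op a b n m F3 (u t)) (D_op a b n m F3 u0))
       \<and> (\<forall>v v0. pie_solution a b m n
              (T_hat a b n m J E F F3) (A_hat a b n m J E F F3 A0 A1 A2) (K_op a b n m J E F)
              v v0 \<longrightarrow>
            pde_solution a b n A0 A1 A2 E F
              (\<lambda>t. T_op a b n m J E F F3 (v t)) (T_op a b n m J E F F3 v0))"
proof -
  interpret boundary_data a b n m J E F F3
    using assms by unfold_locales
  show ?thesis
    using pde_solution_imp_pie_solution pie_solution_imp_pde_solution assms(4-6) by blast
qed

end
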